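(* For every derivator $\mathscr D$ and every $n\ge 2$ there is a morphism of derivators $d\colon\mathscr D^{\square^n_{\le n-1}}\to\mathscr D^{\square}$ such that for every $X\in\mathscr D^{\square^n_{\le n-1}}$ the square $d(X)\in\mathscr D^\square$ is cocartesian with underlying diagram $$\begin{array}{ccc}\operatorname{colim}_{\square^{n-1}_{\le n-2}}j_0^*X&\to&X_{\infty,0}\\ \downarrow&&\downarrow\\ \operatorname{colim}_{\square^{n-1}_{\le n-2}}j_1^*X&\to&\operatorname{colim}_{\square^n_{\le n-1}}X.\end{array}$$
   Context: Derivators. $\mathrm{Cat}$ is the 2-category of small categories, $\mathrm{CAT}$ that of not necessarily small categories, $\mathbb 1$ the terminal category. A prederivator is a strict 2-functor $\mathscr D\colon\mathrm{Cat}^{\mathrm{op}}\to\mathrm{CAT}$ (1-cells reversed); write $u^*=\mathscr D(u)$. It is a derivator if: (Der1) $\mathscr D(\coprod_i A_i)\to\prod_i\mathscr D(A_i)$ is an equivalence; (Der2) a morphism $f$ of $\mathscr D(A)$ is invertible iff $f_a:=a^*f$ is invertible for all objects $a\colon\mathbb 1\to A$; (Der3) every $u^*$ has a left adjoint $u_!$ and a right adjoint $u_*$; (Der4) for $u\colon A\to B$ and $b\in B$ the canonical maps $\operatorname{colim}_{(u/b)}p^*X\to (u_!X)_b$ and $(u_*X)_b\to\lim_{(b/u)}q^*X$ are isomorphisms, where $p\colon(u/b)\to A$, $q\colon (b/u)\to A$ are the projections and $\operatorname{colim}_A=\pi_!$, $\lim_A=\pi_*$ for $\pi\colon A\to\mathbb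 1$. Morphisms of derivators are pseudo-natural transformations; natural transformations between them are modifications. For $A\in\mathrm{Cat}$, $\mathscr D^A$ is the derivator $B\mapsto\mathscr D(A\times B)$; a functor $u\colon A\to B$ induces morphisms of derivators $u^*\colon\mathscr D^B\to\mathscr D^A$ and $u_!,u_*\colon\mathscr D^A\to\mathscr D^B$. "$X\in\mathscr D^A$" means $X\in\mathscr D^A(B)$ for some $B\in\mathrm{Cat}$ (objects with parameters), and $X_a=a^*X$. The underlying diagram of $X\in\mathscr D^A$ is the functor $a\mapsto X_a$ on $A$. Cubes. $\square^n$ is the power set of $\{1,\dots,n\}$ ordered by inclusion, identified with $[1]^n$, $[1]=(0<1)$; $\square=\square^2$. $\square^n_{\le k}$ is the full subposet of subsets with at most $k$ elements; $\square^n_{\le n-1}$ is the punctured $n$-cube. For $k=0,1$ the functor $j_k\colon\square^{n-1}_{\le n-2}\to\square^n_{\le n-1}$ is $a\mapsto(a,k)$ (appending $k$ as last coordinate), and $(\infty,0)$ denotes $(1,\dots,1,0)\in\square^n_{\le n-1}$. A square in $\mathscr D^{\square}$ is cocartesian if it lies in the essential image of left Kan extension along the inclusion $\square_{\le 1}\to\square$. *)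

theory Defs
  imports "HOL-Library.FuncSet"
begin

section \<open>Categories, functors, natural transformations\<close>

record ('o, 'm) cat =
  ob :: "'o set"
  ar :: "'m set"
  src :: "'m \<Rightarrow> 'o"
  tgt :: "'m \<Rightarrow> 'o"
  idt :: "'o \<Rightarrow> 'm"
  cmp :: "'m \<Rightarrow> 'm \<Rightarrow> 'm"

abbreviation cmp_in :: "'m \<Rightarrow> ('o, 'm) cat \<Rightarrow> 'm \<Rightarrow> 'm"  ("(_ \<cdot>\<^bsub>_\<^esub>/ _)" [66, 0, 65] 65)
  where "g \<cdot>\<^bsub>C\<^esub> f \<equiv> cmp C g f"

definition hom :: "('o, 'm) cat \<Rightarrow> 'o \<Rightarrow> 'o \<Rightarrow> 'm set" where
  "hom C x y = {f \<in> ar C. src C f = x \<and> tgt C f = y}"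

definition category :: "('o, 'm) cat \<Rightarrow> bool" where
  "category C \<longleftrightarrow>
     (\<forall>f \<in> ar C. src C f \<in> ob C \<and> tgt C f \<in> ob C) \<and>
     (\<forall>x \<in> ob C. idt C x \<in> hom C x x) \<and>
     (\<forall>f \<in> ar C. \<forall>g \<in> ar C. tgt C f = src C g \<longrightarrow> g \<cdot>\<^bsub>C\<^esub> f \<in> hom C (src C f) (tgt C g)) \<and>
     (\<forall>f \<in> ar C. f \<cdot>\<^bsub>C\<^esub> idt C (src C f) = f \<and> idt C (tgt C f) \<cdot>\<^bsub>C\<^esub> f = f) \<and>
     (\<forall>f \<in> ar C. \<forall>g \<in> ar C. \<forall>h \<in> ar C. tgt C f = src C g \<longrightarrow> tgt C g = src C h \<longrightarrow>
        h \<cdot>\<^bsub>C\<^esub> (g \<cdot>\<^bsub>C\<^esub> f) = (h \<cdot>\<^bsub>C\<^esub> g) \<cdot>\<^bsub>C\<^esub> f)"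

definition is_iso :: "('o, 'm) cat \<Rightarrow> 'm \<Rightarrow> bool" where
  "is_iso C f \<longleftrightarrow> f \<in> ar C \<and>
     (\<exists>g \<in> hom C (tgt C f) (src C f).
        g \<cdot>\<^bsub>C\<^esub> f = idt C (src C f) \<and> f \<cdot>\<^bsub>C\<^esub> g = idt C (tgt C f))"

text \<open>
  Functors and natural transformations are required to be extensional (\<open>undefined\<close> outside their
  domain category), so that equality in HOL is equality of 1-cells and 2-cells.  This matters since
  a prederivator is a strict 2-functor.
\<close>

record ('o, 'm, 'p, 'q) ftor =
  fo :: "'o \<Rightarrow> 'p"
  fa :: "'m \<Rightarrow> 'q"

definition is_functor :: "('o, 'm) cat \<Rightarrow> ('p, 'q) cat \<Rightarrow> ('o, 'm, 'p, 'q) ftor \<Rightarrow> bool" where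
  "is_functor C E F \<longleftrightarrow>
     fo F \<in> ob C \<rightarrow>\<^sub>E ob E \<and>
     fa F \<in> ar C \<rightarrow>\<^sub>E ar E \<and>
     (\<forall>f \<in> ar C. src E (fa F f) = fo F (src C f) \<and> tgt E (fa F f) = fo F (tgt C f)) \<and>
     (\<forall>x \<in> ob C. fa F (idt C x) = idt E (fo F x)) \<and>
     (\<forall>f \<in> ar C. \<forall>g \<in> ar C. tgt C f = src C g \<longrightarrow>
        fa F (g \<cdot>\<^bsub>C\<^esub> f) = fa F g \<cdot>\<^bsub>E\<^esub> fa F f)"

definition mk_ftor :: "('o, 'm) cat \<Rightarrow> ('o \<Rightarrow> 'p) \<Rightarrow> ('m \<Rightarrow> 'q) \<Rightarrow> ('o, 'm, 'p, 'q) ftor" where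
  "mk_ftor C F0 F1 = \<lparr>fo = restrict F0 (ob C), fa = restrict F1 (ar C)\<rparr>"

definition id_ftor :: "('o, 'm) cat \<Rightarrow> ('o, 'm, 'o, 'm) ftor" where
  "id_ftor C = mk_ftor C (\<lambda>x. x) (\<lambda>f. f)"

text \<open>\<open>comp_ftor C G F\<close> is \<open>G \<circ> F\<close>, where \<open>C\<close> is the domain of \<open>F\<close>.\<close>

definition comp_ftor :: "('o, 'm) cat \<Rightarrow> ('p, 'q, 'r, 's) ftor \<Rightarrow> ('o, 'm, 'p, 'q) ftor
    \<Rightarrow> ('o, 'm, 'r, 's) ftor" where
  "comp_ftor C G F = mk_ftor C (\<lambda>x. fo G (fo F x)) (\<lambda>f. fa G (fa F f))"

definition const_ftor :: "('o, 'm) cat \<Rightarrow> ('p, 'q) cat \<Rightarrow> 'p \<Rightarrow> ('o, 'm, 'p, 'q) ftor" where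
  "const_ftor C E y = mk_ftor C (\<lambda>_. y) (\<lambda>_. idt E y)"

definition is_nt :: "('o, 'm) cat \<Rightarrow> ('p, 'q) cat \<Rightarrow> ('o, 'm, 'p, 'q) ftor \<Rightarrow> ('o, 'm, 'p, 'q) ftor
    \<Rightarrow> ('o \<Rightarrow> 'q) \<Rightarrow> bool" where
  "is_nt C E F G \<alpha> \<longleftrightarrow>
     is_functor C E F \<and> is_functor C E G \<and>
     \<alpha> \<in> (\<Pi>\<^sub>E x \<in> ob C. hom E (fo F x) (fo G x)) \<and>
     (\<forall>f \<in> ar C. \<alpha> (tgt C f) \<cdot>\<^bsub>E\<^esub> fa F f = fa G f \<cdot>\<^bsub>E\<^esub> \<alpha> (src C f))"

definition is_nt_iso :: "('o, 'm) cat \<Rightarrow> ('p, 'q) cat \<Rightarrow> ('o, 'm, 'p, 'q) ftor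
    \<Rightarrow> ('o, 'm, 'p, 'q) ftor \<Rightarrow> ('o \<Rightarrow> 'q) \<Rightarrow> bool" where
  "is_nt_iso C E F G \<alpha> \<longleftrightarrow> is_nt C E F G \<alpha> \<and> (\<forall>x \<in> ob C. is_iso E (\<alpha> x))"

definition id_nt :: "('o, 'm) cat \<Rightarrow> ('p, 'q) cat \<Rightarrow> ('o, 'm, 'p, 'q) ftor \<Rightarrow> 'o \<Rightarrow> 'q" where
  "id_nt C E F = (\<lambda>x \<in> ob C. idt E (fo F x))"

definition vcomp :: "('o, 'm) cat \<Rightarrow> ('p, 'q) cat \<Rightarrow> ('o \<Rightarrow> 'q) \<Rightarrow> ('o \<Rightarrow> 'q) \<Rightarrow> 'o \<Rightarrow> 'q" where
  "vcomp C E \<beta> \<alpha> = (\<lambda>x \<in> ob C. \<beta> x \<cdot>\<^bsub>E\<^esub> \<alpha> x)"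

text \<open>
  Horizontal composite \<open>\<beta> * \<alpha> : H \<circ> F \<Rightarrow> H' \<circ> F'\<close> of \<open>\<alpha> : F \<Rightarrow> F'\<close> and \<open>\<beta> : H \<Rightarrow> H'\<close>,
  where \<open>F, F'\<close> have domain \<open>C\<close> and \<open>H, H'\<close> have codomain \<open>E\<close>.
\<close>

definition hcomp :: "('o, 'm) cat \<Rightarrow> ('r, 's) cat \<Rightarrow> ('o, 'm, 'p, 'q) ftor
    \<Rightarrow> ('p, 'q, 'r, 's) ftor \<Rightarrow> ('p \<Rightarrow> 's) \<Rightarrow> ('o \<Rightarrow> 'q) \<Rightarrow> 'o \<Rightarrow> 's" where
  "hcomp C E F H' \<beta> \<alpha> = (\<lambda>x \<in> ob C. fa H' (\<alpha> x) \<cdot>\<^bsub>E\<^esub> \<beta> (fo F x))"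

definition is_equivalence :: "('o, 'm) cat \<Rightarrow> ('p, 'q) cat \<Rightarrow> ('o, 'm, 'p, 'q) ftor \<Rightarrow> bool" where
  "is_equivalence C E F \<longleftrightarrow> is_functor C E F \<and>
     (\<exists>G \<eta> \<epsilon>. is_functor E C G \<and>
        is_nt_iso C C (id_ftor C) (comp_ftor C G F) \<eta> \<and>
        is_nt_iso E E (comp_ftor E F G) (id_ftor E) \<epsilon>)"

text \<open>\<open>adjunction C E F G \<eta> \<epsilon>\<close>: the functor \<open>F : C \<rightarrow> E\<close> is left adjoint to \<open>G : E \<rightarrow> C\<close>.\<close>

definition adjunction :: "('o, 'm) cat \<Rightarrow> ('p, 'q) cat \<Rightarrow> ('o, 'm, 'p, 'q) ftor
    \<Rightarrow> ('p, 'q, 'o, 'm) ftor \<Rightarrow> ('o \<Rightarrow> 'm) \<Rightarrow> ('p \<Rightarrow> 'q) \<Rightarrow> bool" where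
  "adjunction C E F G \<eta> \<epsilon> \<longleftrightarrow>
     is_functor C E F \<and> is_functor E C G \<and>
     is_nt C C (id_ftor C) (comp_ftor C G F) \<eta> \<and>
     is_nt E E (comp_ftor E F G) (id_ftor E) \<epsilon> \<and>
     (\<forall>X \<in> ob C. \<epsilon> (fo F X) \<cdot>\<^bsub>E\<^esub> fa F (\<eta> X) = idt E (fo F X)) \<and>
     (\<forall>Y \<in> ob E. fa G (\<epsilon> Y) \<cdot>\<^bsub>C\<^esub> \<eta> (fo G Y) = idt C (fo G Y))"

text \<open>The product of the categories \<open>C i\<close>, \<open>i \<in> I\<close>.\<close>

definition Prod_cat :: "'i set \<Rightarrow> ('i \<Rightarrow> ('o, 'm) cat) \<Rightarrow> ('i \<Rightarrow> 'o, 'i \<Rightarrow> 'm) cat" where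
  "Prod_cat I C =
    \<lparr>ob = (\<Pi>\<^sub>E i \<in> I. ob (C i)),
     ar = (\<Pi>\<^sub>E i \<in> I. ar (C i)),
     src = (\<lambda>f. \<lambda>i \<in> I. src (C i) (f i)),
     tgt = (\<lambda>f. \<lambda>i \<in> I. tgt (C i) (f i)),
     idt = (\<lambda>x. \<lambda>i \<in> I. idt (C i) (x i)),
     cmp = (\<lambda>g f. \<lambda>i \<in> I. g i \<cdot>\<^bsub>C i\<^esub> f i)\<rparr>"


section \<open>The 2-category of small categories\<close>

text \<open>
  Objects and morphisms of small categories live in a fixed type \<open>'a uni\<close>.  The parameter \<open>'a\<close> is
  arbitrary; the other constructors supply codes for pairs and for the vertices of cubes, so that
  all diagram categories needed below can be formed inside \<open>'a uni\<close>.
\<close>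

datatype 'a uni = Atom 'a | Vertex "nat set" | Pair (pfst: "'a uni") (psnd: "'a uni")

type_synonym 'a scat = "('a uni, 'a uni) cat"
type_synonym 'a sftor = "('a uni, 'a uni, 'a uni, 'a uni) ftor"
type_synonym 'a snt = "'a uni \<Rightarrow> 'a uni"

text \<open>
  The sets that count as small form an arbitrary family closed under subsets, images and small
  unions and containing an infinite set.  The small sets of a Grothendieck universe containing an
  infinite set are an instance; closure under power sets is not required, so that such families
  exist for every \<open>'a\<close>.
\<close>

definition smallness :: "('a uni set \<Rightarrow> bool) \<Rightarrow> bool" where
  "smallness small \<longleftrightarrow>
     (\<forall>X Y. small X \<longrightarrow> Y \<subseteq> X \<longrightarrow> small Y) \<and>
     (\<forall>X (f :: 'a uni \<Rightarrow> 'a uni). small X \<longrightarrow> small (f ` X)) \<and>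
     (\<forall>I (X :: 'a uni \<Rightarrow> 'a uni set). small I \<longrightarrow> (\<forall>i \<in> I. small (X i)) \<longrightarrow> small (\<Union>i \<in> I. X i)) \<and>
     (\<exists>X. small X \<and> infinite X)"

definition small_cat :: "('a uni set \<Rightarrow> bool) \<Rightarrow> 'a scat \<Rightarrow> bool" where
  "small_cat small A \<longleftrightarrow> category A \<and> small (ob A) \<and> small (ar A)"

text \<open>A set of subsets of \<open>nat\<close>, ordered by inclusion and regarded as a category.\<close>

definition poset_cat :: "nat set set \<Rightarrow> 'a scat" where
  "poset_cat P =
    \<lparr>ob = Vertex ` P,
     ar = {Pair (Vertex S) (Vertex T) | S T. S \<in> P \<and> T \<in> P \<and> S \<subseteq> T},
     src = pfst,
     tgt = psnd,
     idt = (\<lambda>x. Pair x x),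
     cmp = (\<lambda>g f. Pair (pfst f) (psnd g))\<rparr>"

text \<open>
  \<open>cube_le n k\<close> is \<open>\<square>\<^sup>n\<close> truncated to subsets with at most \<open>k\<close> elements.  A subset corresponds to the
  point of \<open>[1]\<^sup>n\<close> whose \<open>i\<close>-th coordinate is \<open>1\<close> iff \<open>i\<close> belongs to the subset.
\<close>

definition cube_le :: "nat \<Rightarrow> nat \<Rightarrow> 'a scat" where
  "cube_le n k = poset_cat {S. S \<subseteq> {1..n} \<and> card S \<le> k}"

definition cube :: "nat \<Rightarrow> 'a scat" where
  "cube n = poset_cat (Pow {1..n})"

abbreviation square :: "'a scat" where
  "square \<equiv> cube 2"

definition punctured :: "nat \<Rightarrow> 'a scat" where
  "punctured n = cube_le n (n - 1)"

definition star :: "'a uni" where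
  "star = Vertex {}"

definition one :: "'a scat" where
  "one = poset_cat {{}}"

definition point :: "'a scat \<Rightarrow> 'a uni \<Rightarrow> 'a sftor" where
  "point A a = const_ftor one A a"

definition to_one :: "'a scat \<Rightarrow> 'a sftor" where
  "to_one A = const_ftor A one star"

definition coprod_cat :: "'a uni set \<Rightarrow> ('a uni \<Rightarrow> 'a scat) \<Rightarrow> 'a scat" where
  "coprod_cat I A =
    \<lparr>ob = {Pair i a | i a. i \<in> I \<and> a \<in> ob (A i)},
     ar = {Pair i f | i f. i \<in> I \<and> f \<in> ar (A i)},
     src = (\<lambda>p. Pair (pfst p) (src (A (pfst p)) (psnd p))),
     tgt = (\<lambda>p. Pair (pfst p) (tgt (A (pfst p)) (psnd p))),
     idt = (\<lambda>p. Pair (pfst p) (idt (A (pfst p)) (psnd p))),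
     cmp = (\<lambda>q p. Pair (pfst p) (psnd q \<cdot>\<^bsub>A (pfst p)\<^esub> psnd p))\<rparr>"

definition coprod_inj :: "('a uni \<Rightarrow> 'a scat) \<Rightarrow> 'a uni \<Rightarrow> 'a sftor" where
  "coprod_inj A i = mk_ftor (A i) (Pair i) (Pair i)"

definition prod_cat :: "'a scat \<Rightarrow> 'a scat \<Rightarrow> 'a scat" (infixr "\<times>\<^sub>c" 80) where
  "A \<times>\<^sub>c B =
    \<lparr>ob = {Pair a b | a b. a \<in> ob A \<and> b \<in> ob B},
     ar = {Pair f g | f g. f \<in> ar A \<and> g \<in> ar B},
     src = (\<lambda>p. Pair (src A (pfst p)) (src B (psnd p))),
     tgt = (\<lambda>p. Pair (tgt A (pfst p)) (tgt B (psnd p))),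
     idt = (\<lambda>p. Pair (idt A (pfst p)) (idt B (psnd p))),
     cmp = (\<lambda>q p. Pair (pfst q \<cdot>\<^bsub>A\<^esub> pfst p) (psnd q \<cdot>\<^bsub>B\<^esub> psnd p))\<rparr>"

definition proj2 :: "'a scat \<Rightarrow> 'a scat \<Rightarrow> 'a sftor" where
  "proj2 A B = mk_ftor (A \<times>\<^sub>c B) psnd psnd"

text \<open>In the following two definitions \<open>A\<close> and \<open>B\<close> are the domains of the two factors.\<close>

definition prod_ftor :: "'a scat \<Rightarrow> 'a scat \<Rightarrow> 'a sftor \<Rightarrow> 'a sftor \<Rightarrow> 'a sftor" where
  "prod_ftor A B u v = mk_ftor (A \<times>\<^sub>c B)
     (\<lambda>p. Pair (fo u (pfst p)) (fo v (psnd p)))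
     (\<lambda>p. Pair (fa u (pfst p)) (fa v (psnd p)))"

definition prod_nt :: "'a scat \<Rightarrow> 'a scat \<Rightarrow> 'a snt \<Rightarrow> 'a snt \<Rightarrow> 'a snt" where
  "prod_nt A B \<alpha> \<beta> = (\<lambda>p \<in> ob (A \<times>\<^sub>c B). Pair (\<alpha> (pfst p)) (\<beta> (psnd p)))"

text \<open>
  For an object \<open>a\<close> of \<open>A\<close>, the functor \<open>a \<times> B : B \<rightarrow> A \<times> B\<close>, and for a morphism \<open>e\<close> of \<open>A\<close>
  the induced natural transformation between such functors.
\<close>

definition slice_at :: "'a scat \<Rightarrow> 'a scat \<Rightarrow> 'a uni \<Rightarrow> 'a sftor" where
  "slice_at A B a = mk_ftor B (Pair a) (Pair (idt A a))"

definition slice_nt :: "'a scat \<Rightarrow> 'a uni \<Rightarrow> 'a snt" where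
  "slice_nt B e = (\<lambda>b \<in> ob B. Pair e (idt B b))"

text \<open>
  The comma categories \<open>(u/b)\<close>, with objects the pairs \<open>(a, f : u a \<rightarrow> b)\<close>, and \<open>(b/u)\<close>, with objects
  the pairs \<open>(a, f : b \<rightarrow> u a)\<close>.  A morphism \<open>h : x \<rightarrow> y\<close> is coded as \<open>Pair (Pair x y) h\<close>, since \<open>h\<close>
  alone does not determine its source and target.
\<close>

definition comma_over :: "'a scat \<Rightarrow> 'a scat \<Rightarrow> 'a sftor \<Rightarrow> 'a uni \<Rightarrow> 'a scat" where
  "comma_over A B u b =
    (let obs = {Pair a f | a f. a \<in> ob A \<and> f \<in> hom B (fo u a) b} in
    \<lparr>ob = obs,
     ar = {Pair (Pair x y) h | x y h. x \<in> obs \<and> y \<in> obs \<and> h \<in> hom A (pfst x) (pfst y) \<and>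
             psnd y \<cdot>\<^bsub>B\<^esub> fa u h = psnd x},
     src = (\<lambda>e. pfst (pfst e)),
     tgt = (\<lambda>e. psnd (pfst e)),
     idt = (\<lambda>x. Pair (Pair x x) (idt A (pfst x))),
     cmp = (\<lambda>e d. Pair (Pair (pfst (pfst d)) (psnd (pfst e))) (psnd e \<cdot>\<^bsub>A\<^esub> psnd d))\<rparr>)"

definition comma_under :: "'a scat \<Rightarrow> 'a scat \<Rightarrow> 'a sftor \<Rightarrow> 'a uni \<Rightarrow> 'a scat" where
  "comma_under A B u b =
    (let obs = {Pair a f | a f. a \<in> ob A \<and> f \<in> hom B b (fo u a)} in
    \<lparr>ob = obs,
     ar = {Pair (Pair x y) h | x y h. x \<in> obs \<and> y \<in> obs \<and> h \<in> hom A (pfst x) (pfst y) \<and>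
             fa u h \<cdot>\<^bsub>B\<^esub> psnd x = psnd y},
     src = (\<lambda>e. pfst (pfst e)),
     tgt = (\<lambda>e. psnd (pfst e)),
     idt = (\<lambda>x. Pair (Pair x x) (idt A (pfst x))),
     cmp = (\<lambda>e d. Pair (Pair (pfst (pfst d)) (psnd (pfst e))) (psnd e \<cdot>\<^bsub>A\<^esub> psnd d))\<rparr>)"

text \<open>
  For \<open>K\<close> one of these comma categories: the projection to \<open>A\<close>, and the components of the canonical
  natural transformation, \<open>u p \<Rightarrow> b \<pi>\<close> for \<open>(u/b)\<close> and \<open>b \<pi> \<Rightarrow> u q\<close> for \<open>(b/u)\<close>.
\<close>

definition comma_proj :: "'a scat \<Rightarrow> 'a sftor" where
  "comma_proj K = mk_ftor K pfst psnd"

definition comma_nt :: "'a scat \<Rightarrow> 'a snt" where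
  "comma_nt K = (\<lambda>x \<in> ob K. psnd x)"


section \<open>Prederivators and Kan extensions\<close>

text \<open>
  \<open>D0 D A\<close> is the category \<open>D(A)\<close>.  For \<open>u : A \<rightarrow> B\<close>, \<open>D1 D A B u : D(B) \<rightarrow> D(A)\<close> is \<open>u\<^sup>*\<close>.  For
  \<open>\<alpha> : u \<Rightarrow> v\<close>, \<open>D2 D A B u v \<alpha> : u\<^sup>* \<Rightarrow> v\<^sup>*\<close> is \<open>\<alpha>\<^sup>*\<close>.
\<close>

record ('a, 'o, 'm) prederiv =
  D0 :: "'a scat \<Rightarrow> ('o, 'm) cat"
  D1 :: "'a scat \<Rightarrow> 'a scat \<Rightarrow> 'a sftor \<Rightarrow> ('o, 'm, 'o, 'm) ftor"
  D2 :: "'a scat \<Rightarrow> 'a scat \<Rightarrow> 'a sftor \<Rightarrow> 'a sftor \<Rightarrow> 'a snt \<Rightarrow> 'o \<Rightarrow> 'm"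

definition prederivator :: "('a uni set \<Rightarrow> bool) \<Rightarrow> ('a, 'o, 'm) prederiv \<Rightarrow> bool" where
  "prederivator small D \<longleftrightarrow>
     (\<forall>A. small_cat small A \<longrightarrow> category (D0 D A)) \<and>
     (\<forall>A B u. small_cat small A \<longrightarrow> small_cat small B \<longrightarrow> is_functor A B u \<longrightarrow>
        is_functor (D0 D B) (D0 D A) (D1 D A B u)) \<and>
     (\<forall>A. small_cat small A \<longrightarrow> D1 D A A (id_ftor A) = id_ftor (D0 D A)) \<and>
     (\<forall>A B C u v. small_cat small A \<longrightarrow> small_cat small B \<longrightarrow> small_cat small C \<longrightarrow>
        is_functor A B u \<longrightarrow> is_functor B C v \<longrightarrow>
        D1 D A C (comp_ftor A v u) = comp_ftor (D0 D C) (D1 D A B u) (D1 D B C v)) \<and>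
     (\<forall>A B u v \<alpha>. small_cat small A \<longrightarrow> small_cat small B \<longrightarrow> is_nt A B u v \<alpha> \<longrightarrow>
        is_nt (D0 D B) (D0 D A) (D1 D A B u) (D1 D A B v) (D2 D A B u v \<alpha>)) \<and>
     (\<forall>A B u. small_cat small A \<longrightarrow> small_cat small B \<longrightarrow> is_functor A B u \<longrightarrow>
        D2 D A B u u (id_nt A B u) = id_nt (D0 D B) (D0 D A) (D1 D A B u)) \<and>
     (\<forall>A B u v w \<alpha> \<beta>. small_cat small A \<longrightarrow> small_cat small B \<longrightarrow>
        is_nt A B u v \<alpha> \<longrightarrow> is_nt A B v w \<beta> \<longrightarrow>
        D2 D A B u w (vcomp A B \<beta> \<alpha>) =
          vcomp (D0 D B) (D0 D A) (D2 D A B v w \<beta>) (D2 D A B u v \<alpha>)) \<and>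
     (\<forall>A B C u u' v v' \<alpha> \<beta>. small_cat small A \<longrightarrow> small_cat small B \<longrightarrow> small_cat small C \<longrightarrow>
        is_nt A B u u' \<alpha> \<longrightarrow> is_nt B C v v' \<beta> \<longrightarrow>
        D2 D A C (comp_ftor A v u) (comp_ftor A v' u') (hcomp A C u v' \<beta> \<alpha>) =
          hcomp (D0 D C) (D0 D A) (D1 D B C v) (D1 D A B u')
            (D2 D A B u u' \<alpha>) (D2 D B C v v' \<beta>))"

definition is_lan :: "('a, 'o, 'm) prederiv \<Rightarrow> 'a scat \<Rightarrow> 'a scat \<Rightarrow> 'a sftor
    \<Rightarrow> ('o, 'm, 'o, 'm) ftor \<times> ('o \<Rightarrow> 'm) \<times> ('o \<Rightarrow> 'm) \<Rightarrow> bool" where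
  "is_lan D A B u = (\<lambda>(F, \<eta>, \<epsilon>). adjunction (D0 D A) (D0 D B) F (D1 D A B u) \<eta> \<epsilon>)"

definition is_ran :: "('a, 'o, 'm) prederiv \<Rightarrow> 'a scat \<Rightarrow> 'a scat \<Rightarrow> 'a sftor
    \<Rightarrow> ('o, 'm, 'o, 'm) ftor \<times> ('o \<Rightarrow> 'm) \<times> ('o \<Rightarrow> 'm) \<Rightarrow> bool" where
  "is_ran D A B u = (\<lambda>(F, \<eta>, \<epsilon>). adjunction (D0 D B) (D0 D A) (D1 D A B u) F \<eta> \<epsilon>)"

text \<open>
  Chosen Kan extensions \<open>u\<^sub>! \<stileturn> u\<^sup>* \<stileturn> u\<^sub>*\<close> with units and counits; meaningful only if adjoints exist.
\<close>

definition lan :: "('a, 'o, 'm) prederiv \<Rightarrow> 'a scat \<Rightarrow> 'a scat \<Rightarrow> 'a sftor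
    \<Rightarrow> ('o, 'm, 'o, 'm) ftor" where
  "lan D A B u = fst (SOME t. is_lan D A B u t)"

definition lan_unit :: "('a, 'o, 'm) prederiv \<Rightarrow> 'a scat \<Rightarrow> 'a scat \<Rightarrow> 'a sftor \<Rightarrow> 'o \<Rightarrow> 'm" where
  "lan_unit D A B u = fst (snd (SOME t. is_lan D A B u t))"

definition lan_counit :: "('a, 'o, 'm) prederiv \<Rightarrow> 'a scat \<Rightarrow> 'a scat \<Rightarrow> 'a sftor \<Rightarrow> 'o \<Rightarrow> 'm" where
  "lan_counit D A B u = snd (snd (SOME t. is_lan D A B u t))"

definition ran :: "('a, 'o, 'm) prederiv \<Rightarrow> 'a scat \<Rightarrow> 'a scat \<Rightarrow> 'a sftor
    \<Rightarrow> ('o, 'm, 'o, 'm) ftor" where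
  "ran D A B u = fst (SOME t. is_ran D A B u t)"

definition ran_unit :: "('a, 'o, 'm) prederiv \<Rightarrow> 'a scat \<Rightarrow> 'a scat \<Rightarrow> 'a sftor \<Rightarrow> 'o \<Rightarrow> 'm" where
  "ran_unit D A B u = fst (snd (SOME t. is_ran D A B u t))"

definition ran_counit :: "('a, 'o, 'm) prederiv \<Rightarrow> 'a scat \<Rightarrow> 'a scat \<Rightarrow> 'a sftor \<Rightarrow> 'o \<Rightarrow> 'm" where
  "ran_counit D A B u = snd (snd (SOME t. is_ran D A B u t))"

text \<open>The adjoint \<open>u\<^sub>! X \<rightarrow> Y\<close> of \<open>g : X \<rightarrow> u\<^sup>* Y\<close>, and the adjoint \<open>Y \<rightarrow> u\<^sub>* X\<close> of \<open>g : u\<^sup>* Y \<rightarrow> X\<close>.\<close>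

definition lan_adj :: "('a, 'o, 'm) prederiv \<Rightarrow> 'a scat \<Rightarrow> 'a scat \<Rightarrow> 'a sftor \<Rightarrow> 'o \<Rightarrow> 'm \<Rightarrow> 'm" where
  "lan_adj D A B u Y g = lan_counit D A B u Y \<cdot>\<^bsub>D0 D B\<^esub> fa (lan D A B u) g"

definition ran_adj :: "('a, 'o, 'm) prederiv \<Rightarrow> 'a scat \<Rightarrow> 'a scat \<Rightarrow> 'a sftor \<Rightarrow> 'o \<Rightarrow> 'm \<Rightarrow> 'm" where
  "ran_adj D A B u Y g = fa (ran D A B u) g \<cdot>\<^bsub>D0 D B\<^esub> ran_unit D A B u Y"

text \<open>
  The map \<open>colim\<^bsub>(u/b)\<^esub> p\<^sup>* X \<rightarrow> (u\<^sub>! X)\<^sub>b\<close> is adjoint to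
  \<open>p\<^sup>* X \<rightarrow> p\<^sup>* u\<^sup>* u\<^sub>! X \<rightarrow> \<pi>\<^sup>* b\<^sup>* u\<^sub>! X\<close>, and \<open>(u\<^sub>* X)\<^sub>b \<rightarrow> lim\<^bsub>(b/u)\<^esub> q\<^sup>* X\<close> is adjoint to
  \<open>\<pi>\<^sup>* b\<^sup>* u\<^sub>* X \<rightarrow> q\<^sup>* u\<^sup>* u\<^sub>* X \<rightarrow> q\<^sup>* X\<close>.
\<close>

definition der4_colim :: "('a, 'o, 'm) prederiv \<Rightarrow> 'a scat \<Rightarrow> 'a scat \<Rightarrow> 'a sftor \<Rightarrow> 'a uni \<Rightarrow> 'o
    \<Rightarrow> 'm" where
  "der4_colim D A B u b X =
    (let K = comma_over A B u b; p = comma_proj K; \<pi> = to_one K; Y = fo (lan D A B u) X in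
     lan_adj D K one \<pi> (fo (D1 D one B (point B b)) Y)
       (D2 D K B (comp_ftor K u p) (comp_ftor K (point B b) \<pi>) (comma_nt K) Y
          \<cdot>\<^bsub>D0 D K\<^esub> fa (D1 D K A p) (lan_unit D A B u X)))"

definition der4_lim :: "('a, 'o, 'm) prederiv \<Rightarrow> 'a scat \<Rightarrow> 'a scat \<Rightarrow> 'a sftor \<Rightarrow> 'a uni \<Rightarrow> 'o
    \<Rightarrow> 'm" where
  "der4_lim D A B u b X =
    (let K = comma_under A B u b; q = comma_proj K; \<pi> = to_one K; Y = fo (ran D A B u) X in
     ran_adj D K one \<pi> (fo (D1 D one B (point B b)) Y)
       (fa (D1 D K A q) (ran_counit D A B u X)
          \<cdot>\<^bsub>D0 D K\<^esub> D2 D K B (comp_ftor K (point B b) \<pi>) (comp_ftor K u q) (comma_nt K) Y))"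


section \<open>Derivators and their morphisms\<close>

definition der1 :: "('a uni set \<Rightarrow> bool) \<Rightarrow> ('a, 'o, 'm) prederiv \<Rightarrow> bool" where
  "der1 small D \<longleftrightarrow>
     (\<forall>I A. small I \<longrightarrow> (\<forall>i \<in> I. small_cat small (A i)) \<longrightarrow>
        is_equivalence (D0 D (coprod_cat I A)) (Prod_cat I (\<lambda>i. D0 D (A i)))
          (mk_ftor (D0 D (coprod_cat I A))
             (\<lambda>X. \<lambda>i \<in> I. fo (D1 D (A i) (coprod_cat I A) (coprod_inj A i)) X)
             (\<lambda>f. \<lambda>i \<in> I. fa (D1 D (A i) (coprod_cat I A) (coprod_inj A i)) f)))"

definition der2 :: "('a uni set \<Rightarrow> bool) \<Rightarrow> ('a, 'o, 'm) prederiv \<Rightarrow> bool" where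
  "der2 small D \<longleftrightarrow>
     (\<forall>A. small_cat small A \<longrightarrow> (\<forall>f \<in> ar (D0 D A).
        is_iso (D0 D A) f \<longleftrightarrow> (\<forall>a \<in> ob A. is_iso (D0 D one) (fa (D1 D one A (point A a)) f))))"

definition der3 :: "('a uni set \<Rightarrow> bool) \<Rightarrow> ('a, 'o, 'm) prederiv \<Rightarrow> bool" where
  "der3 small D \<longleftrightarrow>
     (\<forall>A B u. small_cat small A \<longrightarrow> small_cat small B \<longrightarrow> is_functor A B u \<longrightarrow>
        (\<exists>t. is_lan D A B u t) \<and> (\<exists>t. is_ran D A B u t))"

definition der4 :: "('a uni set \<Rightarrow> bool) \<Rightarrow> ('a, 'o, 'm) prederiv \<Rightarrow> bool" where
  "der4 small D \<longleftrightarrow>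
     (\<forall>A B u. small_cat small A \<longrightarrow> small_cat small B \<longrightarrow> is_functor A B u \<longrightarrow>
        (\<forall>b \<in> ob B. \<forall>X \<in> ob (D0 D A).
           is_iso (D0 D one) (der4_colim D A B u b X) \<and>
           is_iso (D0 D one) (der4_lim D A B u b X)))"

definition derivator :: "('a uni set \<Rightarrow> bool) \<Rightarrow> ('a, 'o, 'm) prederiv \<Rightarrow> bool" where
  "derivator small D \<longleftrightarrow>
     prederivator small D \<and> der1 small D \<and> der2 small D \<and> der3 small D \<and> der4 small D"

text \<open>\<open>shift D A\<close> is \<open>D\<^sup>A : B \<mapsto> D(A \<times> B)\<close>.\<close>

definition shift :: "('a, 'o, 'm) prederiv \<Rightarrow> 'a scat \<Rightarrow> ('a, 'o, 'm) prederiv" where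
  "shift D A =
    \<lparr>D0 = (\<lambda>B. D0 D (A \<times>\<^sub>c B)),
     D1 = (\<lambda>B C u. D1 D (A \<times>\<^sub>c B) (A \<times>\<^sub>c C) (prod_ftor A B (id_ftor A) u)),
     D2 = (\<lambda>B C u v \<alpha>. D2 D (A \<times>\<^sub>c B) (A \<times>\<^sub>c C)
             (prod_ftor A B (id_ftor A) u) (prod_ftor A B (id_ftor A) v)
             (prod_nt A B (id_nt A A (id_ftor A)) \<alpha>))\<rparr>"

text \<open>
  A morphism \<open>F : D \<rightarrow> E\<close> consists of functors \<open>mo F B : D(B) \<rightarrow> E(B)\<close> and, for \<open>u : B \<rightarrow> C\<close>, natural
  isomorphisms \<open>mc F B C u : F\<^sub>B u\<^sup>* \<Rightarrow> u\<^sup>* F\<^sub>C\<close>, pseudo-natural with respect to 1-cells and 2-cells.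
\<close>

record ('a, 'o, 'm) dmor =
  mo :: "'a scat \<Rightarrow> ('o, 'm, 'o, 'm) ftor"
  mc :: "'a scat \<Rightarrow> 'a scat \<Rightarrow> 'a sftor \<Rightarrow> 'o \<Rightarrow> 'm"

definition morphism :: "('a uni set \<Rightarrow> bool) \<Rightarrow> ('a, 'o, 'm) prederiv \<Rightarrow> ('a, 'o, 'm) prederiv
    \<Rightarrow> ('a, 'o, 'm) dmor \<Rightarrow> bool" where
  "morphism small D E F \<longleftrightarrow>
     (\<forall>B. small_cat small B \<longrightarrow> is_functor (D0 D B) (D0 E B) (mo F B)) \<and>
     (\<forall>B C u. small_cat small B \<longrightarrow> small_cat small C \<longrightarrow> is_functor B C u \<longrightarrow>
        is_nt_iso (D0 D C) (D0 E B)
          (comp_ftor (D0 D C) (mo F B) (D1 D B C u))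
          (comp_ftor (D0 D C) (D1 E B C u) (mo F C)) (mc F B C u)) \<and>
     (\<forall>B. small_cat small B \<longrightarrow> mc F B B (id_ftor B) = id_nt (D0 D B) (D0 E B) (mo F B)) \<and>
     (\<forall>A B C u v. small_cat small A \<longrightarrow> small_cat small B \<longrightarrow> small_cat small C \<longrightarrow>
        is_functor A B u \<longrightarrow> is_functor B C v \<longrightarrow>
        (\<forall>X \<in> ob (D0 D C).
           mc F A C (comp_ftor A v u) X =
             fa (D1 E A B u) (mc F B C v X) \<cdot>\<^bsub>D0 E A\<^esub> mc F A B u (fo (D1 D B C v) X))) \<and>
     (\<forall>B C u v \<alpha>. small_cat small B \<longrightarrow> small_cat small C \<longrightarrow> is_nt B C u v \<alpha> \<longrightarrow>
        (\<forall>X \<in> ob (D0 D C).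
           mc F B C v X \<cdot>\<^bsub>D0 E B\<^esub> fa (mo F B) (D2 D B C u v \<alpha> X) =
             D2 E B C u v \<alpha> (fo (mo F C) X) \<cdot>\<^bsub>D0 E B\<^esub> mc F B C u X))"


section \<open>Underlying diagrams, parametrized colimits, cocartesian squares\<close>

text \<open>
  Throughout, an object \<open>X\<close> of \<open>D\<^sup>A\<close> has a parameter category \<open>B\<close>, that is, \<open>X\<close> is an object of
  \<open>D(A \<times> B)\<close>.  We write \<open>D(B)\<close> for the isomorphic \<open>D(\<one> \<times> B)\<close>: thus \<open>X\<^sub>a\<close> is the restriction of \<open>X\<close>
  along \<open>a \<times> B : B \<rightarrow> A \<times> B\<close>, and \<open>colim\<^sub>A X\<close> is the left Kan extension of \<open>X\<close> along \<open>A \<times> B \<rightarrow> B\<close>.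
\<close>

definition at :: "('a, 'o, 'm) prederiv \<Rightarrow> 'a scat \<Rightarrow> 'a scat \<Rightarrow> 'a uni \<Rightarrow> ('o, 'm, 'o, 'm) ftor" where
  "at D A B a = D1 D B (A \<times>\<^sub>c B) (slice_at A B a)"

definition underlying :: "('a, 'o, 'm) prederiv \<Rightarrow> 'a scat \<Rightarrow> 'a scat \<Rightarrow> 'o
    \<Rightarrow> ('a uni, 'a uni, 'o, 'm) ftor" where
  "underlying D A B X = mk_ftor A
     (\<lambda>a. fo (at D A B a) X)
     (\<lambda>e. D2 D B (A \<times>\<^sub>c B) (slice_at A B (src A e)) (slice_at A B (tgt A e)) (slice_nt B e) X)"

definition colim :: "('a, 'o, 'm) prederiv \<Rightarrow> 'a scat \<Rightarrow> 'a scat \<Rightarrow> ('o, 'm, 'o, 'm) ftor" where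
  "colim D A B = lan D (A \<times>\<^sub>c B) B (proj2 A B)"

definition colim_unit :: "('a, 'o, 'm) prederiv \<Rightarrow> 'a scat \<Rightarrow> 'a scat \<Rightarrow> 'o \<Rightarrow> 'm" where
  "colim_unit D A B = lan_unit D (A \<times>\<^sub>c B) B (proj2 A B)"

definition colim_adj :: "('a, 'o, 'm) prederiv \<Rightarrow> 'a scat \<Rightarrow> 'a scat \<Rightarrow> 'o \<Rightarrow> 'm \<Rightarrow> 'm" where
  "colim_adj D A B = lan_adj D (A \<times>\<^sub>c B) B (proj2 A B)"

definition span_incl :: "'a sftor" where
  "span_incl = mk_ftor (cube_le 2 1) (\<lambda>x. x) (\<lambda>f. f)"

definition cocartesian :: "('a, 'o, 'm) prederiv \<Rightarrow> 'a scat \<Rightarrow> 'o \<Rightarrow> bool" where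
  "cocartesian D B Y \<longleftrightarrow>
     (\<exists>Z \<in> ob (D0 D (cube_le 2 1 \<times>\<^sub>c B)).
        \<exists>e \<in> hom (D0 D (square \<times>\<^sub>c B))
               (fo (lan D (cube_le 2 1 \<times>\<^sub>c B) (square \<times>\<^sub>c B)
                      (prod_ftor (cube_le 2 1) B span_incl (id_ftor B))) Z) Y.
          is_iso (D0 D (square \<times>\<^sub>c B)) e)"

text \<open>
  The square in \<open>C\<close> with top \<open>f\<close>, left \<open>g\<close>, right \<open>h\<close> and bottom \<open>k\<close>.  The first coordinate of
  \<open>\<square> = [1]\<^sup>2\<close> runs from left to right, the second one from top to bottom.
\<close>

definition square_diag :: "('o, 'm) cat \<Rightarrow> 'm \<Rightarrow> 'm \<Rightarrow> 'm \<Rightarrow> 'm \<Rightarrow> ('a uni, 'a uni, 'o, 'm) ftor" where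
  "square_diag C f g h k =
    (let c00 = Vertex {}; c10 = Vertex {1}; c01 = Vertex {2}; c11 = Vertex {1, 2};
         obj = (\<lambda>x. if x = c00 then src C f else if x = c10 then tgt C f
                    else if x = c01 then tgt C g else tgt C h) in
     mk_ftor square obj
       (\<lambda>e. if e = Pair c00 c10 then f
            else if e = Pair c00 c01 then g
            else if e = Pair c10 c11 then h
            else if e = Pair c01 c11 then k
            else if e = Pair c00 c11 then h \<cdot>\<^bsub>C\<^esub> f
            else idt C (obj (pfst e))))"


section \<open>The square of colimits of a punctured cube\<close>

text \<open>
  Identifying subsets with 0/1-sequences, \<open>a \<mapsto> (a, 0)\<close> leaves a subset of \<open>{1..n - 1}\<close> unchanged and
  \<open>a \<mapsto> (a, 1)\<close> adds the element \<open>n\<close>.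
\<close>

definition append_coord :: "nat \<Rightarrow> nat \<Rightarrow> 'a uni \<Rightarrow> 'a uni" where
  "append_coord n k x = (case x of Vertex S \<Rightarrow> Vertex (if k = 0 then S else insert n S))"

definition j :: "nat \<Rightarrow> nat \<Rightarrow> 'a sftor" where
  "j n k = mk_ftor (punctured (n - 1)) (append_coord n k)
     (\<lambda>e. Pair (append_coord n k (pfst e)) (append_coord n k (psnd e)))"

definition inf0 :: "nat \<Rightarrow> 'a uni" where
  "inf0 n = Vertex {1..n - 1}"

definition j_par :: "nat \<Rightarrow> 'a scat \<Rightarrow> nat \<Rightarrow> 'a sftor" where
  "j_par n B k = prod_ftor (punctured (n - 1)) B (j n k) (id_ftor B)"

abbreviation j_pull :: "('a, 'o, 'm) prederiv \<Rightarrow> nat \<Rightarrow> 'a scat \<Rightarrow> nat \<Rightarrow> ('o, 'm, 'o, 'm) ftor" where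
  "j_pull D n B k \<equiv> D1 D (punctured (n - 1) \<times>\<^sub>c B) (punctured n \<times>\<^sub>c B) (j_par n B k)"

text \<open>
  The top map \<open>colim j\<^sub>0\<^sup>* X \<rightarrow> X\<^sub>\<infinity>\<^sub>,\<^sub>0\<close>, adjoint to the map \<open>j\<^sub>0\<^sup>* X \<rightarrow> pr\<^sup>* (X\<^sub>\<infinity>\<^sub>,\<^sub>0)\<close> induced by
  the relations \<open>(a, 0) \<le> (\<infinity>, 0)\<close>.
\<close>

definition top_map :: "('a, 'o, 'm) prederiv \<Rightarrow> nat \<Rightarrow> 'a scat \<Rightarrow> 'o \<Rightarrow> 'm" where
  "top_map D n B X =
    (let P' = punctured (n - 1); P = punctured n in
     colim_adj D P' B (fo (at D P B (inf0 n)) X)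
       (D2 D (P' \<times>\<^sub>c B) (P \<times>\<^sub>c B)
          (j_par n B 0)
          (comp_ftor (P' \<times>\<^sub>c B) (slice_at P B (inf0 n)) (proj2 P' B))
          (\<lambda>p \<in> ob (P' \<times>\<^sub>c B). Pair (Pair (append_coord n 0 (pfst p)) (inf0 n)) (idt B (psnd p)))
          X))"

text \<open>The left map \<open>colim j\<^sub>0\<^sup>* X \<rightarrow> colim j\<^sub>1\<^sup>* X\<close>, induced by the relations \<open>(a, 0) \<le> (a, 1)\<close>.\<close>

definition left_map :: "('a, 'o, 'm) prederiv \<Rightarrow> nat \<Rightarrow> 'a scat \<Rightarrow> 'o \<Rightarrow> 'm" where
  "left_map D n B X =
    (let P' = punctured (n - 1); P = punctured n in
     fa (colim D P' B)
       (D2 D (P' \<times>\<^sub>c B) (P \<times>\<^sub>c B) (j_par n B 0) (j_par n B 1)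
          (\<lambda>p \<in> ob (P' \<times>\<^sub>c B).
             Pair (Pair (append_coord n 0 (pfst p)) (append_coord n 1 (pfst p))) (idt B (psnd p)))
          X))"

text \<open>
  The right map \<open>X\<^sub>\<infinity>\<^sub>,\<^sub>0 \<rightarrow> colim X\<close> is the component at \<open>(\<infinity>, 0)\<close> of the unit \<open>X \<rightarrow> pr\<^sup>* colim X\<close>; the
  bottom map \<open>colim j\<^sub>1\<^sup>* X \<rightarrow> colim X\<close> is adjoint to the restriction of this unit along \<open>j\<^sub>1\<close>.
\<close>

definition right_map :: "('a, 'o, 'm) prederiv \<Rightarrow> nat \<Rightarrow> 'a scat \<Rightarrow> 'o \<Rightarrow> 'm" where
  "right_map D n B X =
     fa (at D (punctured n) B (inf0 n)) (colim_unit D (punctured n) B X)"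

definition bottom_map :: "('a, 'o, 'm) prederiv \<Rightarrow> nat \<Rightarrow> 'a scat \<Rightarrow> 'o \<Rightarrow> 'm" where
  "bottom_map D n B X =
     colim_adj D (punctured (n - 1)) B (fo (colim D (punctured n) B) X)
       (fa (j_pull D n B 1) (colim_unit D (punctured n) B X))"

definition colim_square :: "('a, 'o, 'm) prederiv \<Rightarrow> nat \<Rightarrow> 'a scat \<Rightarrow> 'o
    \<Rightarrow> ('a uni, 'a uni, 'o, 'm) ftor" where
  "colim_square D n B X =
     square_diag (D0 D B) (top_map D n B X) (left_map D n B X) (right_map D n B X)
       (bottom_map D n B X)"

end

theory Submission
  imports Defs
begin

text \<open>
  Let \<open>f\<close> send the vertices \<open>(a, 0)\<close> with \<open>a \<noteq> \<infinity>\<close>, the vertex \<open>(\<infinity>, 0)\<close> and the vertices \<open>(a, 1)\<close> of the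
  punctured cube to the corners \<open>(0, 0)\<close>, \<open>(1, 0)\<close> and \<open>(0, 1)\<close> of the square.  The morphism is
  \<open>d = f\<^sub>!\<close>.  Since \<open>f\<close> factors through the span, \<open>d(X)\<close> is left Kan extended from the span, hence
  cocartesian.  By (Der4) the corner \<open>c\<close> of \<open>d(X)\<close> is a colimit over \<open>{p. f p \<le> c}\<close>, which has as
  reflective (hence final) subposets the bottom face via \<open>j\<^sub>0\<close>, the point \<open>(\<infinity>, 0)\<close>, the top face via
  \<open>j\<^sub>1\<close>, and the whole punctured cube.  Kan extensions are handled through universal
  arrows \<open>X \<rightarrow> u\<^sup>* Z\<close> rather than mates: all comparison isomorphisms, their coherence and the
  commutativity of the squares then follow from uniqueness, and universality is tested pointwise by
  (Der2).
\<close>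

section \<open>Categories and universal arrows\<close>

text \<open>Two features of the setting shape the argument. The functors \<open>lan\<close> are
  arbitrary choices, and (Der4) speaks only of these choices and only of values at single objects,
  whereas the square must be identified for objects with parameters in \<open>B\<close>. So (Der4)
  is restated for arbitrary universal arrows, and statements with parameters are tested at each pair
  \<open>(c, b)\<close>. The comma category there also contains maps of parameters into
  \<open>b\<close>, but the fibre \<open>{p. f p \<subseteq> c}\<close> is reflective in it and does
  not depend on \<open>b\<close>. This independence yields both that \<open>f_!\<close> commutes
  with change of parameters, hence is a morphism of derivators, and that the corners are colimits
  with parameters. The vertex \<open>(\<infinity>, 0)\<close> gets a corner of its own for two
  reasons: it is the top of its fibre, so that its value is not altered by \<open>f_!\<close>, and
  it is the one vertex that cannot be pushed to the top face, since the vertex above it is missing.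
  The prescribed square is not shown to commute directly: it inherits this from the coherent square
  \<open>d(X)\<close> by cancelling an isomorphism.\<close>

lemma homD:
  assumes "f \<in> hom C x y"
  shows "f \<in> ar C" "src C f = x" "tgt C f = y"
  using assms by (auto simp: hom_def)

lemma hom_ob:
  assumes "category C" "f \<in> hom C x y"
  shows "x \<in> ob C" "y \<in> ob C"
  using assms by (auto simp: hom_def category_def)

lemma ar_hom: "f \<in> ar C \<Longrightarrow> f \<in> hom C (src C f) (tgt C f)"
  by (simp add: hom_def)

lemma ar_ob:
  assumes "category C" "f \<in> ar C"
  shows "src C f \<in> ob C" "tgt C f \<in> ob C"
  using assms by (auto simp: category_def)

lemma idt_hom: "category C \<Longrightarrow> x \<in> ob C \<Longrightarrow> idt C x \<in> hom C x x"
  by (auto simp: category_def)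

lemma idt_ar: "category C \<Longrightarrow> x \<in> ob C \<Longrightarrow> idt C x \<in> ar C"
  by (auto simp: category_def hom_def)

lemma cmp_hom:
  "category C \<Longrightarrow> f \<in> hom C x y \<Longrightarrow> g \<in> hom C y z \<Longrightarrow> g \<cdot>\<^bsub>C\<^esub> f \<in> hom C x z"
  unfolding category_def hom_def by auto

lemma idt_left: "category C \<Longrightarrow> f \<in> hom C x y \<Longrightarrow> idt C y \<cdot>\<^bsub>C\<^esub> f = f"
  by (auto simp: category_def hom_def)

lemma idt_right: "category C \<Longrightarrow> f \<in> hom C x y \<Longrightarrow> f \<cdot>\<^bsub>C\<^esub> idt C x = f"
  by (auto simp: category_def hom_def)

lemma cmp_assoc:
  "category C \<Longrightarrow> f \<in> hom C w x \<Longrightarrow> g \<in> hom C x y \<Longrightarrow> h \<in> hom C y z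
   \<Longrightarrow> h \<cdot>\<^bsub>C\<^esub> (g \<cdot>\<^bsub>C\<^esub> f) = (h \<cdot>\<^bsub>C\<^esub> g) \<cdot>\<^bsub>C\<^esub> f"
  by (auto simp: category_def hom_def)

lemma is_isoI:
  assumes "f \<in> hom C x y" "g \<in> hom C y x" "g \<cdot>\<^bsub>C\<^esub> f = idt C x" "f \<cdot>\<^bsub>C\<^esub> g = idt C y"
  shows "is_iso C f"
  using assms by (auto simp: is_iso_def hom_def)

lemma is_isoE:
  assumes "is_iso C f" "f \<in> hom C x y"
  obtains g where "g \<in> hom C y x" "g \<cdot>\<^bsub>C\<^esub> f = idt C x" "f \<cdot>\<^bsub>C\<^esub> g = idt C y"
  using assms by (auto simp: is_iso_def hom_def)

definition inverse_ar :: "('o, 'm) cat \<Rightarrow> 'm \<Rightarrow> 'm" where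
  "inverse_ar C f = (SOME g. g \<in> hom C (tgt C f) (src C f) \<and>
     g \<cdot>\<^bsub>C\<^esub> f = idt C (src C f) \<and> f \<cdot>\<^bsub>C\<^esub> g = idt C (tgt C f))"

lemma inverse_ar:
  assumes "is_iso C f" "f \<in> hom C x y"
  shows "inverse_ar C f \<in> hom C y x" "inverse_ar C f \<cdot>\<^bsub>C\<^esub> f = idt C x"
    "f \<cdot>\<^bsub>C\<^esub> inverse_ar C f = idt C y"
proof -
  have "\<exists>g. g \<in> hom C (tgt C f) (src C f) \<and>
     g \<cdot>\<^bsub>C\<^esub> f = idt C (src C f) \<and> f \<cdot>\<^bsub>C\<^esub> g = idt C (tgt C f)"
    using assms(1) unfolding is_iso_def by blast
  from someI_ex[OF this, folded inverse_ar_def] assms(2)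
  show "inverse_ar C f \<in> hom C y x" "inverse_ar C f \<cdot>\<^bsub>C\<^esub> f = idt C x"
    "f \<cdot>\<^bsub>C\<^esub> inverse_ar C f = idt C y"
    by (auto simp: hom_def)
qed

lemma is_iso_inverse_ar:
  assumes "is_iso C f" "f \<in> hom C x y"
  shows "is_iso C (inverse_ar C f)"
  by (rule is_isoI[OF inverse_ar(1)[OF assms] assms(2) inverse_ar(3)[OF assms] inverse_ar(2)[OF assms]])

text \<open>Isomorphisms are mono. Later this carries commutativity over from one square to an
  isomorphic one.\<close>

lemma iso_cancel_left:
  assumes "category C" "is_iso C s" "s \<in> hom C y z" "f \<in> hom C x y" "g \<in> hom C x y"
    "s \<cdot>\<^bsub>C\<^esub> f = s \<cdot>\<^bsub>C\<^esub> g"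
  shows "f = g"
proof -
  obtain t where t: "t \<in> hom C z y" "t \<cdot>\<^bsub>C\<^esub> s = idt C y"
    using is_isoE[OF assms(2,3)] by metis
  have "f = (t \<cdot>\<^bsub>C\<^esub> s) \<cdot>\<^bsub>C\<^esub> f" using t assms idt_left by metis
  also have "\<dots> = (t \<cdot>\<^bsub>C\<^esub> s) \<cdot>\<^bsub>C\<^esub> g"
    using cmp_assoc[OF assms(1,4,3) t(1)] cmp_assoc[OF assms(1,5,3) t(1)] assms(6) by simp
  also have "\<dots> = g" using t assms idt_left by metis
  finally show ?thesis .
qed

lemma functor_ob: "is_functor C E F \<Longrightarrow> x \<in> ob C \<Longrightarrow> fo F x \<in> ob E"
  by (auto simp: is_functor_def)

lemma functor_hom: "is_functor C E F \<Longrightarrow> f \<in> hom C x y \<Longrightarrow> fa F f \<in> hom E (fo F x) (fo F y)"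
  by (auto simp: is_functor_def hom_def)

lemma functor_idt: "is_functor C E F \<Longrightarrow> x \<in> ob C \<Longrightarrow> fa F (idt C x) = idt E (fo F x)"
  by (auto simp: is_functor_def)

lemma functor_cmp:
  "is_functor C E F \<Longrightarrow> f \<in> hom C x y \<Longrightarrow> g \<in> hom C y z
   \<Longrightarrow> fa F (g \<cdot>\<^bsub>C\<^esub> f) = fa F g \<cdot>\<^bsub>E\<^esub> fa F f"
  by (auto simp: is_functor_def hom_def)

lemma functor_is_iso:
  assumes "is_functor C E F" "category C" "is_iso C f"
  shows "is_iso E (fa F f)"
proof -
  have f: "f \<in> hom C (src C f) (tgt C f)" using assms(3) by (auto simp: is_iso_def hom_def)
  obtain g where g: "g \<in> hom C (tgt C f) (src C f)" "g \<cdot>\<^bsub>C\<^esub> f = idt C (src C f)"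
    "f \<cdot>\<^bsub>C\<^esub> g = idt C (tgt C f)"
    using is_isoE[OF assms(3) f] .
  show ?thesis
    by (rule is_isoI[OF functor_hom[OF assms(1) f] functor_hom[OF assms(1) g(1)]])
      (use assms(1,2) f g hom_ob[OF assms(2) f] in
        \<open>simp_all add: functor_cmp[symmetric] functor_idt functor_hom\<close>)
qed

text \<open>The laws of a prederivator are equalities of functors, so every identification of
  composites of diagram functors has to hold on the nose. For extensional functors it can be checked
  on the domain.\<close>

lemma functor_eqI:
  assumes "is_functor C E F" "is_functor C E' G"
    and "\<And>x. x \<in> ob C \<Longrightarrow> fo F x = fo G x" "\<And>f. f \<in> ar C \<Longrightarrow> fa F f = fa G f"
  shows "F = G"
proof -
  have "fo F = fo G"
    by (rule extensionalityI[of _ "ob C"]) (use assms in \<open>auto simp: is_functor_def PiE_def\<close>)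
  moreover have "fa F = fa G"
    by (rule extensionalityI[of _ "ar C"]) (use assms in \<open>auto simp: is_functor_def PiE_def\<close>)
  ultimately show ?thesis by simp
qed

lemma mk_ftor_simps [simp]:
  "x \<in> ob C \<Longrightarrow> fo (mk_ftor C F0 F1) x = F0 x"
  "f \<in> ar C \<Longrightarrow> fa (mk_ftor C F0 F1) f = F1 f"
  by (auto simp: mk_ftor_def)

lemma mk_ftor_functor:
  assumes "category C" "category E"
    and "\<And>x. x \<in> ob C \<Longrightarrow> F0 x \<in> ob E"
    and "\<And>f x y. f \<in> hom C x y \<Longrightarrow> F1 f \<in> hom E (F0 x) (F0 y)"
    and "\<And>x. x \<in> ob C \<Longrightarrow> F1 (idt C x) = idt E (F0 x)"
    and "\<And>f g x y z. f \<in> hom C x y \<Longrightarrow> g \<in> hom C y z \<Longrightarrow> F1 (g \<cdot>\<^bsub>C\<^esub> f) = F1 g \<cdot>\<^bsub>E\<^esub> F1 f"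
  shows "is_functor C E (mk_ftor C F0 F1)"
proof -
  have 1: "F1 f \<in> ar E" "src E (F1 f) = F0 (src C f)" "tgt E (F1 f) = F0 (tgt C f)" if "f \<in> ar C" for f
    using assms(4)[OF ar_hom[OF that]] by (auto simp: hom_def)
  have 2: "g \<cdot>\<^bsub>C\<^esub> f \<in> ar C" if "f \<in> ar C" "g \<in> ar C" "tgt C f = src C g" for f g
    using that assms(1) by (auto simp: category_def hom_def)
  have 3: "F1 (g \<cdot>\<^bsub>C\<^esub> f) = F1 g \<cdot>\<^bsub>E\<^esub> F1 f" if "f \<in> ar C" "g \<in> ar C" "tgt C f = src C g" for f g
    using assms(6)[of f "src C f" "src C g" g "tgt C g"] that by (auto simp: hom_def)
  show ?thesis
    unfolding is_functor_def
    using assms(3,5) 1 2 3 ar_ob[OF assms(1)] idt_ar[OF assms(1)]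
    by (auto simp: mk_ftor_def)
qed

lemma id_ftor_functor: "category C \<Longrightarrow> is_functor C C (id_ftor C)"
  unfolding id_ftor_def by (rule mk_ftor_functor) auto

lemma id_ftor_simps [simp]:
  "x \<in> ob C \<Longrightarrow> fo (id_ftor C) x = x" "f \<in> ar C \<Longrightarrow> fa (id_ftor C) f = f"
  by (auto simp: id_ftor_def)

lemma comp_ftor_simps [simp]:
  "x \<in> ob C \<Longrightarrow> fo (comp_ftor C G F) x = fo G (fo F x)"
  "f \<in> ar C \<Longrightarrow> fa (comp_ftor C G F) f = fa G (fa F f)"
  by (auto simp: comp_ftor_def)

lemma comp_ftor_hom_simp: "f \<in> hom C x y \<Longrightarrow> fa (comp_ftor C G F) f = fa G (fa F f)"
  by (auto simp: hom_def)

lemma comp_ftor_functor: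
  assumes "category C" "category A" "is_functor C E F" "is_functor E A G"
  shows "is_functor C A (comp_ftor C G F)"
  unfolding comp_ftor_def
  by (rule mk_ftor_functor)
    (use assms in \<open>auto simp: functor_ob functor_idt functor_hom functor_cmp[OF assms(3)]
      functor_cmp[OF assms(4) functor_hom[OF assms(3)] functor_hom[OF assms(3)]]\<close>)

lemma const_ftor_functor:
  assumes "category C" "category E" "y \<in> ob E"
  shows "is_functor C E (const_ftor C E y)"
  unfolding const_ftor_def
  by (rule mk_ftor_functor) (use assms in \<open>auto simp: idt_hom idt_left[OF _ idt_hom]\<close>)

lemma const_ftor_simps [simp]:
  "x \<in> ob C \<Longrightarrow> fo (const_ftor C E y) x = y" "f \<in> ar C \<Longrightarrow> fa (const_ftor C E y) f = idt E y"
  by (auto simp: const_ftor_def)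

lemma comp_ftor_assoc:
  assumes "category A" "is_functor A B F"
  shows "comp_ftor A H (comp_ftor A G F) = comp_ftor A (comp_ftor B H G) F"
proof -
  have "fo F x \<in> ob B" if "x \<in> ob A" for x using that assms(2) by (rule functor_ob[rotated])
  moreover have "fa F f \<in> ar B" if "f \<in> ar A" for f
    using that assms(2) by (auto simp: is_functor_def)
  ultimately show ?thesis
    by (auto simp: comp_ftor_def mk_ftor_def intro!: restrict_ext)
qed

lemma comp_id_ftor:
  assumes "is_functor A B F"
  shows "comp_ftor A (id_ftor B) F = F"
proof -
  have "fo F = restrict (\<lambda>x. fo (id_ftor B) (fo F x)) (ob A)" "fa F = restrict (\<lambda>f. fa (id_ftor B) (fa F f)) (ar A)"
    using assms by (auto simp: is_functor_def PiE_def Pi_def extensional_def fun_eq_iff)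
  then show ?thesis by (simp add: comp_ftor_def mk_ftor_def)
qed

section \<open>Natural transformations and whiskering\<close>

lemma ntD:
  assumes "is_nt C E F G \<alpha>"
  shows "is_functor C E F" "is_functor C E G"
    and "x \<in> ob C \<Longrightarrow> \<alpha> x \<in> hom E (fo F x) (fo G x)"
    and "f \<in> hom C x y \<Longrightarrow> \<alpha> y \<cdot>\<^bsub>E\<^esub> fa F f = fa G f \<cdot>\<^bsub>E\<^esub> \<alpha> x"
    and "\<alpha> \<in> extensional (ob C)"
  using assms by (auto simp: is_nt_def hom_def PiE_def)

lemma ntI:
  assumes "category C" "is_functor C E F" "is_functor C E G"
    and "\<And>x. x \<in> ob C \<Longrightarrow> \<alpha> x \<in> hom E (fo F x) (fo G x)"
    and "\<And>f x y. f \<in> hom C x y \<Longrightarrow> \<alpha> y \<cdot>\<^bsub>E\<^esub> fa F f = fa G f \<cdot>\<^bsub>E\<^esub> \<alpha> x"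
    and "\<alpha> \<in> extensional (ob C)"
  shows "is_nt C E F G \<alpha>"
  unfolding is_nt_def
  using assms(2,3,4,6) assms(5)[OF ar_hom] by (auto intro: PiE_I simp: extensional_def)

lemma nt_eqI:
  assumes "\<alpha> \<in> extensional (ob C)" "\<beta> \<in> extensional (ob C)" "\<And>x. x \<in> ob C \<Longrightarrow> \<alpha> x = \<beta> x"
  shows "\<alpha> = \<beta>"
  using assms by (rule extensionalityI)

lemma id_nt_nt:
  assumes "category C" "category E" "is_functor C E F"
  shows "is_nt C E F F (id_nt C E F)"
  by (rule ntI)
    (use assms in \<open>auto simp: id_nt_def functor_ob idt_hom hom_ob[OF assms(1)]
      idt_left[OF assms(2) functor_hom[OF assms(3)]] idt_right[OF assms(2) functor_hom[OF assms(3)]]\<close>)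

text \<open>Whiskering is \<open>hcomp\<close> with an identity 2-cell, without the composition with
  an identity arrow that \<open>hcomp\<close> leaves in each component.\<close>

definition pre_whisker :: "('o, 'm) cat \<Rightarrow> ('p \<Rightarrow> 's) \<Rightarrow> ('o, 'm, 'p, 'q) ftor \<Rightarrow> 'o \<Rightarrow> 's" where
  "pre_whisker C \<alpha> u = (\<lambda>x \<in> ob C. \<alpha> (fo u x))"

definition post_whisker :: "('o, 'm) cat \<Rightarrow> ('p, 'q, 'r, 's) ftor \<Rightarrow> ('o \<Rightarrow> 'q) \<Rightarrow> 'o \<Rightarrow> 's" where
  "post_whisker C v \<alpha> = (\<lambda>x \<in> ob C. fa v (\<alpha> x))"

lemma pre_whisker_nt:
  assumes "category C" "category E" "category A" "is_functor C E u" "is_nt E A F G \<alpha>"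
  shows "is_nt C A (comp_ftor C F u) (comp_ftor C G u) (pre_whisker C \<alpha> u)"
  by (rule ntI)
    (use assms ntD[OF assms(5)] in \<open>auto simp: pre_whisker_def comp_ftor_functor functor_ob
      comp_ftor_hom_simp hom_ob[OF assms(1)] ntD(4)[OF assms(5) functor_hom[OF assms(4)]]\<close>)

lemma post_whisker_nt:
  assumes "category C" "category A" "is_functor E A v" "is_nt C E F G \<alpha>"
  shows "is_nt C A (comp_ftor C v F) (comp_ftor C v G) (post_whisker C v \<alpha>)"
proof (rule ntI)
  fix f x y assume f: "f \<in> hom C x y"
  have xy: "x \<in> ob C" "y \<in> ob C" using hom_ob[OF assms(1) f] .
  note n = ntD[OF assms(4)]
  show "post_whisker C v \<alpha> y \<cdot>\<^bsub>A\<^esub> fa (comp_ftor C v F) f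
      = fa (comp_ftor C v G) f \<cdot>\<^bsub>A\<^esub> post_whisker C v \<alpha> x"
    using xy functor_cmp[OF assms(3) functor_hom[OF n(1) f] n(3)[OF xy(2)]]
      functor_cmp[OF assms(3) n(3)[OF xy(1)] functor_hom[OF n(2) f]] n(4)[OF f]
    by (simp add: post_whisker_def comp_ftor_hom_simp[OF f])
qed (use assms ntD[OF assms(4)] in \<open>auto simp: post_whisker_def comp_ftor_functor functor_hom\<close>)

text \<open>An initial object \<open>(Z, \<eta>)\<close> of the comma category \<open>(X/G)\<close>:
  the value at \<open>X\<close> of a left adjoint of \<open>G\<close>, expressed as a property.
  Unlike a chosen adjoint it survives replacing \<open>Z\<close> by an isomorphic object, so values
  of \<open>lan\<close> can be compared with objects obtained in other ways.\<close>

definition universal :: "('o, 'm) cat \<Rightarrow> ('p, 'q) cat \<Rightarrow> ('p, 'q, 'o, 'm) ftor \<Rightarrow> 'o \<Rightarrow> 'p \<Rightarrow> 'm \<Rightarrow> bool"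
  where "universal C E G X Z \<eta> \<longleftrightarrow>
    Z \<in> ob E \<and> \<eta> \<in> hom C X (fo G Z) \<and>
    (\<forall>W \<in> ob E. \<forall>h \<in> hom C X (fo G W). \<exists>!m. m \<in> hom E Z W \<and> fa G m \<cdot>\<^bsub>C\<^esub> \<eta> = h)"

lemma universalD:
  assumes "universal C E G X Z \<eta>"
  shows "Z \<in> ob E" "\<eta> \<in> hom C X (fo G Z)"
  using assms by (auto simp: universal_def)

lemma universal_ob: "category C \<Longrightarrow> universal C E G X Z \<eta> \<Longrightarrow> X \<in> ob C"
  using hom_ob(1)[OF _ universalD(2)] .

lemma universalE:
  assumes "universal C E G X Z \<eta>" "W \<in> ob E" "h \<in> hom C X (fo G W)"
  obtains m where "m \<in> hom E Z W" "fa G m \<cdot>\<^bsub>C\<^esub> \<eta> = h"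
  using assms unfolding universal_def by metis

lemma universal_eqI:
  assumes "universal C E G X Z \<eta>" "category C" "is_functor E C G" "category E"
    and "m \<in> hom E Z W" "m' \<in> hom E Z W" "fa G m \<cdot>\<^bsub>C\<^esub> \<eta> = fa G m' \<cdot>\<^bsub>C\<^esub> \<eta>"
  shows "m = m'"
proof -
  have "W \<in> ob E" using hom_ob assms by metis
  moreover have "fa G m \<cdot>\<^bsub>C\<^esub> \<eta> \<in> hom C X (fo G W)"
    using assms(1,2,3,5) by (blast intro: cmp_hom universalD functor_hom)
  ultimately show ?thesis using assms(1,5,6,7) unfolding universal_def by metis
qed

text \<open>Two initial objects of \<open>(X/G)\<close>: the inverse is the mediating map in the
  other direction, and both composites fix a universal arrow. Most comparison maps below are shown
  to be invertible in this way.\<close>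

lemma universal_unique_iso:
  assumes "universal C E G X Z \<eta>" "universal C E G X Z' \<eta>'"
    and "category C" "category E" "is_functor E C G"
    and "m \<in> hom E Z Z'" "fa G m \<cdot>\<^bsub>C\<^esub> \<eta> = \<eta>'"
  shows "is_iso E m"
proof -
  note u = universalD[OF assms(1)] and u' = universalD[OF assms(2)]
  obtain m' where m': "m' \<in> hom E Z' Z" "fa G m' \<cdot>\<^bsub>C\<^esub> \<eta>' = \<eta>"
    using universalE[OF assms(2) u(1,2)] .
  have 1: "m' \<cdot>\<^bsub>E\<^esub> m = idt E Z"
  proof (rule universal_eqI[OF assms(1,3,5,4)])
    have "fa G (m' \<cdot>\<^bsub>E\<^esub> m) \<cdot>\<^bsub>C\<^esub> \<eta> = \<eta>"
      using assms(7) m'(2) functor_cmp[OF assms(5,6) m'(1)]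
        cmp_assoc[OF assms(3) u(2) functor_hom[OF assms(5,6)] functor_hom[OF assms(5) m'(1)]]
      by simp
    then show "fa G (m' \<cdot>\<^bsub>E\<^esub> m) \<cdot>\<^bsub>C\<^esub> \<eta> = fa G (idt E Z) \<cdot>\<^bsub>C\<^esub> \<eta>"
      using functor_idt[OF assms(5) u(1)] idt_left[OF assms(3) u(2)] by simp
  qed (use assms m' u in \<open>auto intro: cmp_hom idt_hom\<close>)
  have 2: "m \<cdot>\<^bsub>E\<^esub> m' = idt E Z'"
  proof (rule universal_eqI[OF assms(2,3,5,4)])
    have "fa G (m \<cdot>\<^bsub>E\<^esub> m') \<cdot>\<^bsub>C\<^esub> \<eta>' = \<eta>'"
      using assms(7) m'(2) functor_cmp[OF assms(5) m'(1) assms(6)]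
        cmp_assoc[OF assms(3) u'(2) functor_hom[OF assms(5) m'(1)] functor_hom[OF assms(5,6)]]
      by simp
    then show "fa G (m \<cdot>\<^bsub>E\<^esub> m') \<cdot>\<^bsub>C\<^esub> \<eta>' = fa G (idt E Z') \<cdot>\<^bsub>C\<^esub> \<eta>'"
      using functor_idt[OF assms(5) u'(1)] idt_left[OF assms(3) u'(2)] by simp
  qed (use assms m' u' in \<open>auto intro: cmp_hom idt_hom\<close>)
  show ?thesis using assms(6) m'(1) 1 2 by (rule is_isoI)
qed

text \<open>Precomposition with \<open>s\<close> is a bijection between the maps out of
  \<open>Z'\<close> and those out of \<open>Z\<close>. Together with the uniqueness above, the
  universal arrows at \<open>X\<close> are exactly the translates of one of them along
  isomorphisms.\<close>

lemma universal_iso: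
  assumes "universal C E G X Z \<eta>" "category C" "category E" "is_functor E C G"
    and "s \<in> hom E Z Z'" "is_iso E s"
  shows "universal C E G X Z' (fa G s \<cdot>\<^bsub>C\<^esub> \<eta>)"
proof -
  note u = universalD[OF assms(1)]
  have s: "fa G s \<in> hom C (fo G Z) (fo G Z')" using assms by (blast intro: functor_hom)
  obtain t where t: "t \<in> hom E Z' Z" "t \<cdot>\<^bsub>E\<^esub> s = idt E Z" "s \<cdot>\<^bsub>E\<^esub> t = idt E Z'"
    using is_isoE[OF assms(6,5)] .
  have eq: "fa G m \<cdot>\<^bsub>C\<^esub> (fa G s \<cdot>\<^bsub>C\<^esub> \<eta>) = fa G (m \<cdot>\<^bsub>E\<^esub> s) \<cdot>\<^bsub>C\<^esub> \<eta>" if "m \<in> hom E Z' W" for m W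
    using cmp_assoc[OF assms(2) u(2) s functor_hom[OF assms(4) that]] functor_cmp[OF assms(4,5) that]
    by simp
  show ?thesis
    unfolding universal_def
  proof (intro conjI ballI)
    fix W h assume W: "W \<in> ob E" and h: "h \<in> hom C X (fo G W)"
    obtain m where m: "m \<in> hom E Z W" "fa G m \<cdot>\<^bsub>C\<^esub> \<eta> = h" using universalE[OF assms(1) W h] .
    have mt: "m \<cdot>\<^bsub>E\<^esub> t \<in> hom E Z' W" using assms(3) m(1) t(1) by (blast intro: cmp_hom)
    show "\<exists>!m. m \<in> hom E Z' W \<and> fa G m \<cdot>\<^bsub>C\<^esub> (fa G s \<cdot>\<^bsub>C\<^esub> \<eta>) = h"
    proof (rule ex1I[of _ "m \<cdot>\<^bsub>E\<^esub> t"])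
      have "(m \<cdot>\<^bsub>E\<^esub> t) \<cdot>\<^bsub>E\<^esub> s = m"
        using cmp_assoc[OF assms(3,5) t(1) m(1)] t(2) idt_right[OF assms(3) m(1)] by simp
      then show "m \<cdot>\<^bsub>E\<^esub> t \<in> hom E Z' W \<and> fa G (m \<cdot>\<^bsub>E\<^esub> t) \<cdot>\<^bsub>C\<^esub> (fa G s \<cdot>\<^bsub>C\<^esub> \<eta>) = h"
        using eq[OF mt] m mt by simp
    next
      fix m' assume m': "m' \<in> hom E Z' W \<and> fa G m' \<cdot>\<^bsub>C\<^esub> (fa G s \<cdot>\<^bsub>C\<^esub> \<eta>) = h"
      have "m' \<cdot>\<^bsub>E\<^esub> s = m"
        by (rule universal_eqI[OF assms(1,2,4,3)])
          (use eq m m' assms in \<open>auto intro: cmp_hom\<close>)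
      then show "m' = m \<cdot>\<^bsub>E\<^esub> t"
        using cmp_assoc[OF assms(3) t(1) assms(5)] t(3) idt_right[OF assms(3)] m' by metis
    qed
  qed (use u s assms hom_ob[OF assms(3,5)] in \<open>auto intro: cmp_hom\<close>)
qed

text \<open>Left adjoints compose: an arrow from \<open>X\<close> to \<open>G (H V)\<close> is
  factored first through \<open>\<eta>\<close> and then through \<open>\<zeta>\<close>.\<close>

lemma universal_comp:
  assumes "universal C E G X Z \<eta>" "universal E A H Z W \<zeta>"
    and "category C" "category E" "category A" "is_functor E C G" "is_functor A E H"
  shows "universal C A (comp_ftor A G H) X W (fa G \<zeta> \<cdot>\<^bsub>C\<^esub> \<eta>)"
proof -
  note u = universalD[OF assms(1)] and v = universalD[OF assms(2)]
  have z: "fa G \<zeta> \<in> hom C (fo G Z) (fo G (fo H W))" using assms v by (blast intro: functor_hom)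
  have eq: "fa (comp_ftor A G H) m \<cdot>\<^bsub>C\<^esub> (fa G \<zeta> \<cdot>\<^bsub>C\<^esub> \<eta>) = fa G (fa H m \<cdot>\<^bsub>E\<^esub> \<zeta>) \<cdot>\<^bsub>C\<^esub> \<eta>"
    if "m \<in> hom A W V" for m V
    using cmp_assoc[OF assms(3) u(2) z functor_hom[OF assms(6) functor_hom[OF assms(7) that]]]
      functor_cmp[OF assms(6) v(2) functor_hom[OF assms(7) that]] that
    by (simp add: comp_ftor_hom_simp)
  show ?thesis
    unfolding universal_def
  proof (intro conjI ballI)
    fix V h assume V: "V \<in> ob A" and "h \<in> hom C X (fo (comp_ftor A G H) V)"
    then have h: "h \<in> hom C X (fo G (fo H V))" by simp
    have HV: "fo H V \<in> ob E" using assms(7) V by (rule functor_ob)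
    obtain m where m: "m \<in> hom E Z (fo H V)" "fa G m \<cdot>\<^bsub>C\<^esub> \<eta> = h" using universalE[OF assms(1) HV h] .
    obtain k where k: "k \<in> hom A W V" "fa H k \<cdot>\<^bsub>E\<^esub> \<zeta> = m" using universalE[OF assms(2) V m(1)] .
    show "\<exists>!m. m \<in> hom A W V \<and> fa (comp_ftor A G H) m \<cdot>\<^bsub>C\<^esub> (fa G \<zeta> \<cdot>\<^bsub>C\<^esub> \<eta>) = h"
    proof (rule ex1I[of _ k])
      show "k \<in> hom A W V \<and> fa (comp_ftor A G H) k \<cdot>\<^bsub>C\<^esub> (fa G \<zeta> \<cdot>\<^bsub>C\<^esub> \<eta>) = h"
        using eq k m by simp
    next
      fix k' assume k': "k' \<in> hom A W V \<and> fa (comp_ftor A G H) k' \<cdot>\<^bsub>C\<^esub> (fa G \<zeta> \<cdot>\<^bsub>C\<^esub> \<eta>) = h"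
      have "fa H k' \<cdot>\<^bsub>E\<^esub> \<zeta> = m"
        by (rule universal_eqI[OF assms(1,3,6,4)])
          (use eq k' m v assms in \<open>auto intro: cmp_hom functor_hom\<close>)
      then show "k' = k"
        using k k' by (intro universal_eqI[OF assms(2,4,7,5)]) auto
    qed
  qed (use u v z assms in \<open>auto intro: cmp_hom\<close>)
qed

text \<open>The left adjoint of an identity is an identity, so being universal and being invertible
  coincide. This converts a universality statement into the invertibility of a unit
  component.\<close>

lemma universal_id_iff:
  assumes "category C"
  shows "universal C C (id_ftor C) X Z \<eta> \<longleftrightarrow> \<eta> \<in> hom C X Z \<and> is_iso C \<eta>"
proof
  assume u: "universal C C (id_ftor C) X Z \<eta>"
  then have \<eta>: "\<eta> \<in> hom C X Z" by (auto simp: universal_def)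
  then have X: "X \<in> ob C" "Z \<in> ob C" using hom_ob[OF assms] by auto
  have "universal C C (id_ftor C) X X (idt C X)"
    unfolding universal_def using X assms idt_hom[OF assms X(1)] 
    by (auto 0 3 simp: idt_right homD(1) dest: idt_right)
  from universal_unique_iso[OF this u assms assms id_ftor_functor[OF assms] \<eta>]
  show "\<eta> \<in> hom C X Z \<and> is_iso C \<eta>" using \<eta> idt_right[OF assms \<eta>] by (auto simp: homD(1))
next
  assume "\<eta> \<in> hom C X Z \<and> is_iso C \<eta>"
  then have \<eta>: "\<eta> \<in> hom C X Z" "is_iso C \<eta>" by auto
  then have X: "X \<in> ob C" "Z \<in> ob C" using hom_ob[OF assms] by auto
  have "universal C C (id_ftor C) X X (idt C X)"
    unfolding universal_def using X assms idt_hom[OF assms X(1)] 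
    by (auto 0 3 simp: idt_right homD(1) dest: idt_right)
  from universal_iso[OF this assms assms id_ftor_functor[OF assms] \<eta>]
  show "universal C C (id_ftor C) X Z \<eta>"
    using \<eta> idt_right[OF assms \<eta>(1)] by (auto simp: homD(1))
qed

text \<open>The mediating map is the usual transpose. The last two claims keep its formula because
  \<open>lan_adj\<close>, and with it two of the maps of the square, is defined by that
  formula.\<close>

lemma adjunction_universal:
  assumes "adjunction C E F G \<eta> \<epsilon>" "category C" "category E" "X \<in> ob C"
  shows "universal C E G X (fo F X) (\<eta> X)"
    and "W \<in> ob E \<Longrightarrow> h \<in> hom C X (fo G W) \<Longrightarrow> \<epsilon> W \<cdot>\<^bsub>E\<^esub> fa F h \<in> hom E (fo F X) W"
    and "W \<in> ob E \<Longrightarrow> h \<in> hom C X (fo G W) \<Longrightarrow> fa G (\<epsilon> W \<cdot>\<^bsub>E\<^esub> fa F h) \<cdot>\<^bsub>C\<^esub> \<eta> X = h"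
proof -
  have F: "is_functor C E F" and G: "is_functor E C G"
    and \<eta>: "is_nt C C (id_ftor C) (comp_ftor C G F) \<eta>"
    and \<epsilon>: "is_nt E E (comp_ftor E F G) (id_ftor E) \<epsilon>"
    and t1: "\<epsilon> (fo F X) \<cdot>\<^bsub>E\<^esub> fa F (\<eta> X) = idt E (fo F X)"
    and t2: "W \<in> ob E \<Longrightarrow> fa G (\<epsilon> W) \<cdot>\<^bsub>C\<^esub> \<eta> (fo G W) = idt C (fo G W)" for W
    using assms by (auto simp: adjunction_def)
  have FX: "fo F X \<in> ob E" using F assms(4) by (rule functor_ob)
  have e: "\<eta> Y \<in> hom C Y (fo G (fo F Y))" if "Y \<in> ob C" for Y
    using ntD(3)[OF \<eta> that] that by simp
  have d: "\<epsilon> W \<in> hom E (fo F (fo G W)) W" if "W \<in> ob E" for W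
    using ntD(3)[OF \<epsilon> that] that by simp
  show 1: "\<epsilon> W \<cdot>\<^bsub>E\<^esub> fa F h \<in> hom E (fo F X) W" if "W \<in> ob E" "h \<in> hom C X (fo G W)" for W h
    using assms(3) functor_hom[OF F that(2)] d[OF that(1)] by (rule cmp_hom)
  show 2: "fa G (\<epsilon> W \<cdot>\<^bsub>E\<^esub> fa F h) \<cdot>\<^bsub>C\<^esub> \<eta> X = h" if W: "W \<in> ob E" and h: "h \<in> hom C X (fo G W)" for W h
  proof -
    have GW: "fo G W \<in> ob C" using G W by (rule functor_ob)
    have Fh: "fa F h \<in> hom E (fo F X) (fo F (fo G W))" using F h by (rule functor_hom)
    have "fa G (\<epsilon> W \<cdot>\<^bsub>E\<^esub> fa F h) \<cdot>\<^bsub>C\<^esub> \<eta> X = fa G (\<epsilon> W) \<cdot>\<^bsub>C\<^esub> (fa G (fa F h) \<cdot>\<^bsub>C\<^esub> \<eta> X)"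
      using functor_cmp[OF G Fh d[OF W]]
        cmp_assoc[OF assms(2) e[OF assms(4)] functor_hom[OF G Fh] functor_hom[OF G d[OF W]]] by simp
    also have "fa G (fa F h) \<cdot>\<^bsub>C\<^esub> \<eta> X = \<eta> (fo G W) \<cdot>\<^bsub>C\<^esub> h"
      using ntD(4)[OF \<eta> h] by (simp add: homD(1)[OF h])
    also have "fa G (\<epsilon> W) \<cdot>\<^bsub>C\<^esub> (\<eta> (fo G W) \<cdot>\<^bsub>C\<^esub> h) = h"
      using cmp_assoc[OF assms(2) h e[OF GW] functor_hom[OF G d[OF W]]] t2[OF W] idt_left[OF assms(2) h]
      by simp
    finally show ?thesis .
  qed
  have 3: "\<epsilon> W \<cdot>\<^bsub>E\<^esub> fa F (fa G m \<cdot>\<^bsub>C\<^esub> \<eta> X) = m" if m: "m \<in> hom E (fo F X) W" for m W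
  proof -
    have W: "W \<in> ob E" using hom_ob(2)[OF assms(3) m] .
    have Gm: "fa G m \<in> hom C (fo G (fo F X)) (fo G W)" using G m by (rule functor_hom)
    have "\<epsilon> W \<cdot>\<^bsub>E\<^esub> fa F (fa G m \<cdot>\<^bsub>C\<^esub> \<eta> X) = (\<epsilon> W \<cdot>\<^bsub>E\<^esub> fa F (fa G m)) \<cdot>\<^bsub>E\<^esub> fa F (\<eta> X)"
      using functor_cmp[OF F e[OF assms(4)] Gm]
       cmp_assoc[OF assms(3) functor_hom[OF F e[OF assms(4)]] functor_hom[OF F Gm] d[OF W]] by simp
    also have "\<epsilon> W \<cdot>\<^bsub>E\<^esub> fa F (fa G m) = m \<cdot>\<^bsub>E\<^esub> \<epsilon> (fo F X)"
      using ntD(4)[OF \<epsilon> m] by (simp add: homD(1)[OF m])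
    also have "(m \<cdot>\<^bsub>E\<^esub> \<epsilon> (fo F X)) \<cdot>\<^bsub>E\<^esub> fa F (\<eta> X) = m"
      using cmp_assoc[OF assms(3) functor_hom[OF F e[OF assms(4)]] d[OF FX] m] t1
        idt_right[OF assms(3) m] by simp
    finally show ?thesis .
  qed
  show "universal C E G X (fo F X) (\<eta> X)"
    unfolding universal_def
  proof (intro conjI ballI)
    fix W h assume W: "W \<in> ob E" and h: "h \<in> hom C X (fo G W)"
    show "\<exists>!m. m \<in> hom E (fo F X) W \<and> fa G m \<cdot>\<^bsub>C\<^esub> \<eta> X = h"
      by (rule ex1I[of _ "\<epsilon> W \<cdot>\<^bsub>E\<^esub> fa F h"]) (use 1[OF W h] 2[OF W h] 3 in auto)
  qed (use FX e assms in auto)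
qed

section \<open>Small categories\<close>

lemma smallD:
  assumes "smallness small"
  shows small_subset: "small X \<Longrightarrow> Y \<subseteq> X \<Longrightarrow> small Y"
    and small_image: "small X \<Longrightarrow> small (f ` X)"
    and small_UN: "small I \<Longrightarrow> (\<And>i. i \<in> I \<Longrightarrow> small (F i)) \<Longrightarrow> small (\<Union>i \<in> I. F i)"
  using assms by (auto simp: smallness_def)

text \<open>An infinite small set has subsets of every finite cardinality, and \<open>Y\<close> is
  the image of one of them under a bijection.\<close>

lemma small_finite:
  assumes "smallness small" "finite Y"
  shows "small Y"
proof -
  obtain X where X: "small X" "infinite X" using assms(1) by (auto simp: smallness_def)
  then obtain T where T: "T \<subseteq> X" "finite T" "card T = card Y"
    using infinite_arbitrarily_large by metis
  then obtain f where "bij_betw f T Y" using finite_same_card_bij assms(2) by metis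
  then have "Y = f ` T" by (simp add: bij_betw_def)
  then show ?thesis using X T small_subset[OF assms(1)] small_image[OF assms(1)] by metis
qed

lemma small_Pairs:
  assumes "smallness small" "small X" "small Y"
  shows "small {Pair a b | a b. a \<in> X \<and> b \<in> Y}"
proof -
  have "{Pair a b | a b. a \<in> X \<and> b \<in> Y} = (\<Union>a \<in> X. Pair a ` Y)" by auto
  then show ?thesis using small_UN[OF assms(1,2)] small_image[OF assms(1,3)] by simp
qed

lemma small_catD: "small_cat small A \<Longrightarrow> category A"
  by (simp add: small_cat_def)

section \<open>Products of small categories\<close>

lemma in_hom_prod_iff:
  "f \<in> hom (A \<times>\<^sub>c B) p q \<longleftrightarrow>
    (\<exists>a b a' b' g h. p = Pair a b \<and> q = Pair a' b' \<and> f = Pair g h \<and> g \<in> hom A a a' \<and> h \<in> hom B b b')"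
  by (auto simp: hom_def prod_cat_def)

lemma in_ob_prod_iff:
  "p \<in> ob (A \<times>\<^sub>c B) \<longleftrightarrow> (\<exists>a b. p = Pair a b \<and> a \<in> ob A \<and> b \<in> ob B)"
  by (auto simp: prod_cat_def)

lemma in_ar_prod_iff:
  "f \<in> ar (A \<times>\<^sub>c B) \<longleftrightarrow> (\<exists>g h. f = Pair g h \<and> g \<in> ar A \<and> h \<in> ar B)"
  by (auto simp: prod_cat_def)

lemma Pair_hom_prod: "Pair g h \<in> hom (A \<times>\<^sub>c B) (Pair a b) (Pair a' b') \<longleftrightarrow> g \<in> hom A a a' \<and> h \<in> hom B b b'"
  by (auto simp: in_hom_prod_iff)

lemma prod_cat_simps [simp]:
  "src (A \<times>\<^sub>c B) (Pair g h) = Pair (src A g) (src B h)"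
  "tgt (A \<times>\<^sub>c B) (Pair g h) = Pair (tgt A g) (tgt B h)"
  "idt (A \<times>\<^sub>c B) (Pair a b) = Pair (idt A a) (idt B b)"
  "Pair g' h' \<cdot>\<^bsub>A \<times>\<^sub>c B\<^esub> Pair g h = Pair (g' \<cdot>\<^bsub>A\<^esub> g) (h' \<cdot>\<^bsub>B\<^esub> h)"
  "Pair a b \<in> ob (A \<times>\<^sub>c B) \<longleftrightarrow> a \<in> ob A \<and> b \<in> ob B"
  "Pair g h \<in> ar (A \<times>\<^sub>c B) \<longleftrightarrow> g \<in> ar A \<and> h \<in> ar B"
  by (auto simp: prod_cat_def)

lemma prod_category:
  assumes "category A" "category B"
  shows "category (A \<times>\<^sub>c B)"
  using assms unfolding category_def
  by (auto simp: in_ob_prod_iff in_ar_prod_iff Pair_hom_prod)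

lemma prod_small_cat:
  assumes "smallness small" "small_cat small A" "small_cat small B"
  shows "small_cat small (A \<times>\<^sub>c B)"
  using assms small_Pairs[OF assms(1)] prod_category
  by (auto simp: small_cat_def prod_cat_def)

lemma prod_ftor_simps [simp]:
  "a \<in> ob A \<Longrightarrow> b \<in> ob B \<Longrightarrow> fo (prod_ftor A B u v) (Pair a b) = Pair (fo u a) (fo v b)"
  "f \<in> ar A \<Longrightarrow> g \<in> ar B \<Longrightarrow> fa (prod_ftor A B u v) (Pair f g) = Pair (fa u f) (fa v g)"
  by (auto simp: prod_ftor_def)

lemma proj2_simps [simp]:
  "a \<in> ob A \<Longrightarrow> b \<in> ob B \<Longrightarrow> fo (proj2 A B) (Pair a b) = b"
  "f \<in> ar A \<Longrightarrow> g \<in> ar B \<Longrightarrow> fa (proj2 A B) (Pair f g) = g"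
  by (auto simp: proj2_def)

lemma slice_at_simps [simp]:
  "b \<in> ob B \<Longrightarrow> fo (slice_at A B a) b = Pair a b"
  "g \<in> ar B \<Longrightarrow> fa (slice_at A B a) g = Pair (idt A a) g"
  by (auto simp: slice_at_def)

lemma prod_ftor_functor:
  assumes "category A" "category B" "category A'" "category B'" "is_functor A A' u" "is_functor B B' v"
  shows "is_functor (A \<times>\<^sub>c B) (A' \<times>\<^sub>c B') (prod_ftor A B u v)"
  unfolding prod_ftor_def
  by (rule mk_ftor_functor)
    (use assms in \<open>auto simp: prod_category in_ob_prod_iff in_hom_prod_iff functor_ob functor_idt functor_hom
      functor_cmp[OF assms(5)] functor_cmp[OF assms(6)]\<close>)

lemma proj2_functor:
  assumes "category A" "category B"
  shows "is_functor (A \<times>\<^sub>c B) B (proj2 A B)"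
  unfolding proj2_def
  by (rule mk_ftor_functor) (use assms in \<open>auto simp: prod_category in_ob_prod_iff in_hom_prod_iff\<close>)

lemma slice_at_functor:
  assumes "category A" "category B" "a \<in> ob A"
  shows "is_functor B (A \<times>\<^sub>c B) (slice_at A B a)"
  unfolding slice_at_def
  by (rule mk_ftor_functor)
    (use assms in \<open>auto simp: prod_category Pair_hom_prod idt_hom idt_left[OF _ idt_hom]\<close>)

lemma prod_nt_nt:
  assumes "category A" "category B" "category A'" "category B'"
    and "is_nt A A' u u' \<alpha>" "is_nt B B' v v' \<beta>"
  shows "is_nt (A \<times>\<^sub>c B) (A' \<times>\<^sub>c B') (prod_ftor A B u v) (prod_ftor A B u' v') (prod_nt A B \<alpha> \<beta>)"
proof (rule ntI)
  note m = ntD[OF assms(5)] and n = ntD[OF assms(6)]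
  show "is_functor (A \<times>\<^sub>c B) (A' \<times>\<^sub>c B') (prod_ftor A B u v)"
    "is_functor (A \<times>\<^sub>c B) (A' \<times>\<^sub>c B') (prod_ftor A B u' v')"
    using assms m(1,2) n(1,2) by (simp_all add: prod_ftor_functor)
  show "prod_nt A B \<alpha> \<beta> p \<in> hom (A' \<times>\<^sub>c B') (fo (prod_ftor A B u v) p) (fo (prod_ftor A B u' v') p)"
    if "p \<in> ob (A \<times>\<^sub>c B)" for p
    using that m(3) n(3) by (auto simp: in_ob_prod_iff prod_nt_def Pair_hom_prod)
  show "prod_nt A B \<alpha> \<beta> q \<cdot>\<^bsub>A' \<times>\<^sub>c B'\<^esub> fa (prod_ftor A B u v) f
      = fa (prod_ftor A B u' v') f \<cdot>\<^bsub>A' \<times>\<^sub>c B'\<^esub> prod_nt A B \<alpha> \<beta> p"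
    if f: "f \<in> hom (A \<times>\<^sub>c B) p q" for f p q
  proof -
    obtain a b a' b' g h where *: "p = Pair a b" "q = Pair a' b'" "f = Pair g h" "g \<in> hom A a a'" "h \<in> hom B b b'"
      using f by (auto simp: in_hom_prod_iff)
    then show ?thesis
      using hom_ob[OF assms(1) *(4)] hom_ob[OF assms(2) *(5)] m(4)[OF *(4)] n(4)[OF *(5)]
      by (simp add: prod_nt_def homD(1))
  qed
qed (use assms in \<open>auto simp: prod_category prod_nt_def\<close>)

lemma slice_nt_nt:
  assumes "category A" "category B" "e \<in> hom A a a'"
  shows "is_nt B (A \<times>\<^sub>c B) (slice_at A B a) (slice_at A B a') (slice_nt B e)"
proof (rule ntI)
  show "slice_nt B e y \<cdot>\<^bsub>A \<times>\<^sub>c B\<^esub> fa (slice_at A B a) f = fa (slice_at A B a') f \<cdot>\<^bsub>A \<times>\<^sub>c B\<^esub> slice_nt B e x"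
    if f: "f \<in> hom B x y" for f x y
    using hom_ob[OF assms(2) f] idt_left[OF assms(1,3)] idt_right[OF assms(1,3)]
      idt_left[OF assms(2) f] idt_right[OF assms(2) f]
    by (simp add: slice_nt_def homD(1)[OF f])
qed (use assms hom_ob[OF assms(1,3)] in
    \<open>auto simp: prod_category slice_at_functor slice_nt_def Pair_hom_prod idt_hom\<close>)

section \<open>Posets as categories and the terminal category\<close>

lemma in_hom_poset_iff:
  "f \<in> hom (poset_cat P) x y \<longleftrightarrow>
    (\<exists>S T. x = Vertex S \<and> y = Vertex T \<and> f = Pair x y \<and> S \<in> P \<and> T \<in> P \<and> S \<subseteq> T)"
  by (auto simp: hom_def poset_cat_def)

lemma in_ob_poset_iff: "x \<in> ob (poset_cat P) \<longleftrightarrow> (\<exists>S. x = Vertex S \<and> S \<in> P)"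
  by (auto simp: poset_cat_def)

lemma in_ar_poset_iff:
  "f \<in> ar (poset_cat P) \<longleftrightarrow> (\<exists>S T. f = Pair (Vertex S) (Vertex T) \<and> S \<in> P \<and> T \<in> P \<and> S \<subseteq> T)"
  by (auto simp: poset_cat_def)

lemma poset_cat_simps [simp]:
  "idt (poset_cat P) x = Pair x x"
  "Pair y z \<cdot>\<^bsub>poset_cat P\<^esub> Pair x y' = Pair x z"
  "src (poset_cat P) (Pair x y) = x" "tgt (poset_cat P) (Pair x y) = y"
  by (auto simp: poset_cat_def)

lemma poset_category: "category (poset_cat P)"
  unfolding category_def by (auto simp: in_ob_poset_iff in_ar_poset_iff in_hom_poset_iff)

lemma poset_small_cat:
  fixes small :: "'a uni set \<Rightarrow> bool"
  assumes "smallness small" "finite P"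
  shows "small_cat small (poset_cat P)"
proof -
  have 1: "finite (ob (poset_cat P :: 'a scat))" using assms by (simp add: poset_cat_def)
  have "ar (poset_cat P :: 'a scat) \<subseteq> (\<lambda>(S, T). Pair (Vertex S) (Vertex T)) ` (P \<times> P)"
    by (auto simp: in_ar_poset_iff)
  then have "finite (ar (poset_cat P :: 'a scat))" using assms(2) finite_subset by blast
  then show ?thesis
    using 1 small_finite[OF assms(1)] by (simp add: small_cat_def poset_category)
qed

lemma one_small_cat: "smallness small \<Longrightarrow> small_cat small one"
  unfolding one_def by (rule poset_small_cat) auto

lemma one_category: "category one"
  by (simp add: one_def poset_category)

lemma ob_one [simp]: "x \<in> ob one \<longleftrightarrow> x = star"
  by (auto simp: one_def in_ob_poset_iff star_def)

lemma ar_one [simp]: "f \<in> ar one \<longleftrightarrow> f = Pair star star"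
  by (auto simp: one_def in_ar_poset_iff star_def)

lemma hom_one [simp]: "f \<in> hom one x y \<longleftrightarrow> x = star \<and> y = star \<and> f = Pair star star"
  by (auto simp: one_def in_hom_poset_iff star_def)

lemma idt_one [simp]: "idt one x = Pair x x"
  by (simp add: one_def)

lemma to_one_functor: "category A \<Longrightarrow> is_functor A one (to_one A)"
  unfolding to_one_def by (rule const_ftor_functor) (auto simp: one_category)

text \<open>Terminality of \<open>one\<close>. It gives equalities such as
  \<open>comp_ftor Q (to_one K) s = to_one Q\<close>, to which a strict 2-functor can be
  applied.\<close>

lemma functor_one_unique: "is_functor A one u \<Longrightarrow> category A \<Longrightarrow> u = to_one A"
proof -
  assume u: "is_functor A one u" and A: "category A"
  have "fo u x = star" if "x \<in> ob A" for x using functor_ob[OF u that] by simp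
  moreover have "fa u f = Pair star star" if "f \<in> ar A" for f
    using functor_hom[OF u ar_hom[OF that]] by simp
  ultimately show ?thesis
    by (intro functor_eqI[OF u to_one_functor[OF A]]) (auto simp: to_one_def)
qed

lemma point_functor: "category A \<Longrightarrow> a \<in> ob A \<Longrightarrow> is_functor one A (point A a)"
  unfolding point_def by (rule const_ftor_functor) (auto simp: one_category)

lemma point_simps [simp]:
  "fo (point A a) star = a" "fa (point A a) (Pair star star) = idt A a"
  by (auto simp: point_def)

lemma to_one_simps [simp]:
  "x \<in> ob A \<Longrightarrow> fo (to_one A) x = star" "f \<in> ar A \<Longrightarrow> fa (to_one A) f = Pair star star"
  by (auto simp: to_one_def)

section \<open>Comma categories over an object\<close>

lemma comma_over_simps [simp]:
  "src (comma_over A B u b) e = pfst (pfst e)" "tgt (comma_over A B u b) e = psnd (pfst e)"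
  "idt (comma_over A B u b) x = Pair (Pair x x) (idt A (pfst x))"
  "e \<cdot>\<^bsub>comma_over A B u b\<^esub> d = Pair (Pair (pfst (pfst d)) (psnd (pfst e))) (psnd e \<cdot>\<^bsub>A\<^esub> psnd d)"
  by (auto simp: comma_over_def Let_def)

lemma in_ob_comma_over_iff:
  "x \<in> ob (comma_over A B u b) \<longleftrightarrow> (\<exists>a f. x = Pair a f \<and> a \<in> ob A \<and> f \<in> hom B (fo u a) b)"
  by (auto simp: comma_over_def Let_def)

lemma in_ar_comma_over_iff:
  "e \<in> ar (comma_over A B u b) \<longleftrightarrow> (\<exists>x y h. e = Pair (Pair x y) h \<and> x \<in> ob (comma_over A B u b)
     \<and> y \<in> ob (comma_over A B u b) \<and> h \<in> hom A (pfst x) (pfst y) \<and> psnd y \<cdot>\<^bsub>B\<^esub> fa u h = psnd x)"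
  by (auto simp: comma_over_def Let_def)

lemma in_hom_comma_over_iff:
  "e \<in> hom (comma_over A B u b) x y \<longleftrightarrow> (\<exists>h. e = Pair (Pair x y) h \<and> x \<in> ob (comma_over A B u b)
     \<and> y \<in> ob (comma_over A B u b) \<and> h \<in> hom A (pfst x) (pfst y) \<and> psnd y \<cdot>\<^bsub>B\<^esub> fa u h = psnd x)"
  by (auto simp: hom_def in_ar_comma_over_iff)

lemma comma_over_category:
  assumes A: "category A" and B: "category B" and u: "is_functor A B u"
  shows "category (comma_over A B u b)"
proof -
  let ?K = "comma_over A B u b"
  have i: "idt ?K x \<in> hom ?K x x" if x: "x \<in> ob ?K" for x
    using x A B by (auto simp: in_hom_comma_over_iff in_ob_comma_over_iff idt_hom functor_idt[OF u] idt_right)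
  have c: "g \<cdot>\<^bsub>?K\<^esub> f \<in> hom ?K x z" if f: "f \<in> hom ?K x y" and g: "g \<in> hom ?K y z" for f g x y z
  proof -
    obtain h k where h: "f = Pair (Pair x y) h" "h \<in> hom A (pfst x) (pfst y)" "psnd y \<cdot>\<^bsub>B\<^esub> fa u h = psnd x"
      and k: "g = Pair (Pair y z) k" "k \<in> hom A (pfst y) (pfst z)" "psnd z \<cdot>\<^bsub>B\<^esub> fa u k = psnd y"
      and o: "x \<in> ob ?K" "y \<in> ob ?K" "z \<in> ob ?K"
      using f g by (auto simp: in_hom_comma_over_iff)
    have "psnd z \<in> hom B (fo u (pfst z)) b" using o by (auto simp: in_ob_comma_over_iff)
    then have "psnd z \<cdot>\<^bsub>B\<^esub> fa u (k \<cdot>\<^bsub>A\<^esub> h) = psnd x"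
      using cmp_assoc[OF B functor_hom[OF u h(2)] functor_hom[OF u k(2)]] functor_cmp[OF u h(2) k(2)] h(3) k(3)
      by simp
    then show ?thesis using h k o cmp_hom[OF A h(2) k(2)] by (auto simp: in_hom_comma_over_iff)
  qed
  show ?thesis
    unfolding category_def
  proof (intro conjI ballI impI)
    fix f g assume "f \<in> ar ?K" "g \<in> ar ?K" "tgt ?K f = src ?K g"
    then show "g \<cdot>\<^bsub>?K\<^esub> f \<in> hom ?K (src ?K f) (tgt ?K g)"
      using c[OF ar_hom, of f g "tgt ?K g"] ar_hom[of g ?K] by simp
  next
    fix f g h assume a: "f \<in> ar ?K" "g \<in> ar ?K" "h \<in> ar ?K" "tgt ?K f = src ?K g" "tgt ?K g = src ?K h"
    have "psnd f \<in> hom A (pfst (src ?K f)) (pfst (tgt ?K f))" if "f \<in> ar ?K" for f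
      using that by (auto simp: in_ar_comma_over_iff)
    from this[OF a(1)] this[OF a(2)] this[OF a(3)] a(4,5)
    have "psnd h \<cdot>\<^bsub>A\<^esub> (psnd g \<cdot>\<^bsub>A\<^esub> psnd f) = (psnd h \<cdot>\<^bsub>A\<^esub> psnd g) \<cdot>\<^bsub>A\<^esub> psnd f"
      by (metis cmp_assoc[OF A])
    then show "h \<cdot>\<^bsub>?K\<^esub> (g \<cdot>\<^bsub>?K\<^esub> f) = (h \<cdot>\<^bsub>?K\<^esub> g) \<cdot>\<^bsub>?K\<^esub> f" by simp
  next
    fix f assume "f \<in> ar ?K"
    then obtain x y h where h: "f = Pair (Pair x y) h" "h \<in> hom A (pfst x) (pfst y)" "x \<in> ob ?K" "y \<in> ob ?K"
      by (auto simp: in_ar_comma_over_iff)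
    then show "src ?K f \<in> ob ?K" "tgt ?K f \<in> ob ?K"
      "f \<cdot>\<^bsub>?K\<^esub> idt ?K (src ?K f) = f" "idt ?K (tgt ?K f) \<cdot>\<^bsub>?K\<^esub> f = f"
      using idt_left[OF A h(2)] idt_right[OF A h(2)] by simp_all
  qed (use i in auto)
qed

text \<open>The laws of a prederivator and (Der3) apply to small categories only, so the comma
  category in (Der4) has to be small. Its objects and arrows are iterated pairs of elements of small
  sets.\<close>

lemma comma_over_small_cat:
  assumes "smallness small" "small_cat small A" "small_cat small B" "is_functor A B u"
  shows "small_cat small (comma_over A B u b)"
proof -
  let ?K = "comma_over A B u b"
  note sub = small_subset[OF assms(1)] and pairs = small_Pairs[OF assms(1)]
  have A: "small (ob A)" "small (ar A)" and B: "small (ar B)"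
    using assms by (auto simp: small_cat_def)
  have "ob ?K \<subseteq> {Pair a f | a f. a \<in> ob A \<and> f \<in> ar B}"
    by (auto simp: in_ob_comma_over_iff hom_def)
  then have ob: "small (ob ?K)" by (rule sub[OF pairs[OF A(1) B]])
  have "ar ?K \<subseteq> {Pair p h | p h. p \<in> {Pair x y | x y. x \<in> ob ?K \<and> y \<in> ob ?K} \<and> h \<in> ar A}"
  proof
    fix e assume "e \<in> ar ?K"
    then obtain x y h where *: "e = Pair (Pair x y) h" "x \<in> ob ?K" "y \<in> ob ?K" "h \<in> hom A (pfst x) (pfst y)"
      unfolding in_ar_comma_over_iff by blast
    then show "e \<in> {Pair p h | p h. p \<in> {Pair x y | x y. x \<in> ob ?K \<and> y \<in> ob ?K} \<and> h \<in> ar A}"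
      using homD(1)[OF *(4)] by simp
  qed
  then have "small (ar ?K)" by (rule sub[OF pairs[OF pairs[OF ob ob] A(2)]])
  with ob show ?thesis
    using comma_over_category[OF assms(2)[THEN small_catD] assms(3)[THEN small_catD] assms(4)]
    by (simp add: small_cat_def)
qed

lemma comma_proj_simps [simp]:
  "Pair a f \<in> ob K \<Longrightarrow> fo (comma_proj K) (Pair a f) = a"
  "Pair e h \<in> ar K \<Longrightarrow> fa (comma_proj K) (Pair e h) = h"
  by (auto simp: comma_proj_def)

lemma comma_proj_functor:
  assumes "category A" "category B" "is_functor A B u"
  shows "is_functor (comma_over A B u b) A (comma_proj (comma_over A B u b))"
  unfolding comma_proj_def
  by (rule mk_ftor_functor)
    (use assms in \<open>auto simp: comma_over_category in_ob_comma_over_iff in_hom_comma_over_iff\<close>)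

lemma comma_nt_nt:
  fixes A B u b
  defines "K \<equiv> comma_over A B u b"
  assumes "category A" "category B" "is_functor A B u" "b \<in> ob B"
  shows "is_nt K B (comp_ftor K u (comma_proj K)) (comp_ftor K (point B b) (to_one K)) (comma_nt K)"
proof -
  have K: "category K" unfolding K_def using assms by (simp add: comma_over_category)
  show ?thesis
  proof (rule ntI)
    show "is_functor K B (comp_ftor K u (comma_proj K))"
      using comp_ftor_functor[OF K assms(3) comma_proj_functor[OF assms(2-4), of b, folded K_def] assms(4)] .
    show "is_functor K B (comp_ftor K (point B b) (to_one K))"
      using comp_ftor_functor[OF K assms(3) to_one_functor[OF K] point_functor[OF assms(3,5)]] .
    show "comma_nt K x \<in> hom B (fo (comp_ftor K u (comma_proj K)) x) (fo (comp_ftor K (point B b) (to_one K)) x)"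
      if "x \<in> ob K" for x
      using that by (auto simp: comma_nt_def in_ob_comma_over_iff comma_proj_def K_def)
    show "comma_nt K y \<cdot>\<^bsub>B\<^esub> fa (comp_ftor K u (comma_proj K)) f
      = fa (comp_ftor K (point B b) (to_one K)) f \<cdot>\<^bsub>B\<^esub> comma_nt K x" if f: "f \<in> hom K x y" for f x y
    proof -
      have o: "f \<in> ar K" "x \<in> ob K" "y \<in> ob K" using f K hom_ob[OF K f] by (auto simp: homD)
      then have "psnd x \<in> hom B (fo u (pfst x)) b" by (auto simp: K_def in_ob_comma_over_iff)
      with o f show ?thesis
        by (auto simp: comma_nt_def comma_proj_def in_hom_comma_over_iff K_def idt_left[OF assms(3)])
    qed
  qed (use K in \<open>auto simp: comma_nt_def\<close>)
qed

section \<open>Kan extensions in a derivator\<close>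

locale derivator_on =
  fixes small :: "'a uni set \<Rightarrow> bool" and D :: "('a, 'o, 'm) prederiv"
  assumes smallness: "smallness small" and derivator: "derivator small D"
begin

section \<open>The laws of a prederivator at single objects and arrows\<close>

lemma prederiv: "prederivator small D"
  using derivator by (simp add: derivator_def)

lemma D0_category: "small_cat small A \<Longrightarrow> category (D0 D A)"
  using prederiv unfolding prederivator_def by (elim conjE) blast

lemma D1_functor:
  "small_cat small A \<Longrightarrow> small_cat small B \<Longrightarrow> is_functor A B u
   \<Longrightarrow> is_functor (D0 D B) (D0 D A) (D1 D A B u)"
  using prederiv unfolding prederivator_def by (elim conjE) blast

lemma D1_ob:
  "small_cat small A \<Longrightarrow> small_cat small B \<Longrightarrow> is_functor A B u \<Longrightarrow> X \<in> ob (D0 D B)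
   \<Longrightarrow> fo (D1 D A B u) X \<in> ob (D0 D A)"
  using D1_functor functor_ob by metis

lemma D1_hom:
  "small_cat small A \<Longrightarrow> small_cat small B \<Longrightarrow> is_functor A B u \<Longrightarrow> f \<in> hom (D0 D B) X Y
   \<Longrightarrow> fa (D1 D A B u) f \<in> hom (D0 D A) (fo (D1 D A B u) X) (fo (D1 D A B u) Y)"
  using D1_functor functor_hom by metis

lemma D1_id: "small_cat small A \<Longrightarrow> D1 D A A (id_ftor A) = id_ftor (D0 D A)"
  using prederiv unfolding prederivator_def by (elim conjE) blast

lemma D1_comp:
  "small_cat small A \<Longrightarrow> small_cat small B \<Longrightarrow> small_cat small C \<Longrightarrow> is_functor A B u \<Longrightarrow> is_functor B C v
   \<Longrightarrow> D1 D A C (comp_ftor A v u) = comp_ftor (D0 D C) (D1 D A B u) (D1 D B C v)"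
  using prederiv unfolding prederivator_def by (elim conjE) blast

lemma D1_comp_ob:
  "small_cat small A \<Longrightarrow> small_cat small B \<Longrightarrow> small_cat small C \<Longrightarrow> is_functor A B u \<Longrightarrow> is_functor B C v
   \<Longrightarrow> X \<in> ob (D0 D C) \<Longrightarrow> fo (D1 D A C (comp_ftor A v u)) X = fo (D1 D A B u) (fo (D1 D B C v) X)"
  by (simp add: D1_comp)

lemma D1_comp_hom:
  "small_cat small A \<Longrightarrow> small_cat small B \<Longrightarrow> small_cat small C \<Longrightarrow> is_functor A B u \<Longrightarrow> is_functor B C v
   \<Longrightarrow> f \<in> hom (D0 D C) X Y \<Longrightarrow> fa (D1 D A C (comp_ftor A v u)) f = fa (D1 D A B u) (fa (D1 D B C v) f)"
  by (simp add: D1_comp comp_ftor_hom_simp)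

lemma D2_nt:
  "small_cat small A \<Longrightarrow> small_cat small B \<Longrightarrow> is_nt A B u v \<alpha>
   \<Longrightarrow> is_nt (D0 D B) (D0 D A) (D1 D A B u) (D1 D A B v) (D2 D A B u v \<alpha>)"
  using prederiv unfolding prederivator_def by (elim conjE) blast

lemma D2_hom:
  "small_cat small A \<Longrightarrow> small_cat small B \<Longrightarrow> is_nt A B u v \<alpha> \<Longrightarrow> X \<in> ob (D0 D B)
   \<Longrightarrow> D2 D A B u v \<alpha> X \<in> hom (D0 D A) (fo (D1 D A B u) X) (fo (D1 D A B v) X)"
  using D2_nt ntD(3) by metis

lemma D2_natural:
  "small_cat small A \<Longrightarrow> small_cat small B \<Longrightarrow> is_nt A B u v \<alpha> \<Longrightarrow> f \<in> hom (D0 D B) X Y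
   \<Longrightarrow> D2 D A B u v \<alpha> Y \<cdot>\<^bsub>D0 D A\<^esub> fa (D1 D A B u) f = fa (D1 D A B v) f \<cdot>\<^bsub>D0 D A\<^esub> D2 D A B u v \<alpha> X"
  using ntD(4)[OF D2_nt] .

lemma D2_id:
  "small_cat small A \<Longrightarrow> small_cat small B \<Longrightarrow> is_functor A B u \<Longrightarrow> X \<in> ob (D0 D B)
   \<Longrightarrow> D2 D A B u u (id_nt A B u) X = idt (D0 D A) (fo (D1 D A B u) X)"
  using prederiv[unfolded prederivator_def, THEN conjunct2, THEN conjunct2, THEN conjunct2, THEN conjunct2, THEN conjunct2, THEN conjunct1, rule_format, of A B u]
  by (simp add: id_nt_def)

lemma D2_vcomp:
  assumes "small_cat small A" "small_cat small B" "is_nt A B u v \<alpha>" "is_nt A B v w \<beta>" "X \<in> ob (D0 D B)"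
  shows "D2 D A B u w (vcomp A B \<beta> \<alpha>) X = D2 D A B v w \<beta> X \<cdot>\<^bsub>D0 D A\<^esub> D2 D A B u v \<alpha> X"
proof -
  have "D2 D A B u w (vcomp A B \<beta> \<alpha>) = vcomp (D0 D B) (D0 D A) (D2 D A B v w \<beta>) (D2 D A B u v \<alpha>)"
    using prederiv[unfolded prederivator_def, THEN conjunct2, THEN conjunct2, THEN conjunct2, THEN conjunct2, THEN conjunct2, THEN conjunct2, THEN conjunct1, rule_format, OF assms(1-4)] .
  then show ?thesis using assms(5) by (simp add: vcomp_def)
qed

lemma D2_hcomp:
  assumes "small_cat small A" "small_cat small B" "small_cat small C" "is_nt A B u u' \<alpha>" "is_nt B C v v' \<beta>"
    and "X \<in> ob (D0 D C)"
  shows "D2 D A C (comp_ftor A v u) (comp_ftor A v' u') (hcomp A C u v' \<beta> \<alpha>) X =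
    fa (D1 D A B u') (D2 D B C v v' \<beta> X) \<cdot>\<^bsub>D0 D A\<^esub> D2 D A B u u' \<alpha> (fo (D1 D B C v) X)"
proof -
  have "D2 D A C (comp_ftor A v u) (comp_ftor A v' u') (hcomp A C u v' \<beta> \<alpha>) =
          hcomp (D0 D C) (D0 D A) (D1 D B C v) (D1 D A B u') (D2 D A B u u' \<alpha>) (D2 D B C v v' \<beta>)"
    using prederiv[unfolded prederivator_def, THEN conjunct2, THEN conjunct2, THEN conjunct2, THEN conjunct2, THEN conjunct2, THEN conjunct2, THEN conjunct2, rule_format, OF assms(1-5)] .
  then show ?thesis using assms(6) by (simp add: hcomp_def)
qed

text \<open>This is \<open>hcomp\<close> with the identity of the inner functor \<open>w\<close>. As
  \<open>D1\<close> reverses 1-cells, precomposition with \<open>w\<close> turns into applying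
  \<open>w^*\<close> afterwards.\<close>

lemma D2_pre_whisker:
  assumes "small_cat small A" "small_cat small B" "small_cat small C" "is_functor A B w" "is_nt B C u v \<alpha>"
    and "X \<in> ob (D0 D C)"
  shows "D2 D A C (comp_ftor A u w) (comp_ftor A v w) (pre_whisker A \<alpha> w) X
    = fa (D1 D A B w) (D2 D B C u v \<alpha> X)"
proof -
  have c: "category A" "category B" "category C" using assms(1-3) by (auto dest: small_catD)
  have "fa v (idt B (fo w x)) \<cdot>\<^bsub>C\<^esub> \<alpha> (fo w x) = \<alpha> (fo w x)" if "x \<in> ob A" for x
    using functor_ob[OF assms(4) that] functor_idt[OF ntD(2)[OF assms(5)]] idt_left[OF c(3) ntD(3)[OF assms(5)]]
    by metis
  then have "hcomp A C w v \<alpha> (id_nt A B w) = pre_whisker A \<alpha> w"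
    by (auto simp: hcomp_def pre_whisker_def id_nt_def intro!: restrict_ext)
  moreover have u: "is_functor B C u" using ntD(1)[OF assms(5)] .
  moreover have "fa (D1 D A B w) (D2 D B C u v \<alpha> X) \<cdot>\<^bsub>D0 D A\<^esub> D2 D A B w w (id_nt A B w) (fo (D1 D B C u) X)
      = fa (D1 D A B w) (D2 D B C u v \<alpha> X)"
    using D2_id[OF assms(1,2,4) D1_ob[OF assms(2,3) u assms(6)]]
      idt_right[OF D0_category[OF assms(1)] D1_hom[OF assms(1,2,4) D2_hom[OF assms(2,3,5,6)]]]
    by simp
  ultimately show ?thesis
    using D2_hcomp[OF assms(1-3) id_nt_nt[OF c(1,2) assms(4)] assms(5,6)] by simp
qed

text \<open>This is \<open>hcomp\<close> with the identity of the outer functor \<open>w\<close>.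
  The reversal of 1-cells turns postcomposition with \<open>w\<close> into evaluation at the object
  \<open>w^* X\<close>.\<close>

lemma D2_post_whisker:
  assumes "small_cat small A" "small_cat small B" "small_cat small C" "is_nt A B u v \<alpha>" "is_functor B C w"
    and "X \<in> ob (D0 D C)"
  shows "D2 D A C (comp_ftor A w u) (comp_ftor A w v) (post_whisker A w \<alpha>) X
    = D2 D A B u v \<alpha> (fo (D1 D B C w) X)"
proof -
  have c: "category A" "category B" "category C" using assms(1-3) by (auto dest: small_catD)
  have u: "is_functor A B u" and v: "is_functor A B v" using ntD(1,2)[OF assms(4)] .
  have "fa w (\<alpha> x) \<cdot>\<^bsub>C\<^esub> idt C (fo w (fo u x)) = fa w (\<alpha> x)" if "x \<in> ob A" for x
    using idt_right[OF c(3) functor_hom[OF assms(5) ntD(3)[OF assms(4) that]]] .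
  then have "hcomp A C u w (id_nt B C w) \<alpha> = post_whisker A w \<alpha>"
    using functor_ob[OF u] by (auto simp: hcomp_def post_whisker_def id_nt_def intro!: restrict_ext)
  moreover have "fa (D1 D A B v) (D2 D B C w w (id_nt B C w) X) \<cdot>\<^bsub>D0 D A\<^esub> D2 D A B u v \<alpha> (fo (D1 D B C w) X)
      = D2 D A B u v \<alpha> (fo (D1 D B C w) X)"
    using D2_id[OF assms(2,3,5,6)] functor_idt[OF D1_functor[OF assms(1,2) v] D1_ob[OF assms(2,3,5,6)]]
      idt_left[OF D0_category[OF assms(1)] D2_hom[OF assms(1,2,4) D1_ob[OF assms(2,3,5,6)]]]
    by simp
  ultimately show ?thesis
    using D2_hcomp[OF assms(1-4) id_nt_nt[OF c(2,3) assms(5)] assms(6)] by simp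
qed

text \<open>
  For \<open>u : A \<rightarrow> E\<close>, \<open>k : A' \<rightarrow> A\<close>, \<open>\<Psi> : u k \<Rightarrow> w\<close> and \<open>\<eta> : X \<rightarrow> u\<^sup>* Z\<close>, the map
  \<open>k\<^sup>* X \<rightarrow> k\<^sup>* u\<^sup>* Z \<rightarrow> w\<^sup>* Z\<close>.
\<close>

definition transport :: "'a scat \<Rightarrow> 'a scat \<Rightarrow> 'a scat \<Rightarrow> 'a sftor \<Rightarrow> 'a sftor \<Rightarrow> 'a sftor \<Rightarrow> 'a snt
    \<Rightarrow> 'o \<Rightarrow> 'm \<Rightarrow> 'm" where
  "transport A' A E u k w \<Psi> Z \<eta> =
    D2 D A' E (comp_ftor A' u k) w \<Psi> Z \<cdot>\<^bsub>D0 D A'\<^esub> fa (D1 D A' A k) \<eta>"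

section \<open>Pasting 2-cells onto an arrow \<open>X -> u^* Z\<close>\<close>

context
  fixes A' A E u k w \<Psi> X Z \<eta>
  assumes A': "small_cat small A'" and A: "small_cat small A" and E: "small_cat small E"
    and u: "is_functor A E u" and k: "is_functor A' A k" and \<Psi>: "is_nt A' E (comp_ftor A' u k) w \<Psi>"
    and Z: "Z \<in> ob (D0 D E)" and \<eta>: "\<eta> \<in> hom (D0 D A) X (fo (D1 D A E u) Z)"
begin

lemma k_eta_hom: "fa (D1 D A' A k) \<eta> \<in> hom (D0 D A') (fo (D1 D A' A k) X) (fo (D1 D A' E (comp_ftor A' u k)) Z)"
  using D1_hom[OF A' A k \<eta>] by (simp add: D1_comp_ob[OF A' A E k u Z])

lemma Psi_hom: "D2 D A' E (comp_ftor A' u k) w \<Psi> Z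
    \<in> hom (D0 D A') (fo (D1 D A' E (comp_ftor A' u k)) Z) (fo (D1 D A' E w) Z)"
  using D2_hom[OF A' E \<Psi> Z] .

lemma transport_hom: "transport A' A E u k w \<Psi> Z \<eta> \<in> hom (D0 D A') (fo (D1 D A' A k) X) (fo (D1 D A' E w) Z)"
  unfolding transport_def using D0_category[OF A'] k_eta_hom Psi_hom by (rule cmp_hom)

text \<open>Naturality of \<open>\<kappa>^*\<close> at \<open>\<eta>\<close> moves
  \<open>\<kappa>\<close> past the restriction of \<open>\<eta>\<close>; there it appears whiskered
  by \<open>u\<close> and is absorbed into \<open>\<Psi>\<close>.\<close>

lemma transport_pre_nt:
  assumes \<kappa>: "is_nt A' A k' k \<kappa>"
  shows "transport A' A E u k w \<Psi> Z \<eta> \<cdot>\<^bsub>D0 D A'\<^esub> D2 D A' A k' k \<kappa> X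
    = transport A' A E u k' w (vcomp A' E \<Psi> (post_whisker A' u \<kappa>)) Z \<eta>"
proof -
  note c = D0_category[OF A']
  have X: "X \<in> ob (D0 D A)" using hom_ob(1)[OF D0_category[OF A] \<eta>] .
  have k': "is_functor A' A k'" using ntD(1)[OF \<kappa>] .
  have l: "D2 D A' A k' k \<kappa> X \<in> hom (D0 D A') (fo (D1 D A' A k') X) (fo (D1 D A' A k) X)"
    using D2_hom[OF A' A \<kappa> X] .
  have p: "is_nt A' E (comp_ftor A' u k') (comp_ftor A' u k) (post_whisker A' u \<kappa>)"
    by (rule post_whisker_nt) (use A' E \<kappa> u small_catD in auto)
  have k'\<eta>: "fa (D1 D A' A k') \<eta> \<in> hom (D0 D A') (fo (D1 D A' A k') X) (fo (D1 D A' E (comp_ftor A' u k')) Z)"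
    using D1_hom[OF A' A k' \<eta>] by (simp add: D1_comp_ob[OF A' A E k' u Z])
  have "transport A' A E u k w \<Psi> Z \<eta> \<cdot>\<^bsub>D0 D A'\<^esub> D2 D A' A k' k \<kappa> X
    = D2 D A' E (comp_ftor A' u k) w \<Psi> Z \<cdot>\<^bsub>D0 D A'\<^esub> (fa (D1 D A' A k) \<eta> \<cdot>\<^bsub>D0 D A'\<^esub> D2 D A' A k' k \<kappa> X)"
    unfolding transport_def using cmp_assoc[OF c l k_eta_hom Psi_hom] by simp
  also have "fa (D1 D A' A k) \<eta> \<cdot>\<^bsub>D0 D A'\<^esub> D2 D A' A k' k \<kappa> X
    = D2 D A' E (comp_ftor A' u k') (comp_ftor A' u k) (post_whisker A' u \<kappa>) Z \<cdot>\<^bsub>D0 D A'\<^esub> fa (D1 D A' A k') \<eta>"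
    using D2_natural[OF A' A \<kappa> \<eta>] D2_post_whisker[OF A' A E \<kappa> u Z] by simp
  also have "D2 D A' E (comp_ftor A' u k) w \<Psi> Z \<cdot>\<^bsub>D0 D A'\<^esub> \<dots>
      = transport A' A E u k' w (vcomp A' E \<Psi> (post_whisker A' u \<kappa>)) Z \<eta>"
    unfolding transport_def D2_vcomp[OF A' E p \<Psi> Z]
    using cmp_assoc[OF c k'\<eta> D2_hom[OF A' E p Z] Psi_hom] .
  finally show ?thesis .
qed

lemma transport_post_nt:
  assumes \<mu>: "is_nt A' E w w' \<mu>"
  shows "D2 D A' E w w' \<mu> Z \<cdot>\<^bsub>D0 D A'\<^esub> transport A' A E u k w \<Psi> Z \<eta>
    = transport A' A E u k w' (vcomp A' E \<mu> \<Psi>) Z \<eta>"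
  unfolding transport_def D2_vcomp[OF A' E \<Psi> \<mu> Z]
  using cmp_assoc[OF D0_category[OF A'] k_eta_hom Psi_hom D2_hom[OF A' E \<mu> Z]] .

text \<open>Restriction is strictly functorial, so restricting along \<open>i\<close> only whiskers
  the 2-cell and no correcting isomorphism appears.\<close>

lemma transport_restrict:
  assumes A'': "small_cat small A''" and i: "is_functor A'' A' i"
  shows "fa (D1 D A'' A' i) (transport A' A E u k w \<Psi> Z \<eta>)
    = transport A'' A E u (comp_ftor A'' k i) (comp_ftor A'' w i) (pre_whisker A'' \<Psi> i) Z \<eta>"
proof -
  have 1: "comp_ftor A'' u (comp_ftor A'' k i) = comp_ftor A'' (comp_ftor A' u k) i"
    using A'' i by (intro comp_ftor_assoc) (auto dest: small_catD)
  show ?thesis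
    unfolding transport_def functor_cmp[OF D1_functor[OF A'' A' i] k_eta_hom Psi_hom] 1
      D2_pre_whisker[OF A'' A' E i \<Psi> Z] D1_comp_hom[OF A'' A' A i k \<eta>] ..
qed

text \<open>Naturality of \<open>\<Psi>^*\<close> in the object. It is used with a mediating map
  \<open>m\<close>, to compare the transports of two universal arrows out of the same
  \<open>X\<close>.\<close>

lemma transport_target:
  assumes m: "m \<in> hom (D0 D E) Z Z'"
  shows "fa (D1 D A' E w) m \<cdot>\<^bsub>D0 D A'\<^esub> transport A' A E u k w \<Psi> Z \<eta>
    = transport A' A E u k w \<Psi> Z' (fa (D1 D A E u) m \<cdot>\<^bsub>D0 D A\<^esub> \<eta>)"
proof -
  note c = D0_category[OF A']
  have w: "is_functor A' E w" and uk: "is_functor A' E (comp_ftor A' u k)" using ntD[OF \<Psi>] by auto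
  have Z': "Z' \<in> ob (D0 D E)" using hom_ob(2)[OF D0_category[OF E] m] .
  note um = D1_hom[OF A E u m]
  have "fa (D1 D A' E w) m \<cdot>\<^bsub>D0 D A'\<^esub> transport A' A E u k w \<Psi> Z \<eta>
    = (D2 D A' E (comp_ftor A' u k) w \<Psi> Z' \<cdot>\<^bsub>D0 D A'\<^esub> fa (D1 D A' E (comp_ftor A' u k)) m)
       \<cdot>\<^bsub>D0 D A'\<^esub> fa (D1 D A' A k) \<eta>"
    unfolding transport_def D2_natural[OF A' E \<Psi> m]
    using cmp_assoc[OF c k_eta_hom Psi_hom D1_hom[OF A' E w m]] .
  also have "\<dots> = D2 D A' E (comp_ftor A' u k) w \<Psi> Z' \<cdot>\<^bsub>D0 D A'\<^esub>
      (fa (D1 D A' E (comp_ftor A' u k)) m \<cdot>\<^bsub>D0 D A'\<^esub> fa (D1 D A' A k) \<eta>)"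
    using cmp_assoc[OF c k_eta_hom D1_hom[OF A' E uk m] D2_hom[OF A' E \<Psi> Z']] by simp
  also have "fa (D1 D A' E (comp_ftor A' u k)) m \<cdot>\<^bsub>D0 D A'\<^esub> fa (D1 D A' A k) \<eta>
      = fa (D1 D A' A k) (fa (D1 D A E u) m \<cdot>\<^bsub>D0 D A\<^esub> \<eta>)"
    using functor_cmp[OF D1_functor[OF A' A k] \<eta> um] D1_comp_hom[OF A' A E k u m] by simp
  finally show ?thesis unfolding transport_def .
qed

end

text \<open>Adjacent squares may be pasted first: both sides are the pasted 2-cell applied after the
  restriction of \<open>\<eta>\<close> along \<open>k\<close> and \<open>g\<close>. This lets a test
  at a point of \<open>E'\<close> be read as a test at its image in \<open>E\<close>.\<close>

lemma transport_transport:
  assumes "small_cat small A''" "small_cat small A'" "small_cat small A" "small_cat small E" "small_cat small E'"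
    and "is_functor A E u" "is_functor A' A k" "is_functor A' E' u'" "is_functor E' E w" "is_functor A'' A' g"
    and "is_nt A' E (comp_ftor A' u k) (comp_ftor A' w u') \<Psi>"
    and "is_nt A'' E' (comp_ftor A'' u' g) v \<phi>"
    and "Z \<in> ob (D0 D E)" "\<eta> \<in> hom (D0 D A) X (fo (D1 D A E u) Z)"
  shows "transport A'' A' E' u' g v \<phi> (fo (D1 D E' E w) Z) (transport A' A E u k (comp_ftor A' w u') \<Psi> Z \<eta>)
    = transport A'' A E u (comp_ftor A'' k g) (comp_ftor A'' w v)
        (vcomp A'' E (post_whisker A'' w \<phi>) (pre_whisker A'' \<Psi> g)) Z \<eta>"
proof -
  have c: "category A''" "category A'" "category A" "category E" using assms by (auto dest: small_catD)
  have 1: "comp_ftor A'' u (comp_ftor A'' k g) = comp_ftor A'' (comp_ftor A' u k) g"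
    "comp_ftor A'' w (comp_ftor A'' u' g) = comp_ftor A'' (comp_ftor A' w u') g"
    using assms c by (auto intro: comp_ftor_assoc)
  have p: "is_nt A'' E (comp_ftor A'' u (comp_ftor A'' k g)) (comp_ftor A'' w (comp_ftor A'' u' g)) (pre_whisker A'' \<Psi> g)"
    unfolding 1 by (rule pre_whisker_nt) (use assms c in auto)
  have q: "is_nt A'' E (comp_ftor A'' w (comp_ftor A'' u' g)) (comp_ftor A'' w v) (post_whisker A'' w \<phi>)"
    by (rule post_whisker_nt) (use assms c in auto)
  have kg: "is_functor A'' A (comp_ftor A'' k g)" using assms c by (auto intro: comp_ftor_functor)
  show ?thesis
    unfolding transport_post_nt[OF assms(1,3,4,6) kg p assms(13,14) q, symmetric]
    unfolding transport_def[of A'' A' E'] transport_restrict[OF assms(2-4,6,7,11,13,14,1,10)]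
      D2_post_whisker[OF assms(1,5,4,12,9,13), symmetric] 1 ..
qed

text \<open>\<open>lan\<close>, \<open>lan_unit\<close> and \<open>lan_counit\<close> are the
  components of one and the same chosen triple, so (Der3) makes them a matching adjunction.\<close>

lemma lan_adjunction:
  assumes "small_cat small A" "small_cat small B" "is_functor A B u"
  shows "adjunction (D0 D A) (D0 D B) (lan D A B u) (D1 D A B u) (lan_unit D A B u) (lan_counit D A B u)"
proof -
  have "\<exists>t. is_lan D A B u t" using derivator assms by (auto simp: derivator_def der3_def)
  then have "is_lan D A B u (SOME t. is_lan D A B u t)" by (rule someI_ex)
  moreover define t where "t = (SOME t. is_lan D A B u t)"
  ultimately show ?thesis
    unfolding lan_def lan_unit_def lan_counit_def t_def[symmetric] by (simp add: is_lan_def case_prod_beta)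
qed

context
  fixes A B u
  assumes A: "small_cat small A" and B: "small_cat small B" and u: "is_functor A B u"
begin

lemma lan_functor: "is_functor (D0 D A) (D0 D B) (lan D A B u)"
  using lan_adjunction[OF A B u] by (simp add: adjunction_def)

lemma lan_ob: "X \<in> ob (D0 D A) \<Longrightarrow> fo (lan D A B u) X \<in> ob (D0 D B)"
  using functor_ob[OF lan_functor] .

lemma lan_universal:
  "X \<in> ob (D0 D A) \<Longrightarrow>
    universal (D0 D A) (D0 D B) (D1 D A B u) X (fo (lan D A B u) X) (lan_unit D A B u X)"
  using adjunction_universal(1)[OF lan_adjunction[OF A B u]] D0_category A B by blast

lemma lan_unit_hom:
  "X \<in> ob (D0 D A) \<Longrightarrow> lan_unit D A B u X \<in> hom (D0 D A) X (fo (D1 D A B u) (fo (lan D A B u) X))"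
  using universalD(2)[OF lan_universal] .

lemma lan_unit_natural:
  assumes "f \<in> hom (D0 D A) X Y"
  shows "lan_unit D A B u Y \<cdot>\<^bsub>D0 D A\<^esub> f = fa (D1 D A B u) (fa (lan D A B u) f) \<cdot>\<^bsub>D0 D A\<^esub> lan_unit D A B u X"
proof -
  have "is_nt (D0 D A) (D0 D A) (id_ftor (D0 D A)) (comp_ftor (D0 D A) (D1 D A B u) (lan D A B u)) (lan_unit D A B u)"
    using lan_adjunction[OF A B u] by (simp add: adjunction_def)
  from ntD(4)[OF this assms] show ?thesis using homD(1)[OF assms] by simp
qed

lemma lan_adj:
  assumes "X \<in> ob (D0 D A)" "Y \<in> ob (D0 D B)" "g \<in> hom (D0 D A) X (fo (D1 D A B u) Y)"
  shows "lan_adj D A B u Y g \<in> hom (D0 D B) (fo (lan D A B u) X) Y"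
    and "fa (D1 D A B u) (lan_adj D A B u Y g) \<cdot>\<^bsub>D0 D A\<^esub> lan_unit D A B u X = g"
  using adjunction_universal(2,3)[OF lan_adjunction[OF A B u] D0_category[OF A] D0_category[OF B] assms(1) assms(2,3)]
  by (auto simp: lan_adj_def)

end

section \<open>Pointwise criteria for universality\<close>

abbreviation lan_arrow :: "'a scat \<Rightarrow> 'a scat \<Rightarrow> 'a sftor \<Rightarrow> 'o \<Rightarrow> 'o \<Rightarrow> 'm \<Rightarrow> bool" where
  "lan_arrow A E u \<equiv> universal (D0 D A) (D0 D E) (D1 D A E u)"

text \<open>
  \<open>\<phi> : u g \<Rightarrow> e \<pi>\<close> computes left Kan extensions along \<open>u\<close> at \<open>e\<close>: it induces isomorphisms
  \<open>colim\<^bsub>Q\<^esub> g\<^sup>* X \<rightarrow> (u\<^sub>! X)\<^sub>e\<close>.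
\<close>

definition exact_at :: "'a scat \<Rightarrow> 'a scat \<Rightarrow> 'a sftor \<Rightarrow> 'a uni \<Rightarrow> 'a scat \<Rightarrow> 'a sftor \<Rightarrow> 'a snt \<Rightarrow> bool"
  where "exact_at A E u e Q g \<phi> \<longleftrightarrow>
    small_cat small Q \<and> is_functor Q A g \<and>
    is_nt Q E (comp_ftor Q u g) (comp_ftor Q (point E e) (to_one Q)) \<phi> \<and>
    (\<forall>X Z \<eta>. lan_arrow A E u X Z \<eta> \<longrightarrow>
       lan_arrow Q one (to_one Q)
         (fo (D1 D Q A g) X) (fo (D1 D one E (point E e)) Z)
         (transport Q A E u g (comp_ftor Q (point E e) (to_one Q)) \<phi> Z \<eta>))"

lemma one_small: "small_cat small one"
  using one_small_cat[OF smallness] .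

text \<open>(Der4) asserts that a map built from the chosen \<open>lan\<close> is invertible. That
  map is the transpose of the transported unit, so its invertibility makes the transported unit
  universal. An arbitrary \<open>(Z, \<eta>)\<close> differs from the chosen one by an isomorphism,
  whose value at \<open>e\<close> is again an isomorphism.\<close>

lemma exact_at_comma:
  fixes A E u e
  defines "K \<equiv> comma_over A E u e"
  assumes A: "small_cat small A" and E: "small_cat small E" and u: "is_functor A E u" and e: "e \<in> ob E"
  shows "exact_at A E u e K (comma_proj K) (comma_nt K)"
  unfolding exact_at_def
proof (intro conjI allI impI)
  have c: "category A" "category E" using A E by (auto dest: small_catD)
  show K: "small_cat small K" unfolding K_def using smallness A E u by (rule comma_over_small_cat)
  show p: "is_functor K A (comma_proj K)" unfolding K_def using c u by (rule comma_proj_functor)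
  let ?w = "comp_ftor K (point E e) (to_one K)"
  show nt: "is_nt K E (comp_ftor K u (comma_proj K)) ?w (comma_nt K)"
    unfolding K_def using c u e by (rule comma_nt_nt)
  have \<pi>: "is_functor K one (to_one K)" using K by (auto intro: to_one_functor dest: small_catD)
  have pt: "is_functor one E (point E e)" using c e by (simp add: point_functor)
  note \<pi>' = D1_functor[OF K one_small \<pi>] and cat = D0_category[OF K] D0_category[OF one_small] D0_category[OF E] D0_category[OF A]
  fix X Z \<eta> assume univ: "lan_arrow A E u X Z \<eta>"
  note Z = universalD[OF univ]
  have X: "X \<in> ob (D0 D A)" using universal_ob[OF D0_category[OF A] univ] .
  let ?Z0 = "fo (lan D A E u) X" and ?\<eta>0 = "lan_unit D A E u X"
  note u0 = lan_universal[OF A E u X]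
  note Z0 = universalD[OF u0]
  let ?t0 = "transport K A E u (comma_proj K) ?w (comma_nt K) ?Z0 ?\<eta>0"
  let ?Y = "fo (D1 D one E (point E e)) ?Z0" and ?X' = "fo (D1 D K A (comma_proj K)) X"
  have t0: "?t0 \<in> hom (D0 D K) ?X' (fo (D1 D K one (to_one K)) ?Y)"
    using transport_hom[OF K A E u p nt Z0] D1_comp_ob[OF K one_small E \<pi> pt Z0(1)] by simp
  have X': "?X' \<in> ob (D0 D K)" using D1_ob[OF K A p X] .
  have Y: "?Y \<in> ob (D0 D one)" using D1_ob[OF one_small E pt Z0(1)] .
  have "is_iso (D0 D one) (der4_colim D A E u e X)"
    using derivator A E u e X by (auto simp: derivator_def der4_def)
  then have i: "is_iso (D0 D one) (lan_adj D K one (to_one K) ?Y ?t0)"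
    by (simp add: der4_colim_def Let_def K_def transport_def)
  have 0: "lan_arrow K one (to_one K) ?X' ?Y ?t0"
    using universal_iso[OF lan_universal[OF K one_small \<pi> X'] cat(1,2) \<pi>' lan_adj(1)[OF K one_small \<pi> X' Y t0] i]
      lan_adj(2)[OF K one_small \<pi> X' Y t0] by simp
  obtain m where m: "m \<in> hom (D0 D E) ?Z0 Z" "fa (D1 D A E u) m \<cdot>\<^bsub>D0 D A\<^esub> ?\<eta>0 = \<eta>"
    using universalE[OF u0 Z] .
  have "is_iso (D0 D E) m"
    using universal_unique_iso[OF u0 univ cat(4,3) D1_functor[OF A E u] m] .
  then have mi: "is_iso (D0 D one) (fa (D1 D one E (point E e)) m)"
    by (rule functor_is_iso[OF D1_functor[OF one_small E pt] cat(3)])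
  show "lan_arrow K one (to_one K) ?X' (fo (D1 D one E (point E e)) Z)
     (transport K A E u (comma_proj K) ?w (comma_nt K) Z \<eta>)"
    using universal_iso[OF 0 cat(1,2) \<pi>' D1_hom[OF one_small E pt m(1)] mi]
      transport_target[OF K A E u p nt Z0 m(1)] m(2) D1_comp_hom[OF K one_small E \<pi> pt m(1)]
    by simp
qed

text \<open>Let \<open>m\<close> be the map from the chosen extension to \<open>Z\<close> that
  mediates \<open>\<eta>\<close>. At \<open>e\<close> the chosen unit and \<open>\<eta>\<close> both
  yield universal arrows out of the same object, and the value of \<open>m\<close> is the map
  between them, hence invertible. By (Der2) \<open>m\<close> itself is invertible, so
  \<open>\<eta>\<close> is universal along with the unit.\<close>

lemma universal_pointwise:
  assumes A: "small_cat small A" and E: "small_cat small E" and u: "is_functor A E u"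
    and Z: "Z \<in> ob (D0 D E)" and \<eta>: "\<eta> \<in> hom (D0 D A) X (fo (D1 D A E u) Z)"
    and pw: "\<And>e. e \<in> ob E \<Longrightarrow> \<exists>Q g \<phi>. exact_at A E u e Q g \<phi> \<and>
       lan_arrow Q one (to_one Q)
         (fo (D1 D Q A g) X) (fo (D1 D one E (point E e)) Z)
         (transport Q A E u g (comp_ftor Q (point E e) (to_one Q)) \<phi> Z \<eta>)"
  shows "lan_arrow A E u X Z \<eta>"
proof -
  have c: "category A" "category E" using A E by (auto dest: small_catD)
  have X: "X \<in> ob (D0 D A)" using hom_ob(1)[OF D0_category[OF A] \<eta>] .
  let ?Z0 = "fo (lan D A E u) X" and ?\<eta>0 = "lan_unit D A E u X"
  note u0 = lan_universal[OF A E u X]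
  note Z0 = universalD[OF u0]
  obtain m where m: "m \<in> hom (D0 D E) ?Z0 Z" "fa (D1 D A E u) m \<cdot>\<^bsub>D0 D A\<^esub> ?\<eta>0 = \<eta>"
    using universalE[OF u0 Z \<eta>] .
  have "is_iso (D0 D one) (fa (D1 D one E (point E e)) m)" if e: "e \<in> ob E" for e
  proof -
    obtain Q g \<phi> where ex: "exact_at A E u e Q g \<phi>" and
       univ: "lan_arrow Q one (to_one Q)
         (fo (D1 D Q A g) X) (fo (D1 D one E (point E e)) Z)
         (transport Q A E u g (comp_ftor Q (point E e) (to_one Q)) \<phi> Z \<eta>)"
      using pw[OF e] by blast
    have Q: "small_cat small Q" and g: "is_functor Q A g"
      and \<phi>: "is_nt Q E (comp_ftor Q u g) (comp_ftor Q (point E e) (to_one Q)) \<phi>"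
      using ex by (auto simp: exact_at_def)
    have univ0: "lan_arrow Q one (to_one Q)
         (fo (D1 D Q A g) X) (fo (D1 D one E (point E e)) ?Z0)
         (transport Q A E u g (comp_ftor Q (point E e) (to_one Q)) \<phi> ?Z0 ?\<eta>0)"
      using ex u0 by (auto simp: exact_at_def)
    have \<pi>: "is_functor Q one (to_one Q)" using Q by (auto intro: to_one_functor dest: small_catD)
    have pt: "is_functor one E (point E e)" using c e by (simp add: point_functor)
    show ?thesis
      using universal_unique_iso[OF univ0 univ D0_category[OF Q] D0_category[OF one_small]
          D1_functor[OF Q one_small \<pi>] D1_hom[OF one_small E pt m(1)]]
        transport_target[OF Q A E u g \<phi> Z0 m(1)] m(2) D1_comp_hom[OF Q one_small E \<pi> pt m(1)]
      by simp
  qed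
  moreover have "der2 small D" using derivator by (simp add: derivator_def)
  ultimately have "is_iso (D0 D E) m" using E homD(1)[OF m(1)] by (simp add: der2_def)
  from universal_iso[OF u0 D0_category[OF A] D0_category[OF E] D1_functor[OF A E u] m(1) this] m(2)
  show ?thesis by simp
qed

text \<open>
  If \<open>Q \<rightarrow> (u/e)\<close> has a left adjoint left inverse \<open>l\<close>, it is final, so \<open>Q\<close> may replace \<open>(u/e)\<close> in (Der4).
\<close>

lemma universal_final:
  assumes K: "small_cat small K" and Q: "small_cat small Q"
    and s: "is_functor Q K s" and l: "is_functor K Q l" and ls: "comp_ftor Q l s = id_ftor Q"
    and \<epsilon>: "is_nt K K (id_ftor K) (comp_ftor K s l) \<epsilon>"
    and \<epsilon>s: "\<And>q. q \<in> ob Q \<Longrightarrow> \<epsilon> (fo s q) = idt K (fo s q)"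
    and univ: "lan_arrow K one (to_one K) Y V \<theta>"
  shows "lan_arrow Q one (to_one Q) (fo (D1 D Q K s) Y) V (fa (D1 D Q K s) \<theta>)"
proof -
  have cK: "category K" and cQ: "category Q" using K Q by (auto dest: small_catD)
  note dK = D0_category[OF K] and dQ = D0_category[OF Q] and d1 = D0_category[OF one_small]
  have \<pi>K: "is_functor K one (to_one K)" and \<pi>Q: "is_functor Q one (to_one Q)"
    using cK cQ by (auto intro: to_one_functor)
  have \<pi>s: "comp_ftor Q (to_one K) s = to_one Q" and \<pi>l: "comp_ftor K (to_one Q) l = to_one K"
    using comp_ftor_functor[OF cQ one_category s \<pi>K] comp_ftor_functor[OF cK one_category l \<pi>Q]
      functor_one_unique cK cQ by auto
  have V: "V \<in> ob (D0 D one)" and \<theta>: "\<theta> \<in> hom (D0 D K) Y (fo (D1 D K one (to_one K)) V)"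
    using universalD[OF univ] by auto
  have Y: "Y \<in> ob (D0 D K)" using hom_ob(1)[OF dK \<theta>] .
  have sl: "is_functor K K (comp_ftor K s l)" using cK l s by (auto intro: comp_ftor_functor)
  let ?e = "D2 D K K (id_ftor K) (comp_ftor K s l) \<epsilon>"
  have sK: "fo (D1 D Q one (to_one Q)) W = fo (D1 D Q K s) (fo (D1 D K one (to_one K)) W)"
    and lK: "fo (D1 D K one (to_one K)) W = fo (D1 D K Q l) (fo (D1 D Q one (to_one Q)) W)"
    if "W \<in> ob (D0 D one)" for W
    using D1_comp_ob[OF Q K one_small s \<pi>K that] D1_comp_ob[OF K Q one_small l \<pi>Q that] \<pi>s \<pi>l by auto
  have s\<pi>: "fa (D1 D Q one (to_one Q)) m = fa (D1 D Q K s) (fa (D1 D K one (to_one K)) m)"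
    if "m \<in> hom (D0 D one) W W'" for m W W'
    using D1_comp_hom[OF Q K one_small s \<pi>K that] \<pi>s by simp
  have slY: "fo (D1 D K K (comp_ftor K s l)) Y = fo (D1 D K Q l) (fo (D1 D Q K s) Y)"
    if "Y \<in> ob (D0 D K)" for Y using D1_comp_ob[OF K Q K l s that] .
  have eY: "?e Y \<in> hom (D0 D K) Y (fo (D1 D K Q l) (fo (D1 D Q K s) Y))" if "Y \<in> ob (D0 D K)" for Y
    using D2_hom[OF K K \<epsilon> that] that slY[OF that] by (simp add: D1_id[OF K])
  \<comment> \<open>As \<open>\<epsilon>\<close> is an identity on the image of \<open>s\<close>,
    its whiskering with \<open>s\<close> is an identity 2-cell, which \<open>D2\<close>
    preserves.\<close>
  have se: "fa (D1 D Q K s) (?e Y) = idt (D0 D Q) (fo (D1 D Q K s) Y)" if Y: "Y \<in> ob (D0 D K)" for Y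
  proof -
    have 1: "comp_ftor Q (comp_ftor K s l) s = s"
    proof -
      have "comp_ftor Q (comp_ftor K s l) s = comp_ftor Q s (comp_ftor Q l s)"
        using cQ s by (simp add: comp_ftor_assoc)
      also have "\<dots> = s" unfolding ls
        by (rule functor_eqI[OF comp_ftor_functor[OF cQ cK id_ftor_functor[OF cQ] s] s]) auto
      finally show ?thesis .
    qed
    have 2: "pre_whisker Q \<epsilon> s = id_nt Q K s"
      by (auto simp: pre_whisker_def id_nt_def \<epsilon>s)
    show ?thesis
      using D2_pre_whisker[OF Q K K s \<epsilon> Y] D2_id[OF Q K s Y]
      unfolding 1 2 comp_id_ftor[OF s] by simp
  qed
  \<comment> \<open>Followed by the functor to \<open>one\<close>, every 2-cell becomes an identity,
    so \<open>\<epsilon>\<close> acts trivially on objects pulled back from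
    \<open>one\<close>.\<close>
  have \<pi>e: "?e (fo (D1 D K one (to_one K)) W) = idt (D0 D K) (fo (D1 D K one (to_one K)) W)"
    if W: "W \<in> ob (D0 D one)" for W
  proof -
    have 1: "comp_ftor K (to_one K) (id_ftor K) = to_one K" "comp_ftor K (to_one K) (comp_ftor K s l) = to_one K"
      using comp_ftor_functor[OF cK one_category id_ftor_functor[OF cK] \<pi>K]
        comp_ftor_functor[OF cK one_category sl \<pi>K] functor_one_unique cK by auto
    have n: "is_nt K one (to_one K) (to_one K) (post_whisker K (to_one K) \<epsilon>)"
      using post_whisker_nt[OF cK one_category \<pi>K \<epsilon>] 1 by simp
    have 2: "post_whisker K (to_one K) \<epsilon> = id_nt K one (to_one K)"
      by (rule nt_eqI[of _ K]) (use ntD(3,5)[OF n] in \<open>auto simp: id_nt_def\<close>)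
    show ?thesis
      using D2_post_whisker[OF K K one_small \<epsilon> \<pi>K W] D2_id[OF K one_small \<pi>K W]
      unfolding 1 2 by simp
  qed
  show ?thesis
    unfolding universal_def
  proof (intro conjI ballI)
    show "V \<in> ob (D0 D one)" by fact
    show s\<theta>: "fa (D1 D Q K s) \<theta> \<in> hom (D0 D Q) (fo (D1 D Q K s) Y) (fo (D1 D Q one (to_one Q)) V)"
      using D1_hom[OF Q K s \<theta>] sK[OF V] by simp
    fix W h assume W: "W \<in> ob (D0 D one)" and h: "h \<in> hom (D0 D Q) (fo (D1 D Q K s) Y) (fo (D1 D Q one (to_one Q)) W)"
    have lh: "fa (D1 D K Q l) h \<in> hom (D0 D K) (fo (D1 D K Q l) (fo (D1 D Q K s) Y)) (fo (D1 D K one (to_one K)) W)"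
      using D1_hom[OF K Q l h] lK[OF W] by simp
    \<comment> \<open>The 2-functor turns the adjunction \<open>l \<stileturn> s\<close> with unit
      \<open>\<epsilon>\<close> into \<open>s^* \<stileturn> l^*\<close>, and \<open>?h\<close> is
      the transpose of \<open>h\<close>; \<open>l^*\<close> takes the constant diagram on
      \<open>W\<close> over \<open>Q\<close> to the one over \<open>K\<close>.\<close>
    let ?h = "fa (D1 D K Q l) h \<cdot>\<^bsub>D0 D K\<^esub> ?e Y"
    have h': "?h \<in> hom (D0 D K) Y (fo (D1 D K one (to_one K)) W)"
      using dK eY[OF Y] lh by (rule cmp_hom)
    \<comment> \<open>Transposition sends the composite tested over \<open>Q\<close> to the one
      tested over \<open>K\<close>, so uniqueness over \<open>K\<close> gives uniqueness over
      \<open>Q\<close>.\<close>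
    have tr: "fa (D1 D K Q l) (fa (D1 D Q one (to_one Q)) m \<cdot>\<^bsub>D0 D Q\<^esub> fa (D1 D Q K s) \<theta>) \<cdot>\<^bsub>D0 D K\<^esub> ?e Y
        = fa (D1 D K one (to_one K)) m \<cdot>\<^bsub>D0 D K\<^esub> \<theta>" if m: "m \<in> hom (D0 D one) V W" for m
    proof -
      have p: "fa (D1 D K one (to_one K)) m \<cdot>\<^bsub>D0 D K\<^esub> \<theta> \<in> hom (D0 D K) Y (fo (D1 D K one (to_one K)) W)"
        using dK \<theta> D1_hom[OF K one_small \<pi>K m] by (rule cmp_hom)
      have "fa (D1 D Q one (to_one Q)) m \<cdot>\<^bsub>D0 D Q\<^esub> fa (D1 D Q K s) \<theta>
          = fa (D1 D Q K s) (fa (D1 D K one (to_one K)) m \<cdot>\<^bsub>D0 D K\<^esub> \<theta>)"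
        using functor_cmp[OF D1_functor[OF Q K s] \<theta> D1_hom[OF K one_small \<pi>K m]] s\<pi>[OF m] by simp
      then have "fa (D1 D K Q l) (fa (D1 D Q one (to_one Q)) m \<cdot>\<^bsub>D0 D Q\<^esub> fa (D1 D Q K s) \<theta>) \<cdot>\<^bsub>D0 D K\<^esub> ?e Y
        = fa (D1 D K K (comp_ftor K s l)) (fa (D1 D K one (to_one K)) m \<cdot>\<^bsub>D0 D K\<^esub> \<theta>) \<cdot>\<^bsub>D0 D K\<^esub> ?e Y"
        using D1_comp_hom[OF K Q K l s p] by simp
      also have "\<dots> = ?e (fo (D1 D K one (to_one K)) W) \<cdot>\<^bsub>D0 D K\<^esub> (fa (D1 D K one (to_one K)) m \<cdot>\<^bsub>D0 D K\<^esub> \<theta>)"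
        using D2_natural[OF K K \<epsilon> p] homD(1)[OF p] by (simp add: D1_id[OF K])
      finally show ?thesis using \<pi>e[OF W] idt_left[OF dK p] by simp
    qed
    obtain m where m: "m \<in> hom (D0 D one) V W" "fa (D1 D K one (to_one K)) m \<cdot>\<^bsub>D0 D K\<^esub> \<theta> = ?h"
      using universalE[OF univ W h'] .
    show "\<exists>!m. m \<in> hom (D0 D one) V W \<and> fa (D1 D Q one (to_one Q)) m \<cdot>\<^bsub>D0 D Q\<^esub> fa (D1 D Q K s) \<theta> = h"
    proof (rule ex1I[of _ m])
      have "fa (D1 D Q one (to_one Q)) m \<cdot>\<^bsub>D0 D Q\<^esub> fa (D1 D Q K s) \<theta>
          = fa (D1 D Q K s) (fa (D1 D K one (to_one K)) m \<cdot>\<^bsub>D0 D K\<^esub> \<theta>)"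
        using functor_cmp[OF D1_functor[OF Q K s] \<theta> D1_hom[OF K one_small \<pi>K m(1)]] s\<pi>[OF m(1)] by simp
      also have "\<dots> = fa (D1 D Q K s) (fa (D1 D K Q l) h) \<cdot>\<^bsub>D0 D Q\<^esub> fa (D1 D Q K s) (?e Y)"
        unfolding m(2) by (rule functor_cmp[OF D1_functor[OF Q K s] eY[OF Y] lh])
      also have "\<dots> = h"
        using D1_comp_hom[OF Q K Q s l h] idt_right[OF dQ h] homD(1)[OF h]
        by (simp add: se[OF Y] ls D1_id[OF Q])
      finally show "m \<in> hom (D0 D one) V W \<and> fa (D1 D Q one (to_one Q)) m \<cdot>\<^bsub>D0 D Q\<^esub> fa (D1 D Q K s) \<theta> = h"
        using m(1) by simp
    next
      fix m' assume m': "m' \<in> hom (D0 D one) V W \<and> fa (D1 D Q one (to_one Q)) m' \<cdot>\<^bsub>D0 D Q\<^esub> fa (D1 D Q K s) \<theta> = h"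
      show "m' = m"
        by (rule universal_eqI[OF univ dK D1_functor[OF K one_small \<pi>K] d1])
          (use m m' tr[of m'] in auto)
    qed
  qed
qed

text \<open>Combines the comma square of (Der4) with the finality just shown; restricting that
  square along \<open>s\<close> only whiskers its 2-cell.\<close>

lemma exact_at_final:
  fixes A E u e
  defines "K \<equiv> comma_over A E u e"
  assumes A: "small_cat small A" and E: "small_cat small E" and u: "is_functor A E u" and e: "e \<in> ob E"
    and Q: "small_cat small Q" and s: "is_functor Q K s" and l: "is_functor K Q l"
    and ls: "comp_ftor Q l s = id_ftor Q"
    and \<epsilon>: "is_nt K K (id_ftor K) (comp_ftor K s l) \<epsilon>"
    and \<epsilon>s: "\<And>q. q \<in> ob Q \<Longrightarrow> \<epsilon> (fo s q) = idt K (fo s q)"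
  shows "exact_at A E u e Q (comp_ftor Q (comma_proj K) s) (pre_whisker Q (comma_nt K) s)"
  unfolding exact_at_def
proof (intro conjI allI impI)
  have ex: "exact_at A E u e K (comma_proj K) (comma_nt K)"
    unfolding K_def using A E u e by (rule exact_at_comma)
  have K: "small_cat small K" and p: "is_functor K A (comma_proj K)"
    and nt: "is_nt K E (comp_ftor K u (comma_proj K)) (comp_ftor K (point E e) (to_one K)) (comma_nt K)"
    using ex by (auto simp: exact_at_def)
  have c: "category Q" "category K" "category A" "category E" using Q K A E by (auto dest: small_catD)
  have \<pi>: "is_functor K one (to_one K)" using c by (simp add: to_one_functor)
  have "comp_ftor Q (to_one K) s = to_one Q"
    using comp_ftor_functor[OF c(1) one_category s \<pi>] functor_one_unique c by auto
  then have w: "comp_ftor Q (comp_ftor K (point E e) (to_one K)) s = comp_ftor Q (point E e) (to_one Q)"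
    using comp_ftor_assoc[OF c(1) s, of "point E e" "to_one K"] by simp
  show "small_cat small Q" by fact
  show g: "is_functor Q A (comp_ftor Q (comma_proj K) s)" using c s p by (auto intro: comp_ftor_functor)
  show "is_nt Q E (comp_ftor Q u (comp_ftor Q (comma_proj K) s)) (comp_ftor Q (point E e) (to_one Q))
     (pre_whisker Q (comma_nt K) s)"
    using pre_whisker_nt[OF c(1,2,4) s nt] unfolding w comp_ftor_assoc[OF c(1) s] .
  fix X Z \<eta> assume univ: "lan_arrow A E u X Z \<eta>"
  note Z = universalD[OF univ]
  have X: "X \<in> ob (D0 D A)" using universal_ob[OF D0_category[OF A] univ] .
  have "lan_arrow K one (to_one K)
         (fo (D1 D K A (comma_proj K)) X) (fo (D1 D one E (point E e)) Z)
         (transport K A E u (comma_proj K) (comp_ftor K (point E e) (to_one K)) (comma_nt K) Z \<eta>)"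
    using ex univ by (auto simp: exact_at_def)
  from universal_final[OF K Q s l ls \<epsilon> \<epsilon>s this]
  show "lan_arrow Q one (to_one Q)
        (fo (D1 D Q A (comp_ftor Q (comma_proj K) s)) X) (fo (D1 D one E (point E e)) Z)
        (transport Q A E u (comp_ftor Q (comma_proj K) s) (comp_ftor Q (point E e) (to_one Q))
          (pre_whisker Q (comma_nt K) s) Z \<eta>)"
    using transport_restrict[OF K A E u p nt Z Q s] D1_comp_ob[OF Q K A s p X] w by simp
qed

text \<open>Universal arrows along an identity are isomorphisms, and evaluation at \<open>e\<close>
  preserves these. So the point \<open>e\<close> alone computes the extension at \<open>e\<close>,
  in place of the slice category.\<close>

lemma exact_at_id:
  assumes E: "small_cat small E" and e: "e \<in> ob E"
  shows "exact_at E E (id_ftor E) e one (point E e) (id_nt one E (point E e))"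
  unfolding exact_at_def
proof (intro conjI allI impI)
  have c: "category E" "category one" using E one_category by (auto dest: small_catD)
  show "small_cat small one" by (rule one_small)
  show pt: "is_functor one E (point E e)" using c e by (simp add: point_functor)
  have 1: "to_one one = id_ftor one" using functor_one_unique[OF id_ftor_functor[OF c(2)] c(2)] by (rule sym)
  have 2: "comp_ftor one (point E e) (to_one one) = point E e" unfolding 1
    by (rule functor_eqI[OF comp_ftor_functor[OF c(2,1) id_ftor_functor[OF c(2)] pt] pt]) auto
  have 3: "comp_ftor one (id_ftor E) (point E e) = point E e" using pt by (rule comp_id_ftor)
  show "is_nt one E (comp_ftor one (id_ftor E) (point E e)) (comp_ftor one (point E e) (to_one one))
     (id_nt one E (point E e))"
    unfolding 2 3 using c(2,1) pt by (rule id_nt_nt)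
  fix X Z \<eta> assume "lan_arrow E E (id_ftor E) X Z \<eta>"
  then have \<eta>: "\<eta> \<in> hom (D0 D E) X Z" "is_iso (D0 D E) \<eta>"
    using D0_category[OF E] by (auto simp: D1_id[OF E] universal_id_iff)
  have Z: "Z \<in> ob (D0 D E)" using hom_ob[OF D0_category[OF E] \<eta>(1)] by simp
  have h: "fa (D1 D one E (point E e)) \<eta> \<in> hom (D0 D one) (fo (D1 D one E (point E e)) X) (fo (D1 D one E (point E e)) Z)"
    using D1_hom[OF one_small E pt \<eta>(1)] .
  show "lan_arrow one one (to_one one) (fo (D1 D one E (point E e)) X)
        (fo (D1 D one E (point E e)) Z)
        (transport one E E (id_ftor E) (point E e) (comp_ftor one (point E e) (to_one one))
          (id_nt one E (point E e)) Z \<eta>)"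
    using h functor_is_iso[OF D1_functor[OF one_small E pt] D0_category[OF E] \<eta>(2)]
      idt_left[OF D0_category[OF one_small] h]
    unfolding transport_def 2 3 D2_id[OF one_small E pt Z]
    unfolding 1 D1_id[OF one_small] universal_id_iff[OF D0_category[OF one_small]]
    by simp
qed

text \<open>A Beck-Chevalley criterion. Universality over \<open>E'\<close> is tested at each
  \<open>e\<close>; there the square pasted with \<open>\<Psi>\<close> is required to be exact at
  \<open>fo w e\<close> with the same \<open>Q\<close>. Applied to the given universal arrow over
  \<open>E\<close>, this exactness is the test wanted over \<open>E'\<close>, because transports
  compose by pasting.\<close>

lemma universal_transport:
  assumes A': "small_cat small A'" and A: "small_cat small A" and E': "small_cat small E'" and E: "small_cat small E"
    and u: "is_functor A E u" and k: "is_functor A' A k" and u': "is_functor A' E' u'" and w: "is_functor E' E w"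
    and \<Psi>: "is_nt A' E (comp_ftor A' u k) (comp_ftor A' w u') \<Psi>"
    and ex: "\<And>e. e \<in> ob E' \<Longrightarrow> \<exists>Q g \<phi>. exact_at A' E' u' e Q g \<phi> \<and>
      exact_at A E u (fo w e) Q (comp_ftor Q k g) (vcomp Q E (post_whisker Q w \<phi>) (pre_whisker Q \<Psi> g))"
    and univ: "lan_arrow A E u X Z \<eta>"
  shows "lan_arrow A' E' u' (fo (D1 D A' A k) X) (fo (D1 D E' E w) Z)
    (transport A' A E u k (comp_ftor A' w u') \<Psi> Z \<eta>)"
proof (rule universal_pointwise[OF A' E' u'])
  note Z = universalD[OF univ]
  have X: "X \<in> ob (D0 D A)" using universal_ob[OF D0_category[OF A] univ] .
  show "fo (D1 D E' E w) Z \<in> ob (D0 D E')" using D1_ob[OF E' E w Z(1)] .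
  show "transport A' A E u k (comp_ftor A' w u') \<Psi> Z \<eta>
     \<in> hom (D0 D A') (fo (D1 D A' A k) X) (fo (D1 D A' E' u') (fo (D1 D E' E w) Z))"
    using transport_hom[OF A' A E u k \<Psi> Z] D1_comp_ob[OF A' E' E u' w Z(1)] by simp
  fix e assume e: "e \<in> ob E'"
  obtain Q g \<phi> where ex': "exact_at A' E' u' e Q g \<phi>" and ex:
      "exact_at A E u (fo w e) Q (comp_ftor Q k g) (vcomp Q E (post_whisker Q w \<phi>) (pre_whisker Q \<Psi> g))"
    using ex[OF e] by blast
  have Q: "small_cat small Q" and g: "is_functor Q A' g"
      and \<phi>: "is_nt Q E' (comp_ftor Q u' g) (comp_ftor Q (point E' e) (to_one Q)) \<phi>"
    using ex' by (auto simp: exact_at_def)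
  have c: "category Q" "category E'" "category E" using Q E E' by (auto dest: small_catD)
  have pt: "is_functor one E' (point E' e)" using c e by (simp add: point_functor)
  have wpt: "comp_ftor one w (point E' e) = point E (fo w e)"
    by (rule functor_eqI[OF comp_ftor_functor[OF one_category c(3) pt w] point_functor[OF c(3) functor_ob[OF w e]]])
      (auto simp: functor_idt[OF w e])
  have wQ: "comp_ftor Q w (comp_ftor Q (point E' e) (to_one Q)) = comp_ftor Q (point E (fo w e)) (to_one Q)"
    using comp_ftor_assoc[OF c(1) to_one_functor[OF c(1)], of w "point E' e"] wpt by simp
  have "lan_arrow Q one (to_one Q)
         (fo (D1 D Q A (comp_ftor Q k g)) X) (fo (D1 D one E (point E (fo w e))) Z)
         (transport Q A E u (comp_ftor Q k g) (comp_ftor Q (point E (fo w e)) (to_one Q))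
            (vcomp Q E (post_whisker Q w \<phi>) (pre_whisker Q \<Psi> g)) Z \<eta>)"
    using ex univ by (auto simp: exact_at_def)
  then have "lan_arrow Q one (to_one Q)
       (fo (D1 D Q A' g) (fo (D1 D A' A k) X)) (fo (D1 D one E' (point E' e)) (fo (D1 D E' E w) Z))
       (transport Q A' E' u' g (comp_ftor Q (point E' e) (to_one Q)) \<phi> (fo (D1 D E' E w) Z)
         (transport A' A E u k (comp_ftor A' w u') \<Psi> Z \<eta>))"
    using transport_transport[OF Q A' A E E' u k u' w g \<Psi> \<phi> Z] D1_comp_ob[OF Q A' A g k X]
      D1_comp_ob[OF one_small E' E pt w Z(1)]
    by (simp add: wQ wpt)
  with ex' show "\<exists>Q g \<phi>. exact_at A' E' u' e Q g \<phi> \<and>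
     lan_arrow Q one (to_one Q)
       (fo (D1 D Q A' g) (fo (D1 D A' A k) X)) (fo (D1 D one E' (point E' e)) (fo (D1 D E' E w) Z))
       (transport Q A' E' u' g (comp_ftor Q (point E' e) (to_one Q)) \<phi> (fo (D1 D E' E w) Z)
         (transport A' A E u k (comp_ftor A' w u') \<Psi> Z \<eta>))"
    by blast
qed

end

section \<open>Kan extensions along monotone maps\<close>

definition vertex_map :: "(nat set \<Rightarrow> nat set) \<Rightarrow> 'a uni \<Rightarrow> 'a uni" where
  "vertex_map h x = Vertex (h (un_Vertex x))"

definition poset_ftor :: "nat set set \<Rightarrow> (nat set \<Rightarrow> nat set) \<Rightarrow> 'a sftor" where
  "poset_ftor P h = mk_ftor (poset_cat P) (vertex_map h)
     (\<lambda>e. Pair (vertex_map h (pfst e)) (vertex_map h (psnd e)))"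

text \<open>The counterpart of \<open>slice_at\<close>: here the parameter is fixed and the diagram
  variable runs.\<close>

definition level_at :: "'a scat \<Rightarrow> 'a scat \<Rightarrow> 'a uni \<Rightarrow> 'a sftor" where
  "level_at A B b = mk_ftor A (\<lambda>a. Pair a b) (\<lambda>f. Pair f (idt B b))"

lemma vertex_map_Vertex [simp]: "vertex_map h (Vertex S) = Vertex (h S)"
  by (simp add: vertex_map_def)

lemma Vertex_ob_poset [simp]: "Vertex S \<in> ob (poset_cat P) \<longleftrightarrow> S \<in> P"
  by (auto simp: in_ob_poset_iff)

lemma Pair_ar_poset [simp]:
  "Pair (Vertex S) (Vertex T) \<in> ar (poset_cat P) \<longleftrightarrow> S \<in> P \<and> T \<in> P \<and> S \<subseteq> T"
  by (auto simp: in_ar_poset_iff)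

lemma Pair_hom_poset [simp]:
  "Pair (Vertex S) (Vertex T) \<in> hom (poset_cat P) (Vertex S') (Vertex T')
    \<longleftrightarrow> S = S' \<and> T = T' \<and> S \<in> P \<and> T \<in> P \<and> S \<subseteq> T"
  by (auto simp: in_hom_poset_iff)

lemma poset_ftor_simps [simp]:
  "S \<in> P \<Longrightarrow> fo (poset_ftor P h) (Vertex S) = Vertex (h S)"
  "S \<in> P \<Longrightarrow> T \<in> P \<Longrightarrow> S \<subseteq> T \<Longrightarrow>
    fa (poset_ftor P h) (Pair (Vertex S) (Vertex T)) = Pair (Vertex (h S)) (Vertex (h T))"
  by (auto simp: poset_ftor_def)

lemma poset_ftor_functor:
  assumes "\<And>S. S \<in> P \<Longrightarrow> h S \<in> P'" "\<And>S T. S \<in> P \<Longrightarrow> T \<in> P \<Longrightarrow> S \<subseteq> T \<Longrightarrow> h S \<subseteq> h T"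
  shows "is_functor (poset_cat P) (poset_cat P') (poset_ftor P h)"
  unfolding poset_ftor_def
  by (rule mk_ftor_functor) (use assms in \<open>auto simp: poset_category in_ob_poset_iff in_hom_poset_iff\<close>)

lemma level_at_simps [simp]:
  "a \<in> ob A \<Longrightarrow> fo (level_at A B b) a = Pair a b"
  "f \<in> ar A \<Longrightarrow> fa (level_at A B b) f = Pair f (idt B b)"
  by (auto simp: level_at_def)

lemma level_at_functor:
  assumes "category A" "category B" "b \<in> ob B"
  shows "is_functor A (A \<times>\<^sub>c B) (level_at A B b)"
  unfolding level_at_def
  by (rule mk_ftor_functor)
    (use assms in \<open>auto simp: prod_category Pair_hom_prod idt_hom idt_left[OF _ idt_hom]\<close>)

abbreviation par_cat :: "nat set set \<Rightarrow> 'a scat \<Rightarrow> 'a scat" where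
  "par_cat S B \<equiv> poset_cat S \<times>\<^sub>c B"

abbreviation par_ftor :: "nat set set \<Rightarrow> 'a scat \<Rightarrow> (nat set \<Rightarrow> nat set) \<Rightarrow> 'a sftor" where
  "par_ftor S B f \<equiv> prod_ftor (poset_cat S) B (poset_ftor S f) (id_ftor B)"

abbreviation par_proj :: "nat set set \<Rightarrow> 'a scat \<Rightarrow> 'a sftor" where
  "par_proj S B \<equiv> proj2 (poset_cat S) B"

abbreviation par_slice :: "nat set set \<Rightarrow> 'a scat \<Rightarrow> nat set \<Rightarrow> 'a sftor" where
  "par_slice S B p \<equiv> slice_at (poset_cat S) B (Vertex p)"

context derivator_on
begin

text \<open>The common core of the computations at points. An object of \<open>(u/e)\<close> is a
  pair \<open>(p, b')\<close> with \<open>\<psi>\<close> from its image to \<open>e\<close>, and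
  \<open>\<rho>\<close> recovers the parameter. The reflection into \<open>Q\<close> moves both
  variables: \<open>p\<close> goes to \<open>g (l p)\<close> along the inclusion, and
  \<open>b'\<close> goes to \<open>\<rho> e\<close> along \<open>\<rho> \<psi>\<close>. Keeping
  \<open>E\<close> abstract covers a poset times \<open>B\<close>, with \<open>\<rho>\<close> the
  projection, as well as \<open>E = B\<close>, with \<open>\<rho>\<close> the identity.\<close>

lemma exact_at_poset:
  fixes S R :: "nat set set" and B E :: "'a scat"
  defines "A \<equiv> par_cat S B" and "Q \<equiv> poset_cat R"
  assumes S: "finite S" and R: "finite R" and B: "small_cat small B" and E: "small_cat small E"
    and u: "is_functor A E u" and \<rho>: "is_functor E B \<rho>" and e: "e \<in> ob E"
    and \<rho>u: "\<And>p b'. p \<in> S \<Longrightarrow> b' \<in> ob B \<Longrightarrow> fo \<rho> (fo u (Pair (Vertex p) b')) = b'"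
      "\<And>p q h. p \<in> S \<Longrightarrow> q \<in> S \<Longrightarrow> p \<subseteq> q \<Longrightarrow> h \<in> ar B \<Longrightarrow> fa \<rho> (fa u (Pair (Pair (Vertex p) (Vertex q)) h)) = h"
    and g: "\<And>q. q \<in> R \<Longrightarrow> g q \<in> S" "\<And>q q'. q \<in> R \<Longrightarrow> q' \<in> R \<Longrightarrow> q \<subseteq> q' \<Longrightarrow> g q \<subseteq> g q'"
    and \<phi>: "\<And>q. q \<in> R \<Longrightarrow> \<phi> (Vertex q) \<in> hom E (fo u (Pair (Vertex (g q)) (fo \<rho> e))) e"
      "\<And>q. q \<in> R \<Longrightarrow> fa \<rho> (\<phi> (Vertex q)) = idt B (fo \<rho> e)"
      "\<And>q q'. q \<in> R \<Longrightarrow> q' \<in> R \<Longrightarrow> q \<subseteq> q' \<Longrightarrow>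
        \<phi> (Vertex q') \<cdot>\<^bsub>E\<^esub> fa u (Pair (Pair (Vertex (g q)) (Vertex (g q'))) (idt B (fo \<rho> e))) = \<phi> (Vertex q)"
    and l: "\<And>p b' \<psi>. p \<in> S \<Longrightarrow> b' \<in> ob B \<Longrightarrow> \<psi> \<in> hom E (fo u (Pair (Vertex p) b')) e \<Longrightarrow> l p \<in> R \<and> p \<subseteq> g (l p)
        \<and> \<phi> (Vertex (l p)) \<cdot>\<^bsub>E\<^esub> fa u (Pair (Pair (Vertex p) (Vertex (g (l p)))) (fa \<rho> \<psi>)) = \<psi>"
      "\<And>p q b' \<psi>. p \<in> S \<Longrightarrow> q \<in> S \<Longrightarrow> p \<subseteq> q \<Longrightarrow> b' \<in> ob B \<Longrightarrow> \<psi> \<in> hom E (fo u (Pair (Vertex q) b')) e \<Longrightarrow> l p \<subseteq> l q"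
      "\<And>q. q \<in> R \<Longrightarrow> l (g q) = q"
  shows "exact_at A E u e Q (comp_ftor Q (level_at (poset_cat S) B (fo \<rho> e)) (poset_ftor R g)) (restrict \<phi> (ob Q))"
proof -
  let ?b = "fo \<rho> e" and ?K = "comma_over A E u e"
  have A: "small_cat small A" unfolding A_def
    using smallness S B by (simp add: prod_small_cat poset_small_cat)
  have Q: "small_cat small Q" unfolding Q_def using smallness R by (simp add: poset_small_cat)
  have c: "category A" "category B" "category E" "category Q" using A B E Q by (auto dest: small_catD)
  have b: "?b \<in> ob B" using functor_ob[OF \<rho> e] .
  have K: "category ?K" using c u by (simp add: comma_over_category)
  have obK: "x \<in> ob ?K \<longleftrightarrow> (\<exists>p b' \<psi>. x = Pair (Pair (Vertex p) b') \<psi> \<and> p \<in> S \<and> b' \<in> ob B \<and>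
      \<psi> \<in> hom E (fo u (Pair (Vertex p) b')) e)" for x
    by (auto simp: in_ob_comma_over_iff A_def in_ob_prod_iff in_ob_poset_iff)
  have homK: "Pair (Pair (Pair (Pair (Vertex p) b1) \<psi>1) (Pair (Pair (Vertex q) b2) \<psi>2)) (Pair (Pair (Vertex p) (Vertex q)) h)
      \<in> hom ?K (Pair (Pair (Vertex p) b1) \<psi>1) (Pair (Pair (Vertex q) b2) \<psi>2)"
    if "p \<in> S" "q \<in> S" "p \<subseteq> q" "\<psi>1 \<in> hom E (fo u (Pair (Vertex p) b1)) e" "\<psi>2 \<in> hom E (fo u (Pair (Vertex q) b2)) e"
      "h \<in> hom B b1 b2" "\<psi>2 \<cdot>\<^bsub>E\<^esub> fa u (Pair (Pair (Vertex p) (Vertex q)) h) = \<psi>1" for p q b1 b2 \<psi>1 \<psi>2 h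
    using that hom_ob[OF c(2) that(6)] unfolding in_hom_comma_over_iff obK by (simp add: A_def Pair_hom_prod)
  have homKE: "\<exists>p b1 \<psi>1 q b2 \<psi>2 h. x = Pair (Pair (Vertex p) b1) \<psi>1 \<and> y = Pair (Pair (Vertex q) b2) \<psi>2 \<and>
      f = Pair (Pair x y) (Pair (Pair (Vertex p) (Vertex q)) h) \<and> p \<in> S \<and> q \<in> S \<and> p \<subseteq> q \<and> b1 \<in> ob B \<and> b2 \<in> ob B \<and>
      \<psi>1 \<in> hom E (fo u (Pair (Vertex p) b1)) e \<and> \<psi>2 \<in> hom E (fo u (Pair (Vertex q) b2)) e \<and>
      h \<in> hom B b1 b2 \<and> \<psi>2 \<cdot>\<^bsub>E\<^esub> fa u (Pair (Pair (Vertex p) (Vertex q)) h) = \<psi>1" if f: "f \<in> hom ?K x y" for f x y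
  proof -
    obtain p b1 \<psi>1 q b2 \<psi>2 where "x = Pair (Pair (Vertex p) b1) \<psi>1" "p \<in> S" "b1 \<in> ob B"
      "\<psi>1 \<in> hom E (fo u (Pair (Vertex p) b1)) e" "y = Pair (Pair (Vertex q) b2) \<psi>2" "q \<in> S" "b2 \<in> ob B"
      "\<psi>2 \<in> hom E (fo u (Pair (Vertex q) b2)) e"
      using hom_ob[OF K f] unfolding obK by metis
    with f show ?thesis
      by (auto simp: in_hom_comma_over_iff A_def in_hom_prod_iff in_hom_poset_iff)
  qed
  have \<rho>\<psi>: "fa \<rho> \<psi> \<in> hom B b' ?b" if "p \<in> S" "b' \<in> ob B" "\<psi> \<in> hom E (fo u (Pair (Vertex p) b')) e" for p b' \<psi>
    using functor_hom[OF \<rho> that(3)] \<rho>u(1)[OF that(1,2)] by simp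
  define s0 where "s0 x = Pair (Pair (vertex_map g x) ?b) (\<phi> x)" for x
  define s where "s = mk_ftor Q s0 (\<lambda>f. Pair (Pair (s0 (pfst f)) (s0 (psnd f)))
    (Pair (Pair (vertex_map g (pfst f)) (vertex_map g (psnd f))) (idt B ?b)))"
  define l0 where "l0 y = vertex_map l (pfst (pfst y))" for y :: "'a uni"
  define l' where "l' = mk_ftor ?K l0 (\<lambda>f. Pair (l0 (pfst (pfst f))) (l0 (psnd (pfst f))))"
  define \<epsilon> where "\<epsilon> = (\<lambda>x \<in> ob ?K. Pair (Pair x (s0 (l0 x)))
    (Pair (Pair (pfst (pfst x)) (vertex_map g (l0 x))) (fa \<rho> (psnd x))))"
  have s0: "s0 (Vertex q) \<in> ob ?K" if "q \<in> R" for q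
    unfolding s0_def obK using g(1)[OF that] b \<phi>(1)[OF that] by simp
  have l0: "\<exists>q. l0 x = Vertex q \<and> q \<in> R" if "x \<in> ob ?K" for x
    using that unfolding obK by (auto simp: l0_def l)
  have s: "is_functor Q ?K s"
    unfolding s_def
  proof (rule mk_ftor_functor[OF c(4) K])
    show "s0 x \<in> ob ?K" if "x \<in> ob Q" for x using that s0 by (auto simp: Q_def in_ob_poset_iff)
    fix f x y assume "f \<in> hom Q x y"
    then obtain q q' where *: "x = Vertex q" "y = Vertex q'" "f = Pair x y" "q \<in> R" "q' \<in> R" "q \<subseteq> q'"
      by (auto simp: Q_def in_hom_poset_iff)
    then show "Pair (Pair (s0 (pfst f)) (s0 (psnd f))) (Pair (Pair (vertex_map g (pfst f)) (vertex_map g (psnd f))) (idt B ?b))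
       \<in> hom ?K (s0 x) (s0 y)"
      using g(1) \<phi> idt_hom[OF c(2) b] subsetD[OF g(2)[OF *(4-6)]] by (auto simp: s0_def intro!: homK)
  qed (use idt_left[OF c(2) idt_hom[OF c(2) b]] in
      \<open>auto simp: Q_def in_ob_poset_iff in_hom_poset_iff A_def s0_def\<close>)
  have l': "is_functor ?K Q l'"
    unfolding l'_def
  proof (rule mk_ftor_functor[OF K c(4)])
    show "l0 x \<in> ob Q" if "x \<in> ob ?K" for x using l0[OF that] by (auto simp: Q_def)
    fix f x y assume f: "f \<in> hom ?K x y"
    show "Pair (l0 (pfst (pfst f))) (l0 (psnd (pfst f))) \<in> hom Q (l0 x) (l0 y)"
      using homKE[OF f] by (auto simp: l0_def Q_def l)
  qed (auto simp: Q_def)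
  have ls: "comp_ftor Q l' s = id_ftor Q"
  proof (rule functor_eqI[OF comp_ftor_functor[OF c(4,4) s l'] id_ftor_functor[OF c(4)]])
    show "fo (comp_ftor Q l' s) x = fo (id_ftor Q) x" if "x \<in> ob Q" for x
      using that s0 by (auto simp: Q_def in_ob_poset_iff l'_def s_def l(3) l0_def)
        (auto simp: s0_def l)
    show "fa (comp_ftor Q l' s) f = fa (id_ftor Q) f" if f: "f \<in> ar Q" for f
    proof -
      have "fa s f \<in> ar ?K" using s f by (auto simp: is_functor_def)
      then show ?thesis
        using f by (auto simp: Q_def in_ar_poset_iff l'_def s_def l0_def s0_def l)
    qed
  qed
  have \<epsilon>1: "\<epsilon> x \<in> hom ?K x (s0 (l0 x))" if x: "x \<in> ob ?K" for x
  proof -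
    obtain p b' \<psi> where *: "x = Pair (Pair (Vertex p) b') \<psi>" "p \<in> S" "b' \<in> ob B" "\<psi> \<in> hom E (fo u (Pair (Vertex p) b')) e"
      using x unfolding obK by blast
    show ?thesis
      using x \<rho>\<psi>[OF *(2-4)] l(1)[OF *(2-4)] * \<phi>(1) g(1)
      by (auto simp: \<epsilon>_def s0_def l0_def intro!: homK)
  qed
  have \<epsilon>: "is_nt ?K ?K (id_ftor ?K) (comp_ftor ?K s l') \<epsilon>"
  proof (rule ntI[OF K id_ftor_functor[OF K] comp_ftor_functor[OF K K l' s]])
    show "\<epsilon> x \<in> hom ?K (fo (id_ftor ?K) x) (fo (comp_ftor ?K s l') x)" if x: "x \<in> ob ?K" for x
      using \<epsilon>1[OF x] x functor_ob[OF l' x] by (simp add: l'_def s_def)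
    show "\<epsilon> \<in> extensional (ob ?K)" by (simp add: \<epsilon>_def)
    fix f x y assume f: "f \<in> hom ?K x y"
    obtain p b1 \<psi>1 q b2 \<psi>2 h where *: "x = Pair (Pair (Vertex p) b1) \<psi>1" "y = Pair (Pair (Vertex q) b2) \<psi>2"
      "f = Pair (Pair x y) (Pair (Pair (Vertex p) (Vertex q)) h)" "p \<in> S" "q \<in> S" "p \<subseteq> q" "b1 \<in> ob B" "b2 \<in> ob B"
      "\<psi>1 \<in> hom E (fo u (Pair (Vertex p) b1)) e" "\<psi>2 \<in> hom E (fo u (Pair (Vertex q) b2)) e"
      "h \<in> hom B b1 b2" "\<psi>2 \<cdot>\<^bsub>E\<^esub> fa u (Pair (Pair (Vertex p) (Vertex q)) h) = \<psi>1"
      using homKE[OF f] by metis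
    have xy: "x \<in> ob ?K" "y \<in> ob ?K" using hom_ob[OF K f] .
    have fK: "f \<in> ar ?K" using f by (rule homD)
    have pq: "Pair (Pair (Vertex p) (Vertex q)) h \<in> hom A (Pair (Vertex p) b1) (Pair (Vertex q) b2)"
      using *(4-6,11) by (simp add: A_def Pair_hom_prod)
    \<comment> \<open>In the poset variable naturality is automatic. In the parameter it is the
      image under \<open>\<rho>\<close> of the condition that the arrow lies over
      \<open>e\<close>.\<close>
    have "fa \<rho> \<psi>1 = fa \<rho> \<psi>2 \<cdot>\<^bsub>B\<^esub> h"
      using functor_cmp[OF \<rho> functor_hom[OF u pq] *(10)] *(12) \<rho>u(2)[OF *(4-6) homD(1)[OF *(11)]] by simp
    then have "idt B ?b \<cdot>\<^bsub>B\<^esub> fa \<rho> \<psi>1 = fa \<rho> \<psi>2 \<cdot>\<^bsub>B\<^esub> h"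
      using idt_left[OF c(2) \<rho>\<psi>[OF *(4,7,9)]] by simp
    moreover have "fa l' f \<in> ar Q" using l' fK by (auto simp: is_functor_def)
    ultimately show "\<epsilon> y \<cdot>\<^bsub>?K\<^esub> fa (id_ftor ?K) f = fa (comp_ftor ?K s l') f \<cdot>\<^bsub>?K\<^esub> \<epsilon> x"
      using fK xy by (simp add: l'_def s_def \<epsilon>_def A_def *(1-3) l0_def)
  qed
  \<comment> \<open>The arrows \<open>\<phi>\<close> lie over the identity of the parameter
    \<open>\<rho> e\<close>, so on the image of \<open>s\<close> the unit is an identity and not
    merely invertible, as \<open>exact_at_final\<close> demands.\<close>
  have \<epsilon>s: "\<epsilon> (fo s x) = idt ?K (fo s x)" if x: "x \<in> ob Q" for x
  proof -
    obtain q where q: "x = Vertex q" "q \<in> R" using x by (auto simp: Q_def in_ob_poset_iff)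
    have "l0 (s0 (Vertex q)) = Vertex q" using l(3)[OF q(2)] by (simp add: l0_def s0_def)
    then show ?thesis
      using x s0[OF q(2)] \<phi>(2)[OF q(2)] by (simp add: s_def \<epsilon>_def q) (simp add: s0_def A_def)
  qed
  have g': "is_functor Q (poset_cat S) (poset_ftor R g)"
    unfolding Q_def using g by (rule poset_ftor_functor)
  have lv: "is_functor (poset_cat S) A (level_at (poset_cat S) B ?b)"
    unfolding A_def using c b by (simp add: level_at_functor poset_category)
  have 1: "comp_ftor Q (comma_proj ?K) s = comp_ftor Q (level_at (poset_cat S) B ?b) (poset_ftor R g)"
  proof (rule functor_eqI[OF comp_ftor_functor[OF c(4,1) s comma_proj_functor[OF c(1,3) u]]
        comp_ftor_functor[OF c(4,1) g' lv]])
    show "fo (comp_ftor Q (comma_proj ?K) s) x = fo (comp_ftor Q (level_at (poset_cat S) B ?b) (poset_ftor R g)) x"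
      if x: "x \<in> ob Q" for x
      using x s0 g by (auto simp: Q_def in_ob_poset_iff s_def comma_proj_def) (simp add: s0_def)
    show "fa (comp_ftor Q (comma_proj ?K) s) f = fa (comp_ftor Q (level_at (poset_cat S) B ?b) (poset_ftor R g)) f"
      if f: "f \<in> ar Q" for f
    proof -
      have "fa s f \<in> ar ?K" using s f by (auto simp: is_functor_def)
      then show ?thesis
        using f g by (auto simp: Q_def in_ar_poset_iff s_def)
    qed
  qed
  have 2: "pre_whisker Q (comma_nt ?K) s = restrict \<phi> (ob Q)"
    using s0 by (auto simp: pre_whisker_def comma_nt_def Q_def in_ob_poset_iff s_def intro!: restrict_ext)
      (auto simp: s0_def)
  show ?thesis
    using exact_at_final[OF A E u e Q s l' ls \<epsilon> \<epsilon>s] unfolding 1 2 .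
qed

end

text \<open>
  \<open>g : R \<rightarrow> S\<close> embeds \<open>R\<close> as a reflective subposet of \<open>{p \<in> S. f p \<subseteq> c}\<close>, with reflection \<open>l\<close>.
\<close>

definition reflective_fibre :: "nat set set \<Rightarrow> (nat set \<Rightarrow> nat set) \<Rightarrow> nat set \<Rightarrow> nat set set
    \<Rightarrow> (nat set \<Rightarrow> nat set) \<Rightarrow> (nat set \<Rightarrow> nat set) \<Rightarrow> bool" where
  "reflective_fibre S f c R g l \<longleftrightarrow> finite R \<and>
    (\<forall>q \<in> R. g q \<in> S \<and> f (g q) \<subseteq> c \<and> l (g q) = q) \<and>
    (\<forall>q \<in> R. \<forall>q' \<in> R. q \<subseteq> q' \<longrightarrow> g q \<subseteq> g q') \<and>
    (\<forall>p \<in> S. f p \<subseteq> c \<longrightarrow> l p \<in> R \<and> p \<subseteq> g (l p)) \<and>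
    (\<forall>p \<in> S. \<forall>p' \<in> S. p \<subseteq> p' \<longrightarrow> f p' \<subseteq> c \<longrightarrow> l p \<subseteq> l p')"

context derivator_on
begin

text \<open>The case where \<open>\<rho>\<close> is the projection to the parameters. A map from
  \<open>(f p, b')\<close> to \<open>(c, b)\<close> exists only if \<open>f p \<subseteq> c\<close>,
  so a reflection of the fibre over \<open>c\<close> suffices.\<close>

lemma exact_at_prod_ftor:
  fixes S T R :: "nat set set" and B :: "'a scat"
  assumes S: "finite S" and T: "finite T" and B: "small_cat small B"
    and f: "\<And>p. p \<in> S \<Longrightarrow> f p \<in> T" "\<And>p q. p \<in> S \<Longrightarrow> q \<in> S \<Longrightarrow> p \<subseteq> q \<Longrightarrow> f p \<subseteq> f q"
    and c: "c \<in> T" and R: "reflective_fibre S f c R g l" and b: "b \<in> ob B"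
  shows "exact_at (par_cat S B) (par_cat T B) (prod_ftor (poset_cat S) B (poset_ftor S f) (id_ftor B))
    (Pair (Vertex c) b) (poset_cat R) (comp_ftor (poset_cat R) (level_at (poset_cat S) B b) (poset_ftor R g))
    (\<lambda>x \<in> ob (poset_cat R). Pair (Pair (vertex_map (\<lambda>q. f (g q)) x) (Vertex c)) (idt B b))"
proof -
  let ?A = "poset_cat S :: 'a scat" and ?T = "poset_cat T :: 'a scat"
  have cB: "category B" using B by (rule small_catD)
  have E: "small_cat small (?T \<times>\<^sub>c B)" using smallness T B by (simp add: prod_small_cat poset_small_cat)
  have u: "is_functor (?A \<times>\<^sub>c B) (?T \<times>\<^sub>c B) (prod_ftor ?A B (poset_ftor S f) (id_ftor B))"
    using f cB by (intro prod_ftor_functor poset_ftor_functor id_ftor_functor poset_category) auto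
  have \<rho>: "is_functor (?T \<times>\<^sub>c B) B (proj2 ?T B)" using cB by (simp add: proj2_functor poset_category)
  note R' = R[unfolded reflective_fibre_def]
  have l_mono: "l p \<subseteq> l q" if "p \<in> S" "q \<in> S" "p \<subseteq> q" "f q \<subseteq> c" for p q
    using R' that by blast
  have "exact_at (?A \<times>\<^sub>c B) (?T \<times>\<^sub>c B) (prod_ftor ?A B (poset_ftor S f) (id_ftor B))
    (Pair (Vertex c) b) (poset_cat R)
    (comp_ftor (poset_cat R) (level_at ?A B (fo (proj2 ?T B) (Pair (Vertex c) b))) (poset_ftor R g))
    (restrict (\<lambda>x. Pair (Pair (vertex_map (\<lambda>q. f (g q)) x) (Vertex c)) (idt B b)) (ob (poset_cat R)))"
    by (rule exact_at_poset[where l = l, OF S _ B E u \<rho>])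
      (use R' subsetD[OF l_mono] f c b cB in \<open>auto simp: Pair_hom_prod in_hom_prod_iff in_hom_poset_iff idt_ar idt_hom homD(1)
         idt_left[OF cB idt_hom[OF cB b]] idt_left[OF cB]\<close>)
  then show ?thesis using c b by simp
qed

text \<open>The case \<open>E = B\<close>: the reflection moves only the parameter, along the given
  map to \<open>b\<close>, and all of \<open>R\<close> remains.\<close>

lemma exact_at_proj2:
  fixes R :: "nat set set" and B :: "'a scat"
  assumes R: "finite R" and B: "small_cat small B" and b: "b \<in> ob B"
  shows "exact_at (par_cat R B) B (par_proj R B) b (poset_cat R) (level_at (poset_cat R) B b)
    (\<lambda>x \<in> ob (poset_cat R). idt B b)"
proof -
  let ?A = "poset_cat R :: 'a scat"
  have cB: "category B" using B by (rule small_catD)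
  have u: "is_functor (?A \<times>\<^sub>c B) B (proj2 ?A B)" using cB by (simp add: proj2_functor poset_category)
  have "exact_at (?A \<times>\<^sub>c B) B (proj2 ?A B) b ?A
    (comp_ftor ?A (level_at ?A B (fo (id_ftor B) b)) (poset_ftor R (\<lambda>q. q)))
    (restrict (\<lambda>x. idt B b) (ob ?A))"
    by (rule exact_at_poset[where l = "\<lambda>q. q", OF R R B B u id_ftor_functor[OF cB]])
      (use b cB in \<open>auto simp: idt_ar idt_hom homD(1) idt_left[OF cB idt_hom[OF cB b]] idt_left[OF cB]\<close>)
  moreover have "comp_ftor ?A (level_at ?A B b) (poset_ftor R (\<lambda>q. q)) = level_at ?A B b"
    by (rule functor_eqI[of ?A "?A \<times>\<^sub>c B" _ "?A \<times>\<^sub>c B"])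
      (auto simp: in_ob_poset_iff in_ar_poset_iff poset_category prod_category cB b
        intro!: comp_ftor_functor[of _ _ ?A] level_at_functor poset_ftor_functor)
  ultimately show ?thesis using b by simp
qed

end

section \<open>Change of parameters and fibres with parameters\<close>

definition fibre_nt :: "nat set set \<Rightarrow> 'a scat \<Rightarrow> (nat set \<Rightarrow> nat set) \<Rightarrow> nat set \<Rightarrow> 'a snt" where
  "fibre_nt R B h c = (\<lambda>p \<in> ob (par_cat R B).
     Pair (Pair (vertex_map h (pfst p)) (Vertex c)) (idt B (psnd p)))"

lemma par_ftor_functor:
  assumes "category B" "\<And>p. p \<in> S \<Longrightarrow> f p \<in> T" "\<And>p q. p \<in> S \<Longrightarrow> q \<in> S \<Longrightarrow> p \<subseteq> q \<Longrightarrow> f p \<subseteq> f q"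
  shows "is_functor (par_cat S B) (par_cat T B) (par_ftor S B f)"
  using assms by (intro prod_ftor_functor poset_ftor_functor id_ftor_functor poset_category) auto

lemma par_ftor_comp:
  assumes B: "category B"
    and g: "\<And>q. q \<in> R \<Longrightarrow> g q \<in> S" "\<And>q q'. q \<in> R \<Longrightarrow> q' \<in> R \<Longrightarrow> q \<subseteq> q' \<Longrightarrow> g q \<subseteq> g q'"
    and f: "\<And>p. p \<in> S \<Longrightarrow> f p \<in> T" "\<And>p q. p \<in> S \<Longrightarrow> q \<in> S \<Longrightarrow> p \<subseteq> q \<Longrightarrow> f p \<subseteq> f q"
  shows "comp_ftor (par_cat R B) (par_ftor S B f) (par_ftor R B g) = par_ftor R B (\<lambda>q. f (g q))"
proof -
  have k: "is_functor (par_cat R B) (par_cat S B) (par_ftor R B g)"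
    using B g by (rule par_ftor_functor)
  have u: "is_functor (par_cat S B) (par_cat T B) (par_ftor S B f)"
    using B f by (rule par_ftor_functor)
  show ?thesis
    by (rule functor_eqI[OF comp_ftor_functor[OF _ _ k u] par_ftor_functor[of B R "\<lambda>q. f (g q)" T]])
      (use B f g in \<open>auto simp: in_ob_prod_iff in_ar_prod_iff in_ob_poset_iff in_ar_poset_iff
        prod_category poset_category\<close>)
qed

context derivator_on
begin

text \<open>The fibre of \<open>f\<close> over \<open>c'\<close> is the same poset at
  \<open>(c', b)\<close> and at \<open>(c', v b)\<close>, so both extensions are computed by the
  same colimit. Since \<open>f\<close> acts on vertices and \<open>v\<close> on parameters, they
  commute strictly; the 2-cell of the square is an identity and its transport is plain
  restriction.\<close>

lemma universal_base_change:
  fixes B C :: "'a scat"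
  assumes S: "finite S" and T: "finite T" and B: "small_cat small B" and C: "small_cat small C"
    and f: "\<And>p. p \<in> S \<Longrightarrow> f p \<in> T" "\<And>p q. p \<in> S \<Longrightarrow> q \<in> S \<Longrightarrow> p \<subseteq> q \<Longrightarrow> f p \<subseteq> f q"
    and v: "is_functor B C v"
    and univ: "lan_arrow (par_cat S C) (par_cat T C) (par_ftor S C f) X Z \<eta>"
  shows "lan_arrow (par_cat S B) (par_cat T B) (par_ftor S B f)
    (fo (D1 D (par_cat S B) (par_cat S C) (prod_ftor (poset_cat S) B (id_ftor (poset_cat S)) v)) X)
    (fo (D1 D (par_cat T B) (par_cat T C) (prod_ftor (poset_cat T) B (id_ftor (poset_cat T)) v)) Z)
    (fa (D1 D (par_cat S B) (par_cat S C) (prod_ftor (poset_cat S) B (id_ftor (poset_cat S)) v)) \<eta>)"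
proof -
  let ?S = "poset_cat S :: 'a scat" and ?T = "poset_cat T :: 'a scat"
  let ?k = "prod_ftor ?S B (id_ftor ?S) v" and ?w = "prod_ftor ?T B (id_ftor ?T) v"
  let ?A' = "?S \<times>\<^sub>c B" and ?A = "?S \<times>\<^sub>c C" and ?E' = "?T \<times>\<^sub>c B" and ?E = "?T \<times>\<^sub>c C"
  let ?u = "par_ftor S C f" and ?u' = "par_ftor S B f"
  have s: "small_cat small ?A'" "small_cat small ?A" "small_cat small ?E'" "small_cat small ?E"
    using smallness S T B C by (auto intro: prod_small_cat poset_small_cat)
  have c: "category B" "category C" "category ?S" "category ?T" "category ?A'" "category ?A" "category ?E'" "category ?E"
    using s B C by (auto dest: small_catD simp: poset_category)
  have u: "is_functor ?A ?E ?u" and u': "is_functor ?A' ?E' ?u'"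
    using par_ftor_functor[OF c(2), of S f T] par_ftor_functor[OF c(1), of S f T] f by auto
  have k: "is_functor ?A' ?A ?k" and w: "is_functor ?E' ?E ?w"
    using c v by (auto intro!: prod_ftor_functor id_ftor_functor)
  have v': "fo v x \<in> ob C" if "x \<in> ob B" for x using functor_ob[OF v that] .
  have va: "fa v x \<in> ar C" if "x \<in> ar B" for x using v that by (auto simp: is_functor_def)
  have uk: "is_functor ?A' ?E (comp_ftor ?A' ?u ?k)" using comp_ftor_functor[OF c(5,8) k u] .
  have eq: "comp_ftor ?A' ?w ?u' = comp_ftor ?A' ?u ?k"
    by (rule functor_eqI[OF comp_ftor_functor[OF c(5,8) u' w] uk])
      (auto simp: in_ob_prod_iff in_ar_prod_iff in_ob_poset_iff in_ar_poset_iff f v' va)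
  let ?I = "id_nt ?A' ?E (comp_ftor ?A' ?u ?k)"
  have I: "is_nt ?A' ?E (comp_ftor ?A' ?u ?k) (comp_ftor ?A' ?w ?u') ?I"
    unfolding eq using c(5,8) uk by (rule id_nt_nt)
  note Z = universalD[OF univ]
  have "lan_arrow ?A' ?E' ?u' (fo (D1 D ?A' ?A ?k) X) (fo (D1 D ?E' ?E ?w) Z)
    (transport ?A' ?A ?E ?u ?k (comp_ftor ?A' ?w ?u') ?I Z \<eta>)"
  proof (rule universal_transport[OF s(1,2,3,4) u k u' w I _ univ])
    fix e assume "e \<in> ob ?E'"
    then obtain c' b where e: "e = Pair (Vertex c') b" "c' \<in> T" "b \<in> ob B"
      by (auto simp: in_ob_prod_iff in_ob_poset_iff)
    \<comment> \<open>The whole fibre, with the identity as reflection, serves both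
      \<open>(c', b)\<close> and its image under \<open>v\<close>.\<close>
    define R where "R = {p \<in> S. f p \<subseteq> c'}"
    have RS: "p \<in> S" "f p \<in> T" "f p \<subseteq> c'" if "p \<in> R" for p using that f by (auto simp: R_def)
    have R: "reflective_fibre S f c' R (\<lambda>p. p) (\<lambda>p. p)"
      unfolding reflective_fibre_def R_def using S by auto
    let ?Q = "poset_cat R :: 'a scat"
    let ?g = "\<lambda>B b. comp_ftor ?Q (level_at ?S B b) (poset_ftor R (\<lambda>p. p))"
    let ?\<phi> = "\<lambda>B b. (\<lambda>x \<in> ob ?Q. Pair (Pair (vertex_map f x) (Vertex c')) (idt B b))"
    have g: "is_functor ?Q (?S \<times>\<^sub>c B') (?g B' b')" if "b' \<in> ob B'" "category B'" for B' b'
      by (rule comp_ftor_functor[of _ _ ?S])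
        (use that RS in \<open>auto intro!: level_at_functor poset_ftor_functor simp: poset_category prod_category\<close>)
    have 1: "comp_ftor ?Q ?k (?g B b) = ?g C (fo v b)"
      by (rule functor_eqI[OF comp_ftor_functor[OF poset_category c(6) g[OF e(3) c(1)] k] g[OF v'[OF e(3)] c(2)]])
        (use e c in \<open>auto simp: in_ob_poset_iff in_ar_poset_iff RS functor_idt[OF v] idt_ar\<close>)
    have 2: "vcomp ?Q ?E (post_whisker ?Q ?w (?\<phi> B b)) (pre_whisker ?Q ?I (?g B b)) = ?\<phi> C (fo v b)"
      using e c idt_left[OF c(2) idt_hom[OF c(2) v'[OF e(3)]]]
      by (auto simp: vcomp_def post_whisker_def pre_whisker_def id_nt_def in_ob_poset_iff RS v' functor_idt[OF v] idt_ar
          intro!: restrict_ext)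
    show "\<exists>Q g \<phi>. exact_at ?A' ?E' ?u' e Q g \<phi> \<and>
      exact_at ?A ?E ?u (fo ?w e) Q (comp_ftor Q ?k g) (vcomp Q ?E (post_whisker Q ?w \<phi>) (pre_whisker Q ?I g))"
    proof (intro exI conjI)
      show "exact_at ?A' ?E' ?u' e ?Q (?g B b) (?\<phi> B b)"
        unfolding e(1) by (rule exact_at_prod_ftor[OF S T B f e(2) R e(3)])
      show "exact_at ?A ?E ?u (fo ?w e) ?Q (comp_ftor ?Q ?k (?g B b))
         (vcomp ?Q ?E (post_whisker ?Q ?w (?\<phi> B b)) (pre_whisker ?Q ?I (?g B b)))"
        unfolding 1 2 using exact_at_prod_ftor[OF S T C f e(2) R v'[OF e(3)]] e by simp
    qed
  qed
  moreover have "transport ?A' ?A ?E ?u ?k (comp_ftor ?A' ?w ?u') ?I Z \<eta> = fa (D1 D ?A' ?A ?k) \<eta>"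
    unfolding transport_def eq D2_id[OF s(1,4) uk Z(1)]
    using idt_left[OF D0_category[OF s(1)] D1_hom[OF s(1,2) k Z(2)]] D1_comp_ob[OF s(1,2,4) k u Z(1)] by simp
  ultimately show ?thesis by simp
qed

lemma fibre_nt_nt:
  assumes B: "category B" and h: "\<And>q. q \<in> R \<Longrightarrow> h q \<in> T \<and> h q \<subseteq> c" and c: "c \<in> T"
    and m: "\<And>q q'. q \<in> R \<Longrightarrow> q' \<in> R \<Longrightarrow> q \<subseteq> q' \<Longrightarrow> h q \<subseteq> h q'"
  shows "is_nt (par_cat R B) (par_cat T B) (par_ftor R B h)
    (comp_ftor (par_cat R B) (par_slice T B c) (par_proj R B)) (fibre_nt R B h c)"
proof (rule ntI)
  show "is_functor (par_cat R B) (par_cat T B) (par_ftor R B h)"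
    using B h m by (intro par_ftor_functor) auto
  show "is_functor (par_cat R B) (par_cat T B)
    (comp_ftor (par_cat R B) (par_slice T B c) (par_proj R B))"
    using B c by (intro comp_ftor_functor[OF _ _ proj2_functor slice_at_functor])
      (auto simp: prod_category poset_category)
qed (use assms in \<open>auto simp: prod_category poset_category fibre_nt_def in_ob_prod_iff in_ob_poset_iff in_hom_prod_iff
    in_hom_poset_iff Pair_hom_prod idt_hom homD(1) hom_ob idt_left idt_right\<close>)

text \<open>
  The parametrized form of (Der4): \<open>colim\<^bsub>R\<^esub> g\<^sup>* X\<close> is the value of \<open>f\<^sub>! X\<close> at \<open>c\<close>.
\<close>

lemma universal_fibre:
  fixes B :: "'a scat"
  assumes S: "finite S" and T: "finite T" and B: "small_cat small B"
    and f: "\<And>p. p \<in> S \<Longrightarrow> f p \<in> T" "\<And>p q. p \<in> S \<Longrightarrow> q \<in> S \<Longrightarrow> p \<subseteq> q \<Longrightarrow> f p \<subseteq> f q"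
    and c: "c \<in> T" and R: "reflective_fibre S f c R g l"
    and univ: "lan_arrow (par_cat S B) (par_cat T B) (par_ftor S B f) X Z \<eta>"
  shows "lan_arrow (par_cat R B) B (par_proj R B)
    (fo (D1 D (par_cat R B) (par_cat S B) (par_ftor R B g)) X)
    (fo (D1 D B (par_cat T B) (par_slice T B c)) Z)
    (transport (par_cat R B) (par_cat S B) (par_cat T B) (par_ftor S B f) (par_ftor R B g)
      (comp_ftor (par_cat R B) (par_slice T B c) (par_proj R B))
      (fibre_nt R B (\<lambda>q. f (g q)) c) Z \<eta>)"
proof -
  let ?S = "poset_cat S :: 'a scat" and ?T = "poset_cat T :: 'a scat" and ?Q = "poset_cat R :: 'a scat"
  let ?k = "par_ftor R B g" and ?w = "slice_at ?T B (Vertex c)"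
  let ?A' = "?Q \<times>\<^sub>c B" and ?A = "?S \<times>\<^sub>c B" and ?E = "?T \<times>\<^sub>c B"
  let ?u = "par_ftor S B f" and ?u' = "proj2 ?Q B"
  note R' = R[unfolded reflective_fibre_def]
  have fR: "finite R" using R' by blast
  have g: "\<And>q. q \<in> R \<Longrightarrow> g q \<in> S" "\<And>q q'. q \<in> R \<Longrightarrow> q' \<in> R \<Longrightarrow> q \<subseteq> q' \<Longrightarrow> g q \<subseteq> g q'"
    "\<And>q. q \<in> R \<Longrightarrow> f (g q) \<subseteq> c" using R' by simp_all
  have s: "small_cat small ?A'" "small_cat small ?A" "small_cat small ?E"
    using smallness S T B fR by (auto intro: prod_small_cat poset_small_cat)
  have cc: "category B" "category ?S" "category ?T" "category ?A'" "category ?A" "category ?E"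
    using s B by (auto dest: small_catD simp: poset_category)
  have u: "is_functor ?A ?E ?u" and k: "is_functor ?A' ?A ?k"
    using f g cc subsetD[OF g(2)] by (auto intro!: par_ftor_functor)
  have u': "is_functor ?A' B ?u'" and w: "is_functor B ?E ?w"
    using cc c by (auto intro!: proj2_functor slice_at_functor poset_category)
  have eq: "comp_ftor ?A' ?u ?k = par_ftor R B (\<lambda>q. f (g q))"
    using cc(1) g(1,2) f by (rule par_ftor_comp)
  have \<Psi>: "is_nt ?A' ?E (comp_ftor ?A' ?u ?k) (comp_ftor ?A' ?w ?u') (fibre_nt R B (\<lambda>q. f (g q)) c)"
    unfolding eq by (rule fibre_nt_nt[OF cc(1) _ c]) (simp_all add: f g)
  show ?thesis
  proof (rule universal_transport[OF s(1,2) B s(3) u k u' w \<Psi> _ univ])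
    fix b assume b: "b \<in> ob B"
    \<comment> \<open>At \<open>b\<close> the extension along the projection is computed by
      \<open>R\<close> itself. Pasted with \<open>fibre_nt\<close>, this becomes the fibre square
      over \<open>(c, b)\<close> with \<open>g\<close> as embedding.\<close>
    let ?g = "level_at ?Q B b" and ?\<phi> = "\<lambda>x \<in> ob ?Q. idt B b"
    have lv: "is_functor ?Q ?A' ?g" using cc b by (auto intro: level_at_functor poset_category)
    have lS: "is_functor ?S ?A (level_at ?S B b)" using cc b by (auto intro: level_at_functor)
    have pg: "is_functor ?Q ?S (poset_ftor R g)" using g by (intro poset_ftor_functor) auto
    have 1: "comp_ftor ?Q ?k ?g = comp_ftor ?Q (level_at ?S B b) (poset_ftor R g)"
      by (rule functor_eqI[OF comp_ftor_functor[OF poset_category cc(5) lv k]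
            comp_ftor_functor[OF poset_category cc(5) pg lS]])
        (use b cc g in \<open>auto simp: in_ob_poset_iff in_ar_poset_iff idt_ar\<close>)
    have 2: "vcomp ?Q ?E (post_whisker ?Q ?w ?\<phi>) (pre_whisker ?Q (fibre_nt R B (\<lambda>q. f (g q)) c) ?g)
      = (\<lambda>x \<in> ob ?Q. Pair (Pair (vertex_map (\<lambda>q. f (g q)) x) (Vertex c)) (idt B b))"
      using b cc idt_left[OF cc(1) idt_hom[OF cc(1) b]]
      by (auto simp: vcomp_def post_whisker_def pre_whisker_def fibre_nt_def in_ob_poset_iff idt_ar
          intro!: restrict_ext)
    show "\<exists>Q g' \<phi>. exact_at ?A' B ?u' b Q g' \<phi> \<and>
      exact_at ?A ?E ?u (fo ?w b) Q (comp_ftor Q ?k g')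
        (vcomp Q ?E (post_whisker Q ?w \<phi>) (pre_whisker Q (fibre_nt R B (\<lambda>q. f (g q)) c) g'))"
    proof (intro exI conjI)
      show "exact_at ?A' B ?u' b ?Q ?g ?\<phi>" by (rule exact_at_proj2[OF fR B b])
      show "exact_at ?A ?E ?u (fo ?w b) ?Q (comp_ftor ?Q ?k ?g)
        (vcomp ?Q ?E (post_whisker ?Q ?w ?\<phi>) (pre_whisker ?Q (fibre_nt R B (\<lambda>q. f (g q)) c) ?g))"
        unfolding 1 2 using exact_at_prod_ftor[OF S T B f c R b] b by simp
    qed
  qed
qed

text \<open>If \<open>p\<close> is the largest element of the fibre over \<open>f p\<close>, a point
  is reflective in that fibre and the colimit is evaluation at \<open>p\<close>. The square is
  therefore compared with the extension along \<open>id_ftor B\<close>, whose universal arrows are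
  isomorphisms.\<close>

lemma iso_fibre_point:
  fixes B :: "'a scat"
  assumes S: "finite S" and T: "finite T" and B: "small_cat small B"
    and f: "\<And>p. p \<in> S \<Longrightarrow> f p \<in> T" "\<And>p q. p \<in> S \<Longrightarrow> q \<in> S \<Longrightarrow> p \<subseteq> q \<Longrightarrow> f p \<subseteq> f q"
    and p: "p \<in> S" "\<And>q. q \<in> S \<Longrightarrow> f q \<subseteq> f p \<Longrightarrow> q \<subseteq> p"
    and univ: "lan_arrow (par_cat S B) (par_cat T B) (par_ftor S B f) X Z \<eta>"
  shows "fa (D1 D B (par_cat S B) (par_slice S B p)) \<eta> \<in>
      hom (D0 D B) (fo (D1 D B (par_cat S B) (par_slice S B p)) X)
        (fo (D1 D B (par_cat T B) (par_slice T B (f p))) Z)"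
    and "is_iso (D0 D B) (fa (D1 D B (par_cat S B) (par_slice S B p)) \<eta>)"
proof -
  let ?S = "poset_cat S :: 'a scat" and ?T = "poset_cat T :: 'a scat"
  let ?k = "slice_at ?S B (Vertex p)" and ?w = "slice_at ?T B (Vertex (f p))"
  let ?A = "?S \<times>\<^sub>c B" and ?E = "?T \<times>\<^sub>c B"
  let ?u = "par_ftor S B f" and ?u' = "id_ftor B"
  have s: "small_cat small ?A" "small_cat small ?E"
    using smallness S T B by (auto intro: prod_small_cat poset_small_cat)
  have c: "category B" "category ?A" "category ?E"
    using s B by (auto dest: small_catD)
  have u: "is_functor ?A ?E ?u" using f c by (auto intro!: par_ftor_functor)
  have k: "is_functor B ?A ?k" and w: "is_functor B ?E ?w"
    using c p f by (auto intro!: slice_at_functor poset_category)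
  have u': "is_functor B B ?u'" using c(1) by (rule id_ftor_functor)
  have uk: "is_functor B ?E (comp_ftor B ?u ?k)" using comp_ftor_functor[OF c(1,3) k u] .
  have eq: "comp_ftor B ?u ?k = ?w" "comp_ftor B ?w ?u' = ?w"
    by (rule functor_eqI[OF uk w], use p in simp_all)
      (rule functor_eqI[OF comp_ftor_functor[OF c(1,3) u' w] w], simp_all)
  let ?I = "id_nt B ?E ?w"
  have I: "is_nt B ?E (comp_ftor B ?u ?k) (comp_ftor B ?w ?u') ?I"
    unfolding eq using c(1,3) w by (rule id_nt_nt)
  note Z = universalD[OF univ]
  \<comment> \<open>With the family \<open>{{}}\<close> the category \<open>poset_cat R\<close> is
    \<open>one\<close> by definition, so it can be matched with the point used for the extension
    along the identity.\<close>
  have R: "reflective_fibre S f (f p) {{}} (\<lambda>_. p) (\<lambda>_. {})"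
    unfolding reflective_fibre_def using p by auto
  have "lan_arrow B B ?u' (fo (D1 D B ?A ?k) X) (fo (D1 D B ?E ?w) Z)
    (transport B ?A ?E ?u ?k (comp_ftor B ?w ?u') ?I Z \<eta>)"
  proof (rule universal_transport[OF B s(1) B s(2) u k u' w I _ univ])
    fix b assume b: "b \<in> ob B"
    have pt: "is_functor one B (point B b)" using c b by (simp add: point_functor)
    have lS: "is_functor ?S ?A (level_at ?S B b)" using c b by (auto intro: level_at_functor poset_category)
    have pg: "is_functor one ?S (poset_ftor {{}} (\<lambda>_. p))"
      unfolding one_def using p by (intro poset_ftor_functor) auto
    have 1: "comp_ftor one ?k (point B b) = comp_ftor one (level_at ?S B b) (poset_ftor {{}} (\<lambda>_. p))"
      by (rule functor_eqI[OF comp_ftor_functor[OF one_category c(2) pt k] comp_ftor_functor[OF one_category c(2) pg lS]])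
        (use b c p in \<open>auto simp: idt_ar\<close>, auto simp: star_def p)
    have 2: "vcomp one ?E (post_whisker one ?w (id_nt one B (point B b))) (pre_whisker one ?I (point B b))
      = (\<lambda>x \<in> ob one. Pair (Pair (vertex_map (\<lambda>q. f p) x) (Vertex (f p))) (idt B b))"
      using b c idt_left[OF c(1) idt_hom[OF c(1) b]]
      by (auto simp: vcomp_def post_whisker_def pre_whisker_def id_nt_def idt_ar vertex_map_def
          intro!: restrict_ext)
    show "\<exists>Q g' \<phi>. exact_at B B ?u' b Q g' \<phi> \<and>
      exact_at ?A ?E ?u (fo ?w b) Q (comp_ftor Q ?k g')
        (vcomp Q ?E (post_whisker Q ?w \<phi>) (pre_whisker Q ?I g'))"
    proof (intro exI conjI)
      show "exact_at B B ?u' b one (point B b) (id_nt one B (point B b))" by (rule exact_at_id[OF B b])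
      show "exact_at ?A ?E ?u (fo ?w b) one (comp_ftor one ?k (point B b))
        (vcomp one ?E (post_whisker one ?w (id_nt one B (point B b))) (pre_whisker one ?I (point B b)))"
        unfolding 1 2 using exact_at_prod_ftor[OF S T B f f(1)[OF p(1)] R b] b p unfolding one_def[symmetric] by simp
    qed
  qed
  moreover have "transport B ?A ?E ?u ?k (comp_ftor B ?w ?u') ?I Z \<eta> = fa (D1 D B ?A ?k) \<eta>"
    unfolding transport_def eq D2_id[OF B s(2) w Z(1)]
    using idt_left[OF D0_category[OF B] D1_hom[OF B s(1) k Z(2)]] D1_comp_ob[OF B s(1,2) k u Z(1)] eq by simp
  ultimately show "fa (D1 D B ?A ?k) \<eta> \<in> hom (D0 D B) (fo (D1 D B ?A ?k) X) (fo (D1 D B ?E ?w) Z)"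
    "is_iso (D0 D B) (fa (D1 D B ?A ?k) \<eta>)"
    by (simp_all add: D1_id[OF B] universal_id_iff[OF D0_category[OF B]])
qed

end

section \<open>Left Kan extension as a morphism of derivators\<close>

text \<open>Kan extension in stages: the two units compose to a universal arrow along the composite,
  which is compared with the chosen one.\<close>

lemma (in derivator_on) lan_comp_iso:
  assumes A: "small_cat small A" and B: "small_cat small B" and C: "small_cat small C"
    and u: "is_functor A B u" and v: "is_functor B C v" and X: "X \<in> ob (D0 D A)"
  shows "\<exists>e \<in> hom (D0 D C) (fo (lan D B C v) (fo (lan D A B u) X)) (fo (lan D A C (comp_ftor A v u)) X). is_iso (D0 D C) e"
proof -
  note d = D0_category[OF A] D0_category[OF B] D0_category[OF C]
  have vu: "is_functor A C (comp_ftor A v u)"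
    using A C u v by (auto intro: comp_ftor_functor dest: small_catD)
  note 1 = universal_comp[OF lan_universal[OF A B u X] lan_universal[OF B C v lan_ob[OF A B u X]] d
      D1_functor[OF A B u] D1_functor[OF B C v], folded D1_comp[OF A B C u v]]
  note 2 = lan_universal[OF A C vu X]
  obtain e where "e \<in> hom (D0 D C) (fo (lan D B C v) (fo (lan D A B u) X)) (fo (lan D A C (comp_ftor A v u)) X)"
    "fa (D1 D A C (comp_ftor A v u)) e \<cdot>\<^bsub>D0 D A\<^esub> (fa (D1 D A B u) (lan_unit D B C v (fo (lan D A B u) X)) \<cdot>\<^bsub>D0 D A\<^esub>
      lan_unit D A B u X) = lan_unit D A C (comp_ftor A v u) X"
    using universalE[OF 1 universalD[OF 2]] .
  with universal_unique_iso[OF 1 2 d(1,3) D1_functor[OF A C vu]] show ?thesis by blast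
qed

context derivator_on
begin

context
  fixes A E u X
  assumes A: "small_cat small A" and E: "small_cat small E" and u: "is_functor A E u" and X: "X \<in> ob (D0 D A)"
begin

text \<open>Arrows out of a Kan extension are equal if their transposes are. The coherence
  identities of \<open>ext_mor\<close> and three of the four edges of the square are proved by this
  test.\<close>

lemma lan_eqI:
  assumes "m \<in> hom (D0 D E) (fo (lan D A E u) X) W" "m' \<in> hom (D0 D E) (fo (lan D A E u) X) W"
    and "fa (D1 D A E u) m \<cdot>\<^bsub>D0 D A\<^esub> lan_unit D A E u X = fa (D1 D A E u) m' \<cdot>\<^bsub>D0 D A\<^esub> lan_unit D A E u X"
  shows "m = m'"
  by (rule universal_eqI[OF lan_universal[OF A E u X] D0_category[OF A] D1_functor[OF A E u] D0_category[OF E] assms])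

lemma lan_transpose_cmp:
  assumes t: "t \<in> hom (D0 D E) (fo (lan D A E u) X) W" and m: "m \<in> hom (D0 D E) W W'"
  shows "fa (D1 D A E u) (m \<cdot>\<^bsub>D0 D E\<^esub> t) \<cdot>\<^bsub>D0 D A\<^esub> lan_unit D A E u X
    = fa (D1 D A E u) m \<cdot>\<^bsub>D0 D A\<^esub> (fa (D1 D A E u) t \<cdot>\<^bsub>D0 D A\<^esub> lan_unit D A E u X)"
  using functor_cmp[OF D1_functor[OF A E u] t m]
    cmp_assoc[OF D0_category[OF A] lan_unit_hom[OF A E u X] D1_hom[OF A E u t] D1_hom[OF A E u m]] by simp

end

end

text \<open>The construction is carried out for any monotone map between finite families of sets;
  finiteness makes the posets small. The cube enters only through the choice of
  \<open>f\<close>.\<close>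

locale monotone_extension = derivator_on small D
  for small :: "'a uni set \<Rightarrow> bool" and D :: "('a, 'o, 'm) prederiv" +
  fixes S T :: "nat set set" and f :: "nat set \<Rightarrow> nat set"
  assumes finite_S: "finite S" and finite_T: "finite T"
    and f_in: "\<And>p. p \<in> S \<Longrightarrow> f p \<in> T"
    and f_mono: "\<And>p q. p \<in> S \<Longrightarrow> q \<in> S \<Longrightarrow> p \<subseteq> q \<Longrightarrow> f p \<subseteq> f q"
begin

abbreviation dom_cat :: "'a scat \<Rightarrow> 'a scat" where "dom_cat B \<equiv> par_cat S B"
abbreviation cod_cat :: "'a scat \<Rightarrow> 'a scat" where "cod_cat B \<equiv> par_cat T B"
abbreviation par :: "'a scat \<Rightarrow> 'a sftor" where "par B \<equiv> par_ftor S B f"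
abbreviation dom_ftor :: "'a scat \<Rightarrow> 'a sftor \<Rightarrow> 'a sftor"
  where "dom_ftor B v \<equiv> prod_ftor (poset_cat S) B (id_ftor (poset_cat S)) v"
abbreviation cod_ftor :: "'a scat \<Rightarrow> 'a sftor \<Rightarrow> 'a sftor"
  where "cod_ftor B v \<equiv> prod_ftor (poset_cat T) B (id_ftor (poset_cat T)) v"
abbreviation dom_nt :: "'a scat \<Rightarrow> 'a snt \<Rightarrow> 'a snt"
  where "dom_nt B \<alpha> \<equiv> prod_nt (poset_cat S) B (id_nt (poset_cat S) (poset_cat S) (id_ftor (poset_cat S))) \<alpha>"
abbreviation cod_nt :: "'a scat \<Rightarrow> 'a snt \<Rightarrow> 'a snt"
  where "cod_nt B \<alpha> \<equiv> prod_nt (poset_cat T) B (id_nt (poset_cat T) (poset_cat T) (id_ftor (poset_cat T))) \<alpha>"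
abbreviation ext :: "'a scat \<Rightarrow> ('o, 'm, 'o, 'm) ftor" where "ext B \<equiv> lan D (dom_cat B) (cod_cat B) (par B)"
abbreviation unit :: "'a scat \<Rightarrow> 'o \<Rightarrow> 'm" where "unit B \<equiv> lan_unit D (dom_cat B) (cod_cat B) (par B)"
abbreviation dom_pull :: "'a scat \<Rightarrow> 'a scat \<Rightarrow> 'a sftor \<Rightarrow> ('o, 'm, 'o, 'm) ftor"
  where "dom_pull B C v \<equiv> D1 D (dom_cat B) (dom_cat C) (dom_ftor B v)"
abbreviation cod_pull :: "'a scat \<Rightarrow> 'a scat \<Rightarrow> 'a sftor \<Rightarrow> ('o, 'm, 'o, 'm) ftor"
  where "cod_pull B C v \<equiv> D1 D (cod_cat B) (cod_cat C) (cod_ftor B v)"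
abbreviation par_pull :: "'a scat \<Rightarrow> ('o, 'm, 'o, 'm) ftor"
  where "par_pull B \<equiv> D1 D (dom_cat B) (cod_cat B) (par B)"

text \<open>The structure map from \<open>f_! v^* X\<close> to \<open>v^* f_! X\<close> is the
  transpose of the restricted unit \<open>v^* X -> v^* f^* f_! X\<close>, whose target equals
  \<open>f^* v^* f_! X\<close> on the nose.\<close>

definition ext_mor :: "('a, 'o, 'm) dmor" where
  "ext_mor = \<lparr>mo = ext, mc = (\<lambda>B C v. \<lambda>X \<in> ob (D0 D (dom_cat C)).
     lan_adj D (dom_cat B) (cod_cat B) (par B) (fo (cod_pull B C v) (fo (ext C) X))
       (fa (dom_pull B C v) (unit C X)))\<rparr>"

lemma dom_small: "small_cat small B \<Longrightarrow> small_cat small (dom_cat B)"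
  and cod_small: "small_cat small B \<Longrightarrow> small_cat small (cod_cat B)"
  using smallness finite_S finite_T by (auto intro: prod_small_cat poset_small_cat)

lemma par_functor: "small_cat small B \<Longrightarrow> is_functor (dom_cat B) (cod_cat B) (par B)"
  by (rule par_ftor_functor[OF small_catD f_in f_mono])

lemma dom_functor: "small_cat small B \<Longrightarrow> small_cat small C \<Longrightarrow> is_functor B C v
    \<Longrightarrow> is_functor (dom_cat B) (dom_cat C) (dom_ftor B v)"
  and cod_functor: "small_cat small B \<Longrightarrow> small_cat small C \<Longrightarrow> is_functor B C v
    \<Longrightarrow> is_functor (cod_cat B) (cod_cat C) (cod_ftor B v)"
  by (auto intro!: prod_ftor_functor id_ftor_functor poset_category dest: small_catD)

lemma par_dom_eq:
  assumes B: "small_cat small B" and C: "small_cat small C" and v: "is_functor B C v"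
  shows "comp_ftor (dom_cat B) (par C) (dom_ftor B v) = comp_ftor (dom_cat B) (cod_ftor B v) (par B)"
proof -
  have c: "category (dom_cat B)" "category (cod_cat C)" using dom_small[OF B] cod_small[OF C] small_catD by auto
  have "fo v x \<in> ob C" if "x \<in> ob B" for x using functor_ob[OF v that] .
  moreover have "fa v x \<in> ar C" if "x \<in> ar B" for x using v that by (auto simp: is_functor_def)
  ultimately show ?thesis
    by (intro functor_eqI[OF comp_ftor_functor[OF c dom_functor[OF B C v] par_functor[OF C]]
          comp_ftor_functor[OF c par_functor[OF B] cod_functor[OF B C v]]])
      (auto simp: in_ob_prod_iff in_ar_prod_iff in_ob_poset_iff in_ar_poset_iff f_in f_mono subsetD[OF f_mono])
qed

lemma pull_square:
  assumes B: "small_cat small B" and C: "small_cat small C" and v: "is_functor B C v"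
  shows "Z \<in> ob (D0 D (cod_cat C)) \<Longrightarrow> fo (par_pull B) (fo (cod_pull B C v) Z) = fo (dom_pull B C v) (fo (par_pull C) Z)"
    and "m \<in> hom (D0 D (cod_cat C)) Z Z' \<Longrightarrow>
      fa (par_pull B) (fa (cod_pull B C v) m) = fa (dom_pull B C v) (fa (par_pull C) m)"
  using D1_comp_ob[OF dom_small[OF B] dom_small[OF C] cod_small[OF C] dom_functor[OF B C v] par_functor[OF C]]
    D1_comp_ob[OF dom_small[OF B] cod_small[OF B] cod_small[OF C] par_functor[OF B] cod_functor[OF B C v]]
    D1_comp_hom[OF dom_small[OF B] dom_small[OF C] cod_small[OF C] dom_functor[OF B C v] par_functor[OF C]]
    D1_comp_hom[OF dom_small[OF B] cod_small[OF B] cod_small[OF C] par_functor[OF B] cod_functor[OF B C v]]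
  unfolding par_dom_eq[OF assms] by auto

lemma ext_eqI:
  assumes B: "small_cat small B" and X: "X \<in> ob (D0 D (dom_cat B))"
    and "m \<in> hom (D0 D (cod_cat B)) (fo (ext B) X) W" "m' \<in> hom (D0 D (cod_cat B)) (fo (ext B) X) W"
    and "fa (par_pull B) m \<cdot>\<^bsub>D0 D (dom_cat B)\<^esub> unit B X = fa (par_pull B) m' \<cdot>\<^bsub>D0 D (dom_cat B)\<^esub> unit B X"
  shows "m = m'"
  using lan_eqI[OF dom_small[OF B] cod_small[OF B] par_functor[OF B] X assms(3-5)] .

lemma transpose_cmp:
  assumes B: "small_cat small B" and X: "X \<in> ob (D0 D (dom_cat B))"
    and t: "t \<in> hom (D0 D (cod_cat B)) (fo (ext B) X) W" and m: "m \<in> hom (D0 D (cod_cat B)) W W'"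
  shows "fa (par_pull B) (m \<cdot>\<^bsub>D0 D (cod_cat B)\<^esub> t) \<cdot>\<^bsub>D0 D (dom_cat B)\<^esub> unit B X
    = fa (par_pull B) m \<cdot>\<^bsub>D0 D (dom_cat B)\<^esub> (fa (par_pull B) t \<cdot>\<^bsub>D0 D (dom_cat B)\<^esub> unit B X)"
  using lan_transpose_cmp[OF dom_small[OF B] cod_small[OF B] par_functor[OF B] X t m] .

context
  fixes B C v
  assumes B: "small_cat small B" and C: "small_cat small C" and v: "is_functor B C v"
begin

text \<open>By base change the restricted unit is itself universal, so its transpose compares two
  universal arrows out of the same object.\<close>

lemma mc_ext:
  assumes X: "X \<in> ob (D0 D (dom_cat C))"
  shows "mc ext_mor B C v X \<in> hom (D0 D (cod_cat B)) (fo (ext B) (fo (dom_pull B C v) X)) (fo (cod_pull B C v) (fo (ext C) X))"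
    and "fa (par_pull B) (mc ext_mor B C v X) \<cdot>\<^bsub>D0 D (dom_cat B)\<^esub> unit B (fo (dom_pull B C v) X)
      = fa (dom_pull B C v) (unit C X)"
    and "is_iso (D0 D (cod_cat B)) (mc ext_mor B C v X)"
proof -
  note s = dom_small[OF B] cod_small[OF B] par_functor[OF B]
  have kX: "fo (dom_pull B C v) X \<in> ob (D0 D (dom_cat B))"
    using D1_ob[OF dom_small[OF B] dom_small[OF C] dom_functor[OF B C v] X] .
  note u = universal_base_change[OF finite_S finite_T B C f_in f_mono v
      lan_universal[OF dom_small[OF C] cod_small[OF C] par_functor[OF C] X]]
  note a = lan_adj[OF s kX universalD[OF u]]
  show 1: "mc ext_mor B C v X \<in> hom (D0 D (cod_cat B)) (fo (ext B) (fo (dom_pull B C v) X)) (fo (cod_pull B C v) (fo (ext C) X))"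
    "fa (par_pull B) (mc ext_mor B C v X) \<cdot>\<^bsub>D0 D (dom_cat B)\<^esub> unit B (fo (dom_pull B C v) X)
      = fa (dom_pull B C v) (unit C X)"
    using a X by (simp_all add: ext_mor_def)
  show "is_iso (D0 D (cod_cat B)) (mc ext_mor B C v X)"
    using universal_unique_iso[OF lan_universal[OF s kX] u D0_category[OF s(1)] D0_category[OF s(2)] D1_functor[OF s] 1] .
qed

text \<open>After transposition, both composites become the restriction along \<open>v\<close> of
  the naturality square of the unit at \<open>h\<close>.\<close>

lemma mc_ext_natural:
  "is_nt_iso (D0 D (dom_cat C)) (D0 D (cod_cat B)) (comp_ftor (D0 D (dom_cat C)) (ext B) (dom_pull B C v))
     (comp_ftor (D0 D (dom_cat C)) (cod_pull B C v) (ext C)) (mc ext_mor B C v)"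
proof -
  note sB = dom_small[OF B] cod_small[OF B] par_functor[OF B]
  note sC = dom_small[OF C] cod_small[OF C] par_functor[OF C]
  note kf = dom_functor[OF B C v] and wf = cod_functor[OF B C v]
  note d = D0_category[OF sB(1)] D0_category[OF sC(1)] D0_category[OF sB(2)]
  note k = D1_functor[OF sB(1) sC(1) kf] and w = D1_functor[OF sB(2) sC(2) wf]
  show ?thesis
    unfolding is_nt_iso_def
  proof (intro conjI ntI ballI)
    fix h X Y assume h: "h \<in> hom (D0 D (dom_cat C)) X Y"
    have X: "X \<in> ob (D0 D (dom_cat C))" and Y: "Y \<in> ob (D0 D (dom_cat C))" using hom_ob[OF d(2) h] .
    have kX: "fo (dom_pull B C v) X \<in> ob (D0 D (dom_cat B))" and kY: "fo (dom_pull B C v) Y \<in> ob (D0 D (dom_cat B))"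
      using D1_ob[OF sB(1) sC(1) kf] X Y by auto
    have kh: "fa (dom_pull B C v) h \<in> hom (D0 D (dom_cat B)) (fo (dom_pull B C v) X) (fo (dom_pull B C v) Y)"
      using D1_hom[OF sB(1) sC(1) kf h] .
    have ekh: "fa (ext B) (fa (dom_pull B C v) h)
        \<in> hom (D0 D (cod_cat B)) (fo (ext B) (fo (dom_pull B C v) X)) (fo (ext B) (fo (dom_pull B C v) Y))"
      using functor_hom[OF lan_functor[OF sB] kh] .
    have eh: "fa (ext C) h \<in> hom (D0 D (cod_cat C)) (fo (ext C) X) (fo (ext C) Y)"
      using functor_hom[OF lan_functor[OF sC] h] .
    have weh: "fa (cod_pull B C v) (fa (ext C) h)
       \<in> hom (D0 D (cod_cat B)) (fo (cod_pull B C v) (fo (ext C) X)) (fo (cod_pull B C v) (fo (ext C) Y))"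
      using D1_hom[OF sB(2) sC(2) wf eh] .
    have pmY: "fa (par_pull B) (mc ext_mor B C v Y) \<in> hom (D0 D (dom_cat B))
        (fo (par_pull B) (fo (ext B) (fo (dom_pull B C v) Y))) (fo (par_pull B) (fo (cod_pull B C v) (fo (ext C) Y)))"
      using D1_hom[OF sB mc_ext(1)[OF Y]] .
    have uX: "unit C X \<in> hom (D0 D (dom_cat C)) X (fo (par_pull C) (fo (ext C) X))"
      using lan_unit_hom[OF sC X] .
    have eq: "mc ext_mor B C v Y \<cdot>\<^bsub>D0 D (cod_cat B)\<^esub> fa (ext B) (fa (dom_pull B C v) h)
      = fa (cod_pull B C v) (fa (ext C) h) \<cdot>\<^bsub>D0 D (cod_cat B)\<^esub> mc ext_mor B C v X"
    proof (rule ext_eqI[OF B kX])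
      show "mc ext_mor B C v Y \<cdot>\<^bsub>D0 D (cod_cat B)\<^esub> fa (ext B) (fa (dom_pull B C v) h)
          \<in> hom (D0 D (cod_cat B)) (fo (ext B) (fo (dom_pull B C v) X)) (fo (cod_pull B C v) (fo (ext C) Y))"
        using cmp_hom[OF d(3) ekh mc_ext(1)[OF Y]] .
      show "fa (cod_pull B C v) (fa (ext C) h) \<cdot>\<^bsub>D0 D (cod_cat B)\<^esub> mc ext_mor B C v X
          \<in> hom (D0 D (cod_cat B)) (fo (ext B) (fo (dom_pull B C v) X)) (fo (cod_pull B C v) (fo (ext C) Y))"
        using cmp_hom[OF d(3) mc_ext(1)[OF X] weh] .
      have "fa (par_pull B) (mc ext_mor B C v Y \<cdot>\<^bsub>D0 D (cod_cat B)\<^esub> fa (ext B) (fa (dom_pull B C v) h)) \<cdot>\<^bsub>D0 D (dom_cat B)\<^esub>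
          unit B (fo (dom_pull B C v) X)
        = fa (par_pull B) (mc ext_mor B C v Y) \<cdot>\<^bsub>D0 D (dom_cat B)\<^esub>
          (unit B (fo (dom_pull B C v) Y) \<cdot>\<^bsub>D0 D (dom_cat B)\<^esub> fa (dom_pull B C v) h)"
        using transpose_cmp[OF B kX ekh mc_ext(1)[OF Y]] lan_unit_natural[OF sB kh] by simp
      also have "\<dots> = fa (dom_pull B C v) (unit C Y) \<cdot>\<^bsub>D0 D (dom_cat B)\<^esub> fa (dom_pull B C v) h"
        using cmp_assoc[OF d(1) kh lan_unit_hom[OF sB kY] pmY] mc_ext(2)[OF Y] by simp
      also have "\<dots> = fa (dom_pull B C v) (fa (par_pull C) (fa (ext C) h) \<cdot>\<^bsub>D0 D (dom_cat C)\<^esub> unit C X)"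
        using functor_cmp[OF k h lan_unit_hom[OF sC Y]] lan_unit_natural[OF sC h] by simp
      also have "\<dots> = fa (par_pull B) (fa (cod_pull B C v) (fa (ext C) h)) \<cdot>\<^bsub>D0 D (dom_cat B)\<^esub> fa (dom_pull B C v) (unit C X)"
        using functor_cmp[OF k uX D1_hom[OF sC eh]] pull_square(2)[OF B C v eh] by simp
      also have "\<dots> = fa (par_pull B) (fa (cod_pull B C v) (fa (ext C) h) \<cdot>\<^bsub>D0 D (cod_cat B)\<^esub> mc ext_mor B C v X)
          \<cdot>\<^bsub>D0 D (dom_cat B)\<^esub> unit B (fo (dom_pull B C v) X)"
        using transpose_cmp[OF B kX mc_ext(1)[OF X] weh] mc_ext(2)[OF X] by simp
      finally show "fa (par_pull B) (mc ext_mor B C v Y \<cdot>\<^bsub>D0 D (cod_cat B)\<^esub> fa (ext B) (fa (dom_pull B C v) h)) \<cdot>\<^bsub>D0 D (dom_cat B)\<^esub>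
          unit B (fo (dom_pull B C v) X) = \<dots>" .
    qed
    then show "mc ext_mor B C v Y \<cdot>\<^bsub>D0 D (cod_cat B)\<^esub> fa (comp_ftor (D0 D (dom_cat C)) (ext B) (dom_pull B C v)) h
      = fa (comp_ftor (D0 D (dom_cat C)) (cod_pull B C v) (ext C)) h \<cdot>\<^bsub>D0 D (cod_cat B)\<^esub> mc ext_mor B C v X"
      by (simp add: comp_ftor_hom_simp[OF h])
  qed (use mc_ext d k w comp_ftor_functor[OF d(2,3) k lan_functor[OF sB]]
      comp_ftor_functor[OF d(2,3) lan_functor[OF sC] w] in \<open>auto simp: ext_mor_def\<close>)
qed

end

lemma mc_ext_id:
  assumes B: "small_cat small B"
  shows "mc ext_mor B B (id_ftor B) = id_nt (D0 D (dom_cat B)) (D0 D (cod_cat B)) (ext B)"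
proof (rule nt_eqI[of _ "D0 D (dom_cat B)"])
  note s = dom_small[OF B] cod_small[OF B] par_functor[OF B]
  have c: "category B" using B by (rule small_catD)
  have i: "is_functor B B (id_ftor B)" using c by (rule id_ftor_functor)
  have 1: "dom_ftor B (id_ftor B) = id_ftor (dom_cat B)" "cod_ftor B (id_ftor B) = id_ftor (cod_cat B)"
    by (rule functor_eqI[OF dom_functor[OF B B i] id_ftor_functor[OF small_catD[OF s(1)]]],
        auto simp: in_ob_prod_iff in_ar_prod_iff)
      (rule functor_eqI[OF cod_functor[OF B B i] id_ftor_functor[OF small_catD[OF s(2)]]],
        auto simp: in_ob_prod_iff in_ar_prod_iff)
  fix X assume X: "X \<in> ob (D0 D (dom_cat B))"
  have e: "fo (ext B) X \<in> ob (D0 D (cod_cat B))" using lan_ob[OF s X] .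
  have u: "unit B X \<in> hom (D0 D (dom_cat B)) X (fo (par_pull B) (fo (ext B) X))" using lan_unit_hom[OF s X] .
  have "mc ext_mor B B (id_ftor B) X = idt (D0 D (cod_cat B)) (fo (ext B) X)"
  proof (rule ext_eqI[OF B X])
    show "mc ext_mor B B (id_ftor B) X \<in> hom (D0 D (cod_cat B)) (fo (ext B) X) (fo (ext B) X)"
      using mc_ext(1)[OF B B i X] e X unfolding 1 by (simp add: D1_id[OF s(1)] D1_id[OF s(2)])
    show "idt (D0 D (cod_cat B)) (fo (ext B) X) \<in> hom (D0 D (cod_cat B)) (fo (ext B) X) (fo (ext B) X)"
      using D0_category[OF s(2)] e by (rule idt_hom)
    show "fa (par_pull B) (mc ext_mor B B (id_ftor B) X) \<cdot>\<^bsub>D0 D (dom_cat B)\<^esub> unit B X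
      = fa (par_pull B) (idt (D0 D (cod_cat B)) (fo (ext B) X)) \<cdot>\<^bsub>D0 D (dom_cat B)\<^esub> unit B X"
      using mc_ext(2)[OF B B i X] X idt_left[OF D0_category[OF s(1)] u] functor_idt[OF D1_functor[OF s] e] homD(1)[OF u]
      unfolding 1 by (simp add: D1_id[OF s(1)])
  qed
  then show "mc ext_mor B B (id_ftor B) X = id_nt (D0 D (dom_cat B)) (D0 D (cod_cat B)) (ext B) X"
    using X by (simp add: id_nt_def)
qed (auto simp: ext_mor_def id_nt_def)

text \<open>Both sides transpose to the unit at \<open>X\<close> restricted along the composite of
  \<open>u\<close> and \<open>v\<close>.\<close>

lemma mc_ext_comp:
  assumes A: "small_cat small A" and B: "small_cat small B" and C: "small_cat small C"
    and u: "is_functor A B u" and v: "is_functor B C v" and X: "X \<in> ob (D0 D (dom_cat C))"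
  shows "mc ext_mor A C (comp_ftor A v u) X =
    fa (cod_pull A B u) (mc ext_mor B C v X) \<cdot>\<^bsub>D0 D (cod_cat A)\<^esub> mc ext_mor A B u (fo (dom_pull B C v) X)"
proof -
  note sA = dom_small[OF A] cod_small[OF A] par_functor[OF A]
  note sB = dom_small[OF B] cod_small[OF B] par_functor[OF B]
  note sC = dom_small[OF C] cod_small[OF C] par_functor[OF C]
  note ku = dom_functor[OF A B u] and kv = dom_functor[OF B C v] and wu = cod_functor[OF A B u] and wv = cod_functor[OF B C v]
  have c: "category A" "category B" "category C" using A B C by (auto dest: small_catD)
  have vu: "is_functor A C (comp_ftor A v u)" using comp_ftor_functor[OF c(1,3) u v] .
  have ob: "fo u x \<in> ob B" if "x \<in> ob A" for x using functor_ob[OF u that] .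
  have ar: "fa u x \<in> ar B" if "x \<in> ar A" for x using u that by (auto simp: is_functor_def)
  have 1: "dom_ftor A (comp_ftor A v u) = comp_ftor (dom_cat A) (dom_ftor B v) (dom_ftor A u)"
    by (rule functor_eqI[OF dom_functor[OF A C vu] comp_ftor_functor[OF small_catD[OF sA(1)] small_catD[OF sC(1)] ku kv]])
      (auto simp: in_ob_prod_iff in_ar_prod_iff ob ar)
  have 2: "cod_ftor A (comp_ftor A v u) = comp_ftor (cod_cat A) (cod_ftor B v) (cod_ftor A u)"
    by (rule functor_eqI[OF cod_functor[OF A C vu] comp_ftor_functor[OF small_catD[OF sA(2)] small_catD[OF sC(2)] wu wv]])
      (auto simp: in_ob_prod_iff in_ar_prod_iff ob ar)
  let ?kX = "fo (dom_pull B C v) X"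
  have kX: "?kX \<in> ob (D0 D (dom_cat B))" using D1_ob[OF sB(1) sC(1) kv X] .
  have kkX: "fo (dom_pull A C (comp_ftor A v u)) X = fo (dom_pull A B u) ?kX"
    unfolding 1 using D1_comp_ob[OF sA(1) sB(1) sC(1) ku kv X] .
  have kkX': "fo (dom_pull A C (comp_ftor A v u)) X \<in> ob (D0 D (dom_cat A))"
    unfolding kkX using D1_ob[OF sA(1) sB(1) ku kX] .
  have eX: "fo (ext C) X \<in> ob (D0 D (cod_cat C))" using lan_ob[OF sC X] .
  note m1 = mc_ext[OF A B u kX] and m2 = mc_ext[OF B C v X] and m3 = mc_ext[OF A C vu X]
  have wm: "fa (cod_pull A B u) (mc ext_mor B C v X) \<in> hom (D0 D (cod_cat A))
      (fo (cod_pull A B u) (fo (ext B) ?kX)) (fo (cod_pull A C (comp_ftor A v u)) (fo (ext C) X))"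
    unfolding 2 D1_comp_ob[OF sA(2) sB(2) sC(2) wu wv eX] using D1_hom[OF sA(2) sB(2) wu m2(1)] .
  have pm: "fa (par_pull B) (mc ext_mor B C v X) \<in> hom (D0 D (dom_cat B))
      (fo (par_pull B) (fo (ext B) ?kX)) (fo (par_pull B) (fo (cod_pull B C v) (fo (ext C) X)))"
    using D1_hom[OF sB m2(1)] .
  show ?thesis
  proof (rule ext_eqI[OF A kkX'])
    show "mc ext_mor A C (comp_ftor A v u) X \<in> hom (D0 D (cod_cat A)) (fo (ext A) (fo (dom_pull A C (comp_ftor A v u)) X))
        (fo (cod_pull A C (comp_ftor A v u)) (fo (ext C) X))" by (rule m3(1))
    show "fa (cod_pull A B u) (mc ext_mor B C v X) \<cdot>\<^bsub>D0 D (cod_cat A)\<^esub> mc ext_mor A B u ?kX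
      \<in> hom (D0 D (cod_cat A)) (fo (ext A) (fo (dom_pull A C (comp_ftor A v u)) X))
        (fo (cod_pull A C (comp_ftor A v u)) (fo (ext C) X))"
      unfolding kkX using cmp_hom[OF D0_category[OF sA(2)] m1(1) wm] .
    have "fa (par_pull A) (fa (cod_pull A B u) (mc ext_mor B C v X) \<cdot>\<^bsub>D0 D (cod_cat A)\<^esub> mc ext_mor A B u ?kX) \<cdot>\<^bsub>D0 D (dom_cat A)\<^esub>
        unit A (fo (dom_pull A B u) ?kX)
      = fa (dom_pull A B u) (fa (par_pull B) (mc ext_mor B C v X)) \<cdot>\<^bsub>D0 D (dom_cat A)\<^esub> fa (dom_pull A B u) (unit B ?kX)"
      using transpose_cmp[OF A kkX'[unfolded kkX] m1(1) wm] m1(2) pull_square(2)[OF A B u m2(1)] by simp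
    also have "\<dots> = fa (dom_pull A B u) (fa (dom_pull B C v) (unit C X))"
      using functor_cmp[OF D1_functor[OF sA(1) sB(1) ku] lan_unit_hom[OF sB kX] pm] m2(2) by simp
    also have "\<dots> = fa (dom_pull A C (comp_ftor A v u)) (unit C X)"
      unfolding 1 using D1_comp_hom[OF sA(1) sB(1) sC(1) ku kv lan_unit_hom[OF sC X]] by simp
    finally show "fa (par_pull A) (mc ext_mor A C (comp_ftor A v u) X) \<cdot>\<^bsub>D0 D (dom_cat A)\<^esub>
        unit A (fo (dom_pull A C (comp_ftor A v u)) X)
      = fa (par_pull A) (fa (cod_pull A B u) (mc ext_mor B C v X) \<cdot>\<^bsub>D0 D (cod_cat A)\<^esub> mc ext_mor A B u ?kX) \<cdot>\<^bsub>D0 D (dom_cat A)\<^esub>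
        unit A (fo (dom_pull A C (comp_ftor A v u)) X)"
      using m3(2) unfolding kkX by simp
  qed
qed

text \<open>Both sides transpose to composites that agree by naturality of \<open>\<alpha>^*\<close>
  at the unit. This requires identifying the 2-cells induced by \<open>\<alpha>\<close> over
  \<open>S\<close> and over \<open>T\<close> after whiskering with \<open>f\<close>; they agree
  because \<open>f\<close> leaves the parameter alone.\<close>

lemma mc_ext_nt:
  assumes B: "small_cat small B" and C: "small_cat small C" and \<alpha>: "is_nt B C u v \<alpha>"
    and X: "X \<in> ob (D0 D (dom_cat C))"
  shows "mc ext_mor B C v X \<cdot>\<^bsub>D0 D (cod_cat B)\<^esub>
      fa (ext B) (D2 D (dom_cat B) (dom_cat C) (dom_ftor B u) (dom_ftor B v) (dom_nt B \<alpha>) X)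
    = D2 D (cod_cat B) (cod_cat C) (cod_ftor B u) (cod_ftor B v) (cod_nt B \<alpha>) (fo (ext C) X)
      \<cdot>\<^bsub>D0 D (cod_cat B)\<^esub> mc ext_mor B C u X"
proof -
  note sB = dom_small[OF B] cod_small[OF B] par_functor[OF B]
  note sC = dom_small[OF C] cod_small[OF C] par_functor[OF C]
  have c: "category B" "category C" using B C by (auto dest: small_catD)
  have u: "is_functor B C u" and v: "is_functor B C v" using ntD[OF \<alpha>] by auto
  note ku = dom_functor[OF B C u] and kv = dom_functor[OF B C v] and wu = cod_functor[OF B C u] and wv = cod_functor[OF B C v]
  let ?a = "D2 D (dom_cat B) (dom_cat C) (dom_ftor B u) (dom_ftor B v) (dom_nt B \<alpha>)"
  let ?b = "D2 D (cod_cat B) (cod_cat C) (cod_ftor B u) (cod_ftor B v) (cod_nt B \<alpha>)"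
  have nS: "is_nt (dom_cat B) (dom_cat C) (dom_ftor B u) (dom_ftor B v) (dom_nt B \<alpha>)"
    and nT: "is_nt (cod_cat B) (cod_cat C) (cod_ftor B u) (cod_ftor B v) (cod_nt B \<alpha>)"
    using c \<alpha> by (auto intro!: prod_nt_nt id_nt_nt id_ftor_functor poset_category)
  have aob: "\<alpha> x \<in> ar C" if "x \<in> ob B" for x using ntD(3)[OF \<alpha> that] by (rule homD)
  have w: "post_whisker (dom_cat B) (par C) (dom_nt B \<alpha>) = pre_whisker (dom_cat B) (cod_nt B \<alpha>) (par B)"
    by (auto simp: post_whisker_def pre_whisker_def prod_nt_def id_nt_def in_ob_prod_iff in_ob_poset_iff f_in aob
        intro!: restrict_ext)
  let ?Z = "fo (ext C) X"
  have Z: "?Z \<in> ob (D0 D (cod_cat C))" using lan_ob[OF sC X] .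
  have aX: "?a X \<in> hom (D0 D (dom_cat B)) (fo (dom_pull B C u) X) (fo (dom_pull B C v) X)"
    using D2_hom[OF sB(1) sC(1) nS X] .
  have bZ: "?b ?Z \<in> hom (D0 D (cod_cat B)) (fo (cod_pull B C u) ?Z) (fo (cod_pull B C v) ?Z)"
    using D2_hom[OF sB(2) sC(2) nT Z] .
  have kuX: "fo (dom_pull B C u) X \<in> ob (D0 D (dom_cat B))" and kvX: "fo (dom_pull B C v) X \<in> ob (D0 D (dom_cat B))"
    using D1_ob[OF sB(1) sC(1) ku X] D1_ob[OF sB(1) sC(1) kv X] by auto
  note mu = mc_ext[OF B C u X] and mv = mc_ext[OF B C v X]
  have ea: "fa (ext B) (?a X) \<in> hom (D0 D (cod_cat B)) (fo (ext B) (fo (dom_pull B C u) X)) (fo (ext B) (fo (dom_pull B C v) X))"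
    using functor_hom[OF lan_functor[OF sB] aX] .
  show ?thesis
  proof (rule ext_eqI[OF B kuX cmp_hom[OF D0_category[OF sB(2)] ea mv(1)] cmp_hom[OF D0_category[OF sB(2)] mu(1) bZ]])
    have "fa (par_pull B) (mc ext_mor B C v X \<cdot>\<^bsub>D0 D (cod_cat B)\<^esub> fa (ext B) (?a X)) \<cdot>\<^bsub>D0 D (dom_cat B)\<^esub> unit B (fo (dom_pull B C u) X)
      = fa (par_pull B) (mc ext_mor B C v X) \<cdot>\<^bsub>D0 D (dom_cat B)\<^esub> (unit B (fo (dom_pull B C v) X) \<cdot>\<^bsub>D0 D (dom_cat B)\<^esub> ?a X)"
      using transpose_cmp[OF B kuX ea mv(1)] lan_unit_natural[OF sB aX] by simp
    also have "\<dots> = fa (dom_pull B C v) (unit C X) \<cdot>\<^bsub>D0 D (dom_cat B)\<^esub> ?a X"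
      using cmp_assoc[OF D0_category[OF sB(1)] aX lan_unit_hom[OF sB kvX] D1_hom[OF sB mv(1)]] mv(2) by simp
    also have "\<dots> = ?a (fo (par_pull C) ?Z) \<cdot>\<^bsub>D0 D (dom_cat B)\<^esub> fa (dom_pull B C u) (unit C X)"
      using D2_natural[OF sB(1) sC(1) nS lan_unit_hom[OF sC X]] by simp
    also have "?a (fo (par_pull C) ?Z) = fa (par_pull B) (?b ?Z)"
      using D2_post_whisker[OF sB(1) sC(1,2) nS sC(3) Z] D2_pre_whisker[OF sB(1,2) sC(2) sB(3) nT Z]
      unfolding w par_dom_eq[OF B C u] par_dom_eq[OF B C v] by simp
    also have "fa (par_pull B) (?b ?Z) \<cdot>\<^bsub>D0 D (dom_cat B)\<^esub> fa (dom_pull B C u) (unit C X)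
      = fa (par_pull B) (?b ?Z \<cdot>\<^bsub>D0 D (cod_cat B)\<^esub> mc ext_mor B C u X) \<cdot>\<^bsub>D0 D (dom_cat B)\<^esub> unit B (fo (dom_pull B C u) X)"
      using transpose_cmp[OF B kuX mu(1) bZ] mu(2) by simp
    finally show "fa (par_pull B) (mc ext_mor B C v X \<cdot>\<^bsub>D0 D (cod_cat B)\<^esub> fa (ext B) (?a X)) \<cdot>\<^bsub>D0 D (dom_cat B)\<^esub>
        unit B (fo (dom_pull B C u) X) = \<dots>" .
  qed
qed

theorem ext_morphism: "morphism small (shift D (poset_cat S)) (shift D (poset_cat T)) ext_mor"
proof -
  have mo: "mo ext_mor B = ext B" for B by (simp add: ext_mor_def)
  have "is_functor (D0 D (dom_cat B)) (D0 D (cod_cat B)) (ext B)" if "small_cat small B" for B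
    using lan_functor[OF dom_small[OF that] cod_small[OF that] par_functor[OF that]] .
  then show ?thesis
    unfolding morphism_def
    by (auto simp: shift_def mo mc_ext_natural mc_ext_id mc_ext_comp mc_ext_nt)
qed

end

section \<open>Underlying diagrams\<close>

definition mono_nt :: "nat set set \<Rightarrow> 'a scat \<Rightarrow> (nat set \<Rightarrow> nat set) \<Rightarrow> (nat set \<Rightarrow> nat set) \<Rightarrow> 'a snt" where
  "mono_nt R B g g' = (\<lambda>p \<in> ob (par_cat R B).
     Pair (Pair (vertex_map g (pfst p)) (vertex_map g' (pfst p))) (idt B (psnd p)))"

lemma mono_nt_nt:
  assumes B: "category B"
    and g: "\<And>q. q \<in> R \<Longrightarrow> g q \<in> S" "\<And>q q'. q \<in> R \<Longrightarrow> q' \<in> R \<Longrightarrow> q \<subseteq> q' \<Longrightarrow> g q \<subseteq> g q'"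
    and g': "\<And>q. q \<in> R \<Longrightarrow> g' q \<in> S" "\<And>q q'. q \<in> R \<Longrightarrow> q' \<in> R \<Longrightarrow> q \<subseteq> q' \<Longrightarrow> g' q \<subseteq> g' q'"
    and le: "\<And>q. q \<in> R \<Longrightarrow> g q \<subseteq> g' q"
  shows "is_nt (par_cat R B) (par_cat S B) (par_ftor R B g) (par_ftor R B g') (mono_nt R B g g')"
proof (rule ntI)
  show "is_functor (par_cat R B) (par_cat S B) (par_ftor R B g)" using B g by (rule par_ftor_functor)
  show "is_functor (par_cat R B) (par_cat S B) (par_ftor R B g')" using B g' by (rule par_ftor_functor)
qed (use B g(1) g'(1) subsetD[OF le] in \<open>auto simp: prod_category poset_category mono_nt_def in_ob_prod_iff in_ob_poset_iff
    in_hom_prod_iff in_hom_poset_iff Pair_hom_prod idt_hom homD(1) hom_ob idt_left idt_right\<close>)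

text \<open>The constant diagram on the value at \<open>p\<close> is a restriction along a constant
  monotone map. So the relations that define \<open>top_map\<close> become a 2-cell between monotone
  maps.\<close>

lemma slice_proj2:
  assumes "category B" "p \<in> S"
  shows "comp_ftor (par_cat R B) (par_slice S B p) (par_proj R B) = par_ftor R B (\<lambda>_. p)"
  by (rule functor_eqI[OF comp_ftor_functor[OF _ _ proj2_functor slice_at_functor] par_ftor_functor[of B R "\<lambda>_. p" S]])
    (use assms in \<open>auto simp: prod_category poset_category in_ob_prod_iff in_ar_prod_iff in_ob_poset_iff in_ar_poset_iff\<close>)

lemma proj2_slice:
  assumes "category A" "category B" "a \<in> ob A"
  shows "comp_ftor B (proj2 A B) (slice_at A B a) = id_ftor B"
  by (rule functor_eqI[OF comp_ftor_functor[OF _ _ slice_at_functor proj2_functor] id_ftor_functor])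
    (use assms in \<open>auto simp: idt_ar\<close>)

lemma proj2_par_ftor:
  assumes B: "category B"
    and g: "\<And>q. q \<in> R \<Longrightarrow> g q \<in> S" "\<And>q q'. q \<in> R \<Longrightarrow> q' \<in> R \<Longrightarrow> q \<subseteq> q' \<Longrightarrow> g q \<subseteq> g q'"
  shows "comp_ftor (par_cat R B) (par_proj S B) (par_ftor R B g) = par_proj R B"
  by (rule functor_eqI[OF comp_ftor_functor[OF _ _ par_ftor_functor[OF B g] proj2_functor] proj2_functor])
    (auto simp: B g prod_category poset_category in_ob_prod_iff in_ar_prod_iff in_ob_poset_iff in_ar_poset_iff)

text \<open>Slicing turns arrows of \<open>A\<close> into 2-cells compatibly with identities and
  composition, so the laws of the diagram are laws of \<open>D2\<close>.\<close>

lemma underlying_functor: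
  assumes "derivator_on small D" and A: "small_cat small A" and B: "small_cat small B"
    and Z: "Z \<in> ob (D0 D (A \<times>\<^sub>c B))"
  shows "is_functor A (D0 D B) (underlying D A B Z)"
proof -
  interpret derivator_on small D by fact
  have AB: "small_cat small (A \<times>\<^sub>c B)" using smallness A B by (rule prod_small_cat)
  have c: "category A" "category B" "category (A \<times>\<^sub>c B)" using A B AB by (auto dest: small_catD)
  have sl: "is_functor B (A \<times>\<^sub>c B) (slice_at A B a)" if "a \<in> ob A" for a
    using c that by (simp add: slice_at_functor)
  show ?thesis
    unfolding underlying_def
  proof (rule mk_ftor_functor)
    show "fo (at D A B a) Z \<in> ob (D0 D B)" if "a \<in> ob A" for a
      unfolding at_def using D1_ob[OF B AB sl[OF that] Z] .
    show "D2 D B (A \<times>\<^sub>c B) (slice_at A B (src A e)) (slice_at A B (tgt A e)) (slice_nt B e) Z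
        \<in> hom (D0 D B) (fo (at D A B x) Z) (fo (at D A B y) Z)" if "e \<in> hom A x y" for e x y
      unfolding at_def homD(2,3)[OF that] using D2_hom[OF B AB slice_nt_nt[OF c(1,2) that] Z] .
    show "D2 D B (A \<times>\<^sub>c B) (slice_at A B (src A (idt A a))) (slice_at A B (tgt A (idt A a))) (slice_nt B (idt A a)) Z
        = idt (D0 D B) (fo (at D A B a) Z)" if a: "a \<in> ob A" for a
    proof -
      have "slice_nt B (idt A a) = id_nt B (A \<times>\<^sub>c B) (slice_at A B a)"
        by (auto simp: slice_nt_def id_nt_def)
      then show ?thesis
        using D2_id[OF B AB sl[OF a] Z] homD[OF idt_hom[OF c(1) a]] by (simp add: at_def)
    qed
    show "D2 D B (A \<times>\<^sub>c B) (slice_at A B (src A (e' \<cdot>\<^bsub>A\<^esub> e))) (slice_at A B (tgt A (e' \<cdot>\<^bsub>A\<^esub> e))) (slice_nt B (e' \<cdot>\<^bsub>A\<^esub> e)) Z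
        = D2 D B (A \<times>\<^sub>c B) (slice_at A B (src A e')) (slice_at A B (tgt A e')) (slice_nt B e') Z \<cdot>\<^bsub>D0 D B\<^esub>
          D2 D B (A \<times>\<^sub>c B) (slice_at A B (src A e)) (slice_at A B (tgt A e)) (slice_nt B e) Z"
      if e: "e \<in> hom A x y" and e': "e' \<in> hom A y z" for e e' x y z
    proof -
      have "slice_nt B (e' \<cdot>\<^bsub>A\<^esub> e) = vcomp B (A \<times>\<^sub>c B) (slice_nt B e') (slice_nt B e)"
        using c idt_left[OF c(2) idt_hom[OF c(2)]] by (auto simp: slice_nt_def vcomp_def intro!: restrict_ext)
      then show ?thesis
        using D2_vcomp[OF B AB slice_nt_nt[OF c(1,2) e] slice_nt_nt[OF c(1,2) e'] Z]
          homD[OF e] homD[OF e'] homD[OF cmp_hom[OF c(1) e e']] by simp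
    qed
  qed (use c D0_category B in auto)
qed

section \<open>Maps induced on fibres\<close>

context monotone_extension
begin

text \<open>The map \<open>g\<^sup>* X \<rightarrow> pr\<^sup>* (Z\<^sub>c)\<close> induced by \<open>\<eta> : X \<rightarrow> f\<^sup>* Z\<close> and the relations \<open>f (g q) \<subseteq> c\<close>.\<close>

definition fibre_map :: "nat set set \<Rightarrow> 'a scat \<Rightarrow> (nat set \<Rightarrow> nat set) \<Rightarrow> nat set \<Rightarrow> 'o \<Rightarrow> 'm \<Rightarrow> 'm" where
  "fibre_map R B g c Z \<eta> = transport (par_cat R B) (dom_cat B) (cod_cat B) (par B) (par_ftor R B g)
      (comp_ftor (par_cat R B) (par_slice T B c) (par_proj R B))
      (fibre_nt R B (\<lambda>q. f (g q)) c) Z \<eta>"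

abbreviation edge :: "'a scat \<Rightarrow> nat set \<Rightarrow> nat set \<Rightarrow> 'o \<Rightarrow> 'm" where
  "edge B c c' \<equiv> D2 D B (cod_cat B) (par_slice T B c) (slice_at (poset_cat T) B (Vertex c'))
     (slice_nt B (Pair (Vertex c) (Vertex c')))"

abbreviation dom_slice :: "'a scat \<Rightarrow> nat set \<Rightarrow> 'a sftor" where
  "dom_slice B p \<equiv> par_slice S B p"
abbreviation cod_slice :: "'a scat \<Rightarrow> nat set \<Rightarrow> 'a sftor" where
  "cod_slice B c \<equiv> par_slice T B c"

lemma edge_nt:
  "small_cat small B \<Longrightarrow> c \<in> T \<Longrightarrow> c' \<in> T \<Longrightarrow> c \<subseteq> c' \<Longrightarrow>
    is_nt B (cod_cat B) (cod_slice B c) (cod_slice B c') (slice_nt B (Pair (Vertex c) (Vertex c')))"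
  by (rule slice_nt_nt) (auto simp: poset_category dest: small_catD)

lemma dom_slice_functor: "small_cat small B \<Longrightarrow> p \<in> S \<Longrightarrow> is_functor B (dom_cat B) (dom_slice B p)"
  and cod_slice_functor: "small_cat small B \<Longrightarrow> c \<in> T \<Longrightarrow> is_functor B (cod_cat B) (cod_slice B c)"
  by (auto intro!: slice_at_functor simp: poset_category dest: small_catD)

context
  fixes B X Z \<eta>
  assumes B: "small_cat small B"
    and Z: "Z \<in> ob (D0 D (cod_cat B))" and \<eta>: "\<eta> \<in> hom (D0 D (dom_cat B)) X (fo (par_pull B) Z)"
begin

lemma category_B: "category B"
  using B by (rule small_catD)

context
  fixes R :: "nat set set" and g :: "nat set \<Rightarrow> nat set"
  assumes R: "finite R"
    and g_in: "\<And>q. q \<in> R \<Longrightarrow> g q \<in> S" and g_mono: "\<And>q q'. q \<in> R \<Longrightarrow> q' \<in> R \<Longrightarrow> q \<subseteq> q' \<Longrightarrow> g q \<subseteq> g q'"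
begin

lemma R_small: "small_cat small (par_cat R B)"
  using smallness R B by (simp add: prod_small_cat poset_small_cat)

lemma R_ftor: "is_functor (par_cat R B) (dom_cat B) (par_ftor R B g)"
  using category_B g_in g_mono by (rule par_ftor_functor)

lemma R_proj: "is_functor (par_cat R B) B (par_proj R B)"
  using category_B by (simp add: proj2_functor poset_category)

lemma R_par: "comp_ftor (par_cat R B) (par B) (par_ftor R B g) = par_ftor R B (\<lambda>q. f (g q))"
  using category_B g_in g_mono f_in f_mono by (rule par_ftor_comp)

lemma R_nt:
  assumes c: "c \<in> T" and le: "\<And>q. q \<in> R \<Longrightarrow> f (g q) \<subseteq> c"
  shows "is_nt (par_cat R B) (cod_cat B) (comp_ftor (par_cat R B) (par B) (par_ftor R B g))
    (comp_ftor (par_cat R B) (cod_slice B c) (par_proj R B)) (fibre_nt R B (\<lambda>q. f (g q)) c)"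
  unfolding R_par by (rule fibre_nt_nt[OF category_B _ c]) (simp_all add: f_in f_mono g_in g_mono le)

text \<open>Enlarging the corner: \<open>f (g q) \<subseteq> c\<close> followed by
  \<open>c \<subseteq> c'\<close> is the only relation from \<open>f (g q)\<close> to
  \<open>c'\<close>, so pasting the edge merely changes the index.\<close>

lemma fibre_map_edge:
  assumes c: "c \<in> T" "c' \<in> T" "c \<subseteq> c'" and le: "\<And>q. q \<in> R \<Longrightarrow> f (g q) \<subseteq> c"
  shows "fa (D1 D (par_cat R B) B (par_proj R B)) (edge B c c' Z) \<cdot>\<^bsub>D0 D (par_cat R B)\<^esub> fibre_map R B g c Z \<eta>
    = fibre_map R B g c' Z \<eta>"
proof -
  note n = edge_nt[OF B c]
  have w: "is_nt (par_cat R B) (cod_cat B)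
      (comp_ftor (par_cat R B) (cod_slice B c) (par_proj R B))
      (comp_ftor (par_cat R B) (cod_slice B c') (par_proj R B))
      (pre_whisker (par_cat R B) (slice_nt B (Pair (Vertex c) (Vertex c'))) (par_proj R B))"
    using small_catD[OF R_small] category_B small_catD[OF cod_small[OF B]] R_proj n by (rule pre_whisker_nt)
  have "vcomp (par_cat R B) (cod_cat B)
      (pre_whisker (par_cat R B) (slice_nt B (Pair (Vertex c) (Vertex c'))) (par_proj R B))
      (fibre_nt R B (\<lambda>q. f (g q)) c) = fibre_nt R B (\<lambda>q. f (g q)) c'"
    using idt_left[OF category_B idt_hom[OF category_B]]
    by (auto simp: vcomp_def pre_whisker_def fibre_nt_def slice_nt_def in_ob_prod_iff in_ob_poset_iff intro!: restrict_ext)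
  then show ?thesis
    using transport_post_nt[OF R_small dom_small[OF B] cod_small[OF B] par_functor[OF B] R_ftor R_nt[OF c(1) le] Z \<eta> w]
      D2_pre_whisker[OF R_small B cod_small[OF B] R_proj n Z]
    by (simp add: fibre_map_def)
qed

text \<open>Lowering the embedding, again by uniqueness of relations: the image under
  \<open>f\<close> of \<open>g' q \<subseteq> g q\<close>, followed by
  \<open>f (g q) \<subseteq> c\<close>, is the relation that defines the map for
  \<open>g'\<close>.\<close>

lemma fibre_map_mono:
  assumes c: "c \<in> T" and le: "\<And>q. q \<in> R \<Longrightarrow> f (g q) \<subseteq> c"
    and g': "\<And>q. q \<in> R \<Longrightarrow> g' q \<in> S" "\<And>q q'. q \<in> R \<Longrightarrow> q' \<in> R \<Longrightarrow> q \<subseteq> q' \<Longrightarrow> g' q \<subseteq> g' q'"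
    and g'_le: "\<And>q. q \<in> R \<Longrightarrow> g' q \<subseteq> g q"
  shows "fibre_map R B g c Z \<eta> \<cdot>\<^bsub>D0 D (par_cat R B)\<^esub>
      D2 D (par_cat R B) (dom_cat B) (par_ftor R B g') (par_ftor R B g) (mono_nt R B g' g) X
    = fibre_map R B g' c Z \<eta>"
proof -
  have n: "is_nt (par_cat R B) (dom_cat B) (par_ftor R B g') (par_ftor R B g) (mono_nt R B g' g)"
    using category_B g' g_in g_mono g'_le by (rule mono_nt_nt)
  have "vcomp (par_cat R B) (cod_cat B) (fibre_nt R B (\<lambda>q. f (g q)) c)
      (post_whisker (par_cat R B) (par B) (mono_nt R B g' g)) = fibre_nt R B (\<lambda>q. f (g' q)) c"
    using idt_left[OF category_B idt_hom[OF category_B]] idt_ar[OF category_B]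
    by (auto simp: vcomp_def post_whisker_def fibre_nt_def mono_nt_def in_ob_prod_iff in_ob_poset_iff g_in g'(1) g'_le
        intro!: restrict_ext)
  then show ?thesis
    using transport_pre_nt[OF R_small dom_small[OF B] cod_small[OF B] par_functor[OF B] R_ftor R_nt[OF c le] Z \<eta> n]
    by (simp add: fibre_map_def)
qed

text \<open>When every vertex maps below \<open>c\<close>, there is a cocone over all of
  \<open>S\<close>, and its restriction along \<open>g\<close> is the cocone over \<open>R\<close>.
  This identifies the bottom edge.\<close>

lemma fibre_map_restrict:
  assumes c: "c \<in> T" and le: "\<And>p. p \<in> S \<Longrightarrow> f p \<subseteq> c"
  shows "fa (D1 D (par_cat R B) (dom_cat B) (par_ftor R B g))
     (transport (dom_cat B) (dom_cat B) (cod_cat B) (par B) (par_ftor S B (\<lambda>p. p))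
      (comp_ftor (dom_cat B) (cod_slice B c) (par_proj S B)) (fibre_nt S B f c) Z \<eta>)
    = fibre_map R B g c Z \<eta>"
proof -
  have cc: "category (dom_cat B)" "category (par_cat R B)" using dom_small[OF B] R_small small_catD by auto
  have S1: "is_functor (dom_cat B) (dom_cat B) (par_ftor S B (\<lambda>p. p))"
    by (rule par_ftor_functor[OF category_B])
  have S2: "comp_ftor (dom_cat B) (par B) (par_ftor S B (\<lambda>p. p)) = par B"
    by (rule par_ftor_comp[OF category_B _ _ f_in f_mono])
  have S3: "is_functor (dom_cat B) B (par_proj S B)"
    using category_B by (simp add: proj2_functor poset_category)
  have n: "is_nt (dom_cat B) (cod_cat B) (comp_ftor (dom_cat B) (par B) (par_ftor S B (\<lambda>p. p)))
    (comp_ftor (dom_cat B) (cod_slice B c) (par_proj S B)) (fibre_nt S B f c)"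
    unfolding S2 by (rule fibre_nt_nt[OF category_B _ c]) (simp_all add: f_in f_mono le)
  have 1: "comp_ftor (par_cat R B) (par_ftor S B (\<lambda>p. p)) (par_ftor R B g) = par_ftor R B g"
    by (rule par_ftor_comp[OF category_B g_in g_mono])
  have 2: "comp_ftor (par_cat R B) (par_proj S B) (par_ftor R B g) = par_proj R B"
    by (rule proj2_par_ftor[OF category_B g_in g_mono])
  have 3: "pre_whisker (par_cat R B) (fibre_nt S B f c) (par_ftor R B g) = fibre_nt R B (\<lambda>q. f (g q)) c"
    by (auto simp: pre_whisker_def fibre_nt_def in_ob_prod_iff in_ob_poset_iff g_in intro!: restrict_ext)
  show ?thesis
    using transport_restrict[OF dom_small[OF B] dom_small[OF B] cod_small[OF B] par_functor[OF B] S1 n Z \<eta> R_small R_ftor]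
    unfolding 1 3 comp_ftor_assoc[OF cc(2) R_ftor, symmetric] 2 fibre_map_def .
qed

end

text \<open>The component of the full cocone at \<open>p\<close> is the unit at \<open>p\<close>
  followed by the edge from \<open>f p\<close> to \<open>c\<close>. This identifies the right
  edge.\<close>

lemma fibre_map_slice:
  assumes c: "c \<in> T" and le: "\<And>p. p \<in> S \<Longrightarrow> f p \<subseteq> c" and p: "p \<in> S"
  shows "fa (D1 D B (dom_cat B) (dom_slice B p)) (fibre_map S B (\<lambda>p. p) c Z \<eta>)
    = edge B (f p) c Z \<cdot>\<^bsub>D0 D B\<^esub> fa (D1 D B (dom_cat B) (dom_slice B p)) \<eta>"
proof -
  have cc: "category (dom_cat B)" "category (cod_cat B)" using dom_small[OF B] cod_small[OF B] small_catD by auto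
  note k = dom_slice_functor[OF B p]
  have S1: "is_functor (dom_cat B) (dom_cat B) (par_ftor S B (\<lambda>p. p))"
    by (rule par_ftor_functor[OF category_B])
  have S3: "is_functor (dom_cat B) B (par_proj S B)"
    using category_B by (simp add: proj2_functor poset_category)
  have 1: "comp_ftor B (par_ftor S B (\<lambda>p. p)) (dom_slice B p) = dom_slice B p"
    by (rule functor_eqI[OF comp_ftor_functor[OF category_B cc(1) k S1] k]) (use p in auto)
  have 2: "comp_ftor B (par_proj S B) (dom_slice B p) = id_ftor B"
    using category_B p by (simp add: proj2_slice poset_category)
  have 3: "comp_ftor B (cod_slice B c) (id_ftor B) = cod_slice B c"
    by (rule functor_eqI[OF comp_ftor_functor[OF category_B cc(2) id_ftor_functor[OF category_B] cod_slice_functor[OF B c]]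
          cod_slice_functor[OF B c]]) auto
  have 4: "comp_ftor B (par B) (dom_slice B p) = cod_slice B (f p)"
    by (rule functor_eqI[OF comp_ftor_functor[OF category_B cc(2) k par_functor[OF B]] cod_slice_functor[OF B f_in[OF p]]])
      (use p in auto)
  have 5: "pre_whisker B (fibre_nt S B f c) (dom_slice B p) = slice_nt B (Pair (Vertex (f p)) (Vertex c))"
    using p by (auto simp: pre_whisker_def fibre_nt_def slice_nt_def intro!: restrict_ext)
  show ?thesis
    unfolding fibre_map_def
      transport_restrict[OF dom_small[OF B] dom_small[OF B] cod_small[OF B] par_functor[OF B] S1
        R_nt[of S "\<lambda>p. p", OF finite_S _ _ c le] Z \<eta> B k, simplified] 
    unfolding 1 5 comp_ftor_assoc[OF category_B k, symmetric] 2 3 transport_def 4 ..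
qed

text \<open>The relation from \<open>f p\<close> to itself is an identity, so the cocone constant at
  \<open>p\<close> is the pulled back unit component. It enters the top edge, which ends at a corner
  compared by the unit itself.\<close>

lemma fibre_map_const:
  assumes R: "finite R" and p: "p \<in> S"
  shows "fa (D1 D (par_cat R B) B (par_proj R B)) (fa (D1 D B (dom_cat B) (dom_slice B p)) \<eta>)
    = fibre_map R B (\<lambda>_. p) (f p) Z \<eta>"
proof -
  note g = R_small[of R "\<lambda>_. p", OF R p subset_refl] R_ftor[of R "\<lambda>_. p", OF R p subset_refl]
    R_proj[of R "\<lambda>_. p", OF R p subset_refl] R_par[of R "\<lambda>_. p", OF R p subset_refl]
  note k = dom_slice_functor[OF B p] and s = dom_small[OF B] cod_small[OF B] par_functor[OF B]
  have cc: "category (dom_cat B)" "category (cod_cat B)" "category (par_cat R B)"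
    using s g(1) small_catD by auto
  have 1: "comp_ftor (par_cat R B) (dom_slice B p) (par_proj R B) = par_ftor R B (\<lambda>_. p)"
    using category_B p by (rule slice_proj2)
  have 2: "fibre_nt R B (\<lambda>_. f p) (f p) = id_nt (par_cat R B) (cod_cat B) (par_ftor R B (\<lambda>_. f p))"
    by (auto simp: fibre_nt_def id_nt_def in_ob_prod_iff in_ob_poset_iff intro!: restrict_ext)
  have 3: "comp_ftor (par_cat R B) (cod_slice B (f p)) (par_proj R B) = par_ftor R B (\<lambda>_. f p)"
    using category_B f_in[OF p] by (rule slice_proj2)
  have F: "is_functor (par_cat R B) (cod_cat B) (par_ftor R B (\<lambda>_. f p))"
    using category_B p f_in by (auto intro!: par_ftor_functor)
  have h: "fa (D1 D (par_cat R B) (dom_cat B) (par_ftor R B (\<lambda>_. p))) \<eta> \<in> hom (D0 D (par_cat R B))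
     (fo (D1 D (par_cat R B) (dom_cat B) (par_ftor R B (\<lambda>_. p))) X)
     (fo (D1 D (par_cat R B) (cod_cat B) (par_ftor R B (\<lambda>_. f p))) Z)"
    using D1_hom[OF g(1) s(1) g(2) \<eta>] D1_comp_ob[OF g(1) s(1,2) g(2) s(3) Z] unfolding g(4) by simp
  show ?thesis
    unfolding fibre_map_def transport_def 2 3 g(4) D2_id[OF g(1) s(2) F Z] idt_left[OF D0_category[OF g(1)] h]
      D1_comp_hom[OF g(1) B s(1) g(3) k \<eta>, symmetric] 1 ..
qed

end

text \<open>The colimit unit and the fibre map are both universal arrows out of
  \<open>g^* X\<close>, and \<open>\<sigma>\<close> is the map between them. The equation that
  characterizes \<open>\<sigma>\<close> is recorded because the edges are compared after
  transposition.\<close>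

lemma fibre_iso:
  assumes B: "small_cat small B" and X: "X \<in> ob (D0 D (dom_cat B))"
    and c: "c \<in> T" and R: "reflective_fibre S f c R g l"
  obtains \<sigma> where "\<sigma> \<in> hom (D0 D B)
      (fo (lan D (par_cat R B) B (par_proj R B)) (fo (D1 D (par_cat R B) (dom_cat B) (par_ftor R B g)) X))
      (fo (D1 D B (cod_cat B) (cod_slice B c)) (fo (ext B) X))"
    and "is_iso (D0 D B) \<sigma>"
    and "fa (D1 D (par_cat R B) B (par_proj R B)) \<sigma> \<cdot>\<^bsub>D0 D (par_cat R B)\<^esub>
      lan_unit D (par_cat R B) B (par_proj R B) (fo (D1 D (par_cat R B) (dom_cat B) (par_ftor R B g)) X)
      = fibre_map R B g c (fo (ext B) X) (unit B X)"
proof -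
  have cB: "category B" using B by (rule small_catD)
  have fR: "finite R" using R by (simp add: reflective_fibre_def)
  have s: "small_cat small (par_cat R B)"
    using smallness fR B by (simp add: prod_small_cat poset_small_cat)
  have p: "is_functor (par_cat R B) B (par_proj R B)"
    using cB by (simp add: proj2_functor poset_category)
  have g: "is_functor (par_cat R B) (dom_cat B) (par_ftor R B g)"
    by (rule par_ftor_functor[OF cB]) (use R in \<open>simp_all add: reflective_fibre_def\<close>)
  note u = universal_fibre[OF finite_S finite_T B f_in f_mono c R
      lan_universal[OF dom_small[OF B] cod_small[OF B] par_functor[OF B] X], folded fibre_map_def]
  note v = lan_universal[OF s B p D1_ob[OF s dom_small[OF B] g X]]
  obtain \<sigma> where \<sigma>: "\<sigma> \<in> hom (D0 D B)
      (fo (lan D (par_cat R B) B (par_proj R B)) (fo (D1 D (par_cat R B) (dom_cat B) (par_ftor R B g)) X))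
      (fo (D1 D B (cod_cat B) (cod_slice B c)) (fo (ext B) X))"
    "fa (D1 D (par_cat R B) B (par_proj R B)) \<sigma> \<cdot>\<^bsub>D0 D (par_cat R B)\<^esub>
      lan_unit D (par_cat R B) B (par_proj R B) (fo (D1 D (par_cat R B) (dom_cat B) (par_ftor R B g)) X)
      = fibre_map R B g c (fo (ext B) X) (unit B X)"
    using universalE[OF v universalD[OF u]] .
  show thesis
    using that[OF \<sigma>(1) universal_unique_iso[OF v u D0_category[OF s] D0_category[OF B] D1_functor[OF s B p] \<sigma>] \<sigma>(2)] .
qed

end

section \<open>Squares in a category\<close>

lemma Pow_12: "Pow {1..2::nat} = {{}, {1}, {2}, {1, 2}}"
proof -
  have "{1..2::nat} = {1, 2}" by auto
  then show ?thesis by (simp add: Pow_insert insert_commute)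
qed

lemma ob_square: "x \<in> ob square \<longleftrightarrow> x \<in> {Vertex {}, Vertex {1}, Vertex {2}, Vertex {1, 2}}"
  unfolding cube_def poset_cat_def Pow_12 by simp

lemma hom_square: "e \<in> hom square x y \<longleftrightarrow> e = Pair x y \<and> (x, y) \<in>
   {(Vertex {}, Vertex {}), (Vertex {1}, Vertex {1}), (Vertex {2}, Vertex {2}), (Vertex {1, 2}, Vertex {1, 2}),
    (Vertex {}, Vertex {1}), (Vertex {}, Vertex {2}), (Vertex {1}, Vertex {1, 2}), (Vertex {2}, Vertex {1, 2}),
    (Vertex {}, Vertex {1, 2})}"
  unfolding cube_def in_hom_poset_iff Pow_12
  by (rule iffI; elim exE conjE insertE emptyE; simp)

lemma hom_square_cases:
  assumes "e \<in> hom square x y"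
  obtains "x = y" "e = Pair x x"
    | "x \<noteq> y" "e = Pair x y" "(x, y) \<in> {(Vertex {}, Vertex {1}), (Vertex {}, Vertex {2}),
    (Vertex {1}, Vertex {1, 2}), (Vertex {2}, Vertex {1, 2}), (Vertex {}, Vertex {1, 2})}"
  using assms unfolding hom_square by (elim conjE insertE emptyE) simp_all

text \<open>Commutativity of the square, and with it functoriality of \<open>square_diag\<close>, is
  deduced: it holds for \<open>F\<close> and is pulled back along the isomorphism
  \<open>s11\<close>. The given comparisons lead from the square to \<open>F\<close>, so their
  inverses form the natural isomorphism in the stated direction.\<close>

lemma square_iso:
  fixes F :: "('a uni, 'a uni, 'o, 'm) ftor"
  assumes C: "category C" and F: "is_functor square C F"
    and f: "f \<in> hom C a b" and g: "g \<in> hom C a c" and h: "h \<in> hom C b d" and k: "k \<in> hom C c d"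
    and s: "s00 \<in> hom C a (fo F (Vertex {}))" "s10 \<in> hom C b (fo F (Vertex {1}))"
      "s01 \<in> hom C c (fo F (Vertex {2}))" "s11 \<in> hom C d (fo F (Vertex {1, 2}))"
    and i: "is_iso C s00" "is_iso C s10" "is_iso C s01" "is_iso C s11"
    and top: "s10 \<cdot>\<^bsub>C\<^esub> f = fa F (Pair (Vertex {}) (Vertex {1})) \<cdot>\<^bsub>C\<^esub> s00"
    and left: "s01 \<cdot>\<^bsub>C\<^esub> g = fa F (Pair (Vertex {}) (Vertex {2})) \<cdot>\<^bsub>C\<^esub> s00"
    and right: "s11 \<cdot>\<^bsub>C\<^esub> h = fa F (Pair (Vertex {1}) (Vertex {1, 2})) \<cdot>\<^bsub>C\<^esub> s10"
    and bottom: "s11 \<cdot>\<^bsub>C\<^esub> k = fa F (Pair (Vertex {2}) (Vertex {1, 2})) \<cdot>\<^bsub>C\<^esub> s01"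
  shows "\<exists>\<theta>. is_nt_iso square C F (square_diag C f g h k) \<theta>"
proof -
  let ?S = "square :: 'a scat" and ?G = "square_diag C f g h k :: ('a uni, 'a uni, 'o, 'm) ftor"
  have S: "category ?S" by (simp add: cube_def poset_category)
  have ob: "a \<in> ob C" "b \<in> ob C" "c \<in> ob C" "d \<in> ob C"
    using hom_ob[OF C f] hom_ob[OF C h] hom_ob[OF C g] by auto
  have e: "Pair (Vertex {}) (Vertex {1}) \<in> hom ?S (Vertex {}) (Vertex {1})"
     "Pair (Vertex {}) (Vertex {2}) \<in> hom ?S (Vertex {}) (Vertex {2})"
     "Pair (Vertex {1}) (Vertex {1, 2}) \<in> hom ?S (Vertex {1}) (Vertex {1, 2})"
     "Pair (Vertex {2}) (Vertex {1, 2}) \<in> hom ?S (Vertex {2}) (Vertex {1, 2})"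
    by (simp_all add: hom_square)
  have comp: "Pair (Vertex {}) (Vertex {1, 2}) = Pair (Vertex {1}) (Vertex {1, 2}) \<cdot>\<^bsub>?S\<^esub> Pair (Vertex {}) (Vertex {1})"
    "Pair (Vertex {}) (Vertex {1, 2}) = Pair (Vertex {2}) (Vertex {1, 2}) \<cdot>\<^bsub>?S\<^esub> Pair (Vertex {}) (Vertex {2})"
    by (simp_all add: cube_def)
  note Fe = functor_hom[OF F e(1)] functor_hom[OF F e(2)] functor_hom[OF F e(3)] functor_hom[OF F e(4)]
  have hf: "h \<cdot>\<^bsub>C\<^esub> f \<in> hom C a d" and kg: "k \<cdot>\<^bsub>C\<^esub> g \<in> hom C a d"
    using cmp_hom[OF C f h] cmp_hom[OF C g k] .
  have diag: "s11 \<cdot>\<^bsub>C\<^esub> (h \<cdot>\<^bsub>C\<^esub> f) = fa F (Pair (Vertex {}) (Vertex {1, 2})) \<cdot>\<^bsub>C\<^esub> s00"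
    using cmp_assoc[OF C f h s(4)] cmp_assoc[OF C f s(2) Fe(3)] cmp_assoc[OF C s(1) Fe(1) Fe(3)]
      functor_cmp[OF F e(1,3)] top right comp(1) by simp
  have diag': "s11 \<cdot>\<^bsub>C\<^esub> (k \<cdot>\<^bsub>C\<^esub> g) = fa F (Pair (Vertex {}) (Vertex {1, 2})) \<cdot>\<^bsub>C\<^esub> s00"
    using cmp_assoc[OF C g k s(4)] cmp_assoc[OF C g s(3) Fe(4)] cmp_assoc[OF C s(1) Fe(2) Fe(4)]
      functor_cmp[OF F e(2,4)] left bottom comp(2) by simp
  have hk: "h \<cdot>\<^bsub>C\<^esub> f = k \<cdot>\<^bsub>C\<^esub> g"
    using iso_cancel_left[OF C i(4) s(4) hf kg] diag diag' by simp
  note fg = homD(2,3)[OF f] homD(2,3)[OF g] homD(2,3)[OF h] homD(2,3)[OF k]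
  have obG: "fo ?G (Vertex {}) = a" "fo ?G (Vertex {1}) = b" "fo ?G (Vertex {2}) = c" "fo ?G (Vertex {1, 2}) = d"
    by (simp_all add: square_diag_def Let_def ob_square fg)
  have arS: "Pair x y \<in> ar ?S" if "Pair x y \<in> hom ?S x y" for x y using that by (rule homD)
  have arG: "fa ?G (Pair (Vertex {}) (Vertex {1})) = f" "fa ?G (Pair (Vertex {}) (Vertex {2})) = g"
     "fa ?G (Pair (Vertex {1}) (Vertex {1, 2})) = h" "fa ?G (Pair (Vertex {2}) (Vertex {1, 2})) = k"
     "fa ?G (Pair (Vertex {}) (Vertex {1, 2})) = h \<cdot>\<^bsub>C\<^esub> f"
     "x \<in> ob ?S \<Longrightarrow> fa ?G (Pair x x) = idt C (fo ?G x)" for x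
    by (auto simp: square_diag_def Let_def arS hom_square ob_square fg)
  have G: "is_functor ?S C ?G"
  proof -
    have G1: "fo ?G x \<in> ob C" if "x \<in> ob ?S" for x using that obG ob by (auto simp: ob_square)
    have idG: "idt C (fo ?G x) \<in> hom C (fo ?G x) (fo ?G x)" if "x \<in> ob ?S" for x
      using C G1[OF that] by (rule idt_hom)
    have G2: "fa ?G e \<in> hom C (fo ?G x) (fo ?G y)" if e: "e \<in> hom ?S x y" for e x y
    proof (rule hom_square_cases[OF e])
      assume "x = y" "e = Pair x x"
      then show ?thesis using arG(6) idG hom_ob[OF S e] by simp
    next
      assume "e = Pair x y" "(x, y) \<in> {(Vertex {}, Vertex {1}), (Vertex {}, Vertex {2}),
    (Vertex {1}, Vertex {1, 2}), (Vertex {2}, Vertex {1, 2}), (Vertex {}, Vertex {1, 2})}"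
      then show ?thesis using f g h k hf by (elim insertE emptyE) (simp_all add: obG arG(1-5) del: One_nat_def)
    qed
    have G3: "fa ?G (idt ?S x) = idt C (fo ?G x)" if "x \<in> ob ?S" for x
      using arG(6)[OF that] by (simp add: cube_def)
    have G4: "fa ?G (e' \<cdot>\<^bsub>?S\<^esub> e) = fa ?G e' \<cdot>\<^bsub>C\<^esub> fa ?G e" if e: "e \<in> hom ?S x y" "e' \<in> hom ?S y z" for e e' x y z
    proof -
      have xyz: "x \<in> ob ?S" "y \<in> ob ?S" "z \<in> ob ?S" using hom_ob[OF S e(1)] hom_ob[OF S e(2)] by auto
      have p: "e = Pair x y" "e' = Pair y z" using e by (simp_all add: hom_square)
      consider "x = y" | "y = z" | "x \<noteq> y" "y \<noteq> z" by blast
      then show ?thesis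
      proof cases
        case 1
        then have "e = idt ?S y" using p by (simp add: cube_def)
        then show ?thesis
          using 1 idt_right[OF S e(2)] idt_right[OF C G2[OF e(2)]] G3[OF xyz(2)] by simp
      next
        case 2
        then have "e' = idt ?S y" using p by (simp add: cube_def)
        then show ?thesis
          using 2 idt_left[OF S e(1)] idt_left[OF C G2[OF e(1)]] G3[OF xyz(2)] by simp
      next
        case 3
        have "(x, y) \<in> {(Vertex {}, Vertex {1}), (Vertex {}, Vertex {2}),
    (Vertex {1}, Vertex {1, 2}), (Vertex {2}, Vertex {1, 2}), (Vertex {}, Vertex {1, 2})}"
          by (rule hom_square_cases[OF e(1)]) (use 3 in simp_all)
        moreover have "(y, z) \<in> {(Vertex {}, Vertex {1}), (Vertex {}, Vertex {2}),
    (Vertex {1}, Vertex {1, 2}), (Vertex {2}, Vertex {1, 2}), (Vertex {}, Vertex {1, 2})}"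
          by (rule hom_square_cases[OF e(2)]) (use 3 in simp_all)
        \<comment> \<open>Two composable nonidentity arrows lead from the initial to the terminal
          corner. Through \<open>{1}\<close> their composite is the defining value of the diagonal;
          through \<open>{2}\<close> it is the same by \<open>hk\<close>.\<close>
        ultimately have "x = Vertex {} \<and> z = Vertex {1, 2} \<and> (y = Vertex {1} \<or> y = Vertex {2})"
          by (elim insertE emptyE) simp_all
        then show ?thesis using arG(1-5) hk comp(1,2)[symmetric] p by auto
      qed
    qed
    have "is_functor ?S C (mk_ftor ?S (fo ?G) (fa ?G))"
      using S C G1 G2 G3 G4 by (rule mk_ftor_functor)
    moreover have "mk_ftor ?S (fo ?G) (fa ?G) = ?G"
      by (simp add: square_diag_def Let_def mk_ftor_def)
    ultimately show ?thesis by simp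
  qed
  define \<sigma> where "\<sigma> x = (if x = Vertex {} then s00 else if x = Vertex {1} then s10 else if x = Vertex {2} then s01 else s11)"
    for x :: "'a uni"
  have \<sigma>: "\<sigma> x \<in> hom C (fo ?G x) (fo F x)" "is_iso C (\<sigma> x)" if "x \<in> ob ?S" for x
    using that s i obG by (auto simp: ob_square \<sigma>_def)
  have \<sigma>_nat: "\<sigma> y \<cdot>\<^bsub>C\<^esub> fa ?G e = fa F e \<cdot>\<^bsub>C\<^esub> \<sigma> x" if e: "e \<in> hom ?S x y" for e x y
  proof (rule hom_square_cases[OF e])
    assume xy: "x = y" "e = Pair x x"
    have x: "x \<in> ob ?S" using hom_ob[OF S e] by simp
    have "e = idt ?S x" using xy by (simp add: cube_def)
    then show ?thesis
      using xy x functor_idt[OF F x] functor_idt[OF G x] idt_left[OF C \<sigma>(1)[OF x]] idt_right[OF C \<sigma>(1)[OF x]] by simp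
  next
    assume "e = Pair x y" "(x, y) \<in> {(Vertex {}, Vertex {1}), (Vertex {}, Vertex {2}),
    (Vertex {1}, Vertex {1, 2}), (Vertex {2}, Vertex {1, 2}), (Vertex {}, Vertex {1, 2})}"
    then show ?thesis using top left right bottom diag
      by (elim insertE emptyE) (simp_all add: \<sigma>_def arG(1-5) doubleton_eq_iff del: One_nat_def)
  qed
  have "is_nt_iso ?S C F ?G (\<lambda>x \<in> ob ?S. inverse_ar C (\<sigma> x))"
    unfolding is_nt_iso_def
  proof (intro conjI ballI ntI[OF S F G])
    fix x assume x: "x \<in> ob ?S"
    show "(\<lambda>x \<in> ob ?S. inverse_ar C (\<sigma> x)) x \<in> hom C (fo F x) (fo ?G x)"
      "is_iso C ((\<lambda>x \<in> ob ?S. inverse_ar C (\<sigma> x)) x)"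
      using x inverse_ar(1)[OF \<sigma>(2)[OF x] \<sigma>(1)[OF x]] is_iso_inverse_ar[OF \<sigma>(2)[OF x] \<sigma>(1)[OF x]] by simp_all
  next
    fix e x y assume e: "e \<in> hom ?S x y"
    have x: "x \<in> ob ?S" and y: "y \<in> ob ?S" using hom_ob[OF S e] .
    note ix = inverse_ar[OF \<sigma>(2)[OF x] \<sigma>(1)[OF x]] and iy = inverse_ar[OF \<sigma>(2)[OF y] \<sigma>(1)[OF y]]
    note Fe = functor_hom[OF F e] and Ge = functor_hom[OF G e]
    have "\<sigma> y \<cdot>\<^bsub>C\<^esub> (inverse_ar C (\<sigma> y) \<cdot>\<^bsub>C\<^esub> fa F e) = fa F e"
      using cmp_assoc[OF C Fe iy(1) \<sigma>(1)[OF y]] iy(3) idt_left[OF C Fe] by simp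
    moreover have "\<sigma> y \<cdot>\<^bsub>C\<^esub> (fa ?G e \<cdot>\<^bsub>C\<^esub> inverse_ar C (\<sigma> x)) = fa F e"
      using cmp_assoc[OF C ix(1) Ge \<sigma>(1)[OF y]] cmp_assoc[OF C ix(1) \<sigma>(1)[OF x] Fe] ix(3) idt_right[OF C Fe] \<sigma>_nat[OF e]
      by simp
    ultimately have "inverse_ar C (\<sigma> y) \<cdot>\<^bsub>C\<^esub> fa F e = fa ?G e \<cdot>\<^bsub>C\<^esub> inverse_ar C (\<sigma> x)"
      using iso_cancel_left[OF C \<sigma>(2)[OF y] \<sigma>(1)[OF y] cmp_hom[OF C Fe iy(1)] cmp_hom[OF C ix(1) Ge]] by simp
    then show "(\<lambda>x \<in> ob ?S. inverse_ar C (\<sigma> x)) y \<cdot>\<^bsub>C\<^esub> fa F e = fa ?G e \<cdot>\<^bsub>C\<^esub> (\<lambda>x \<in> ob ?S. inverse_ar C (\<sigma> x)) x"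
      using x y by simp
  qed auto
  then show ?thesis by blast
qed

section \<open>The punctured cube\<close>

definition punctured_sets :: "nat \<Rightarrow> nat set set" where
  "punctured_sets n = {S. S \<subseteq> {1..n} \<and> card S \<le> n - 1}"

text \<open>
  Collapses the bottom face minus \<open>(\<infinity>, 0)\<close>, the vertex \<open>(\<infinity>, 0)\<close> and the top face of the punctured
  cube to the three vertices of the span.
\<close>

definition collapse :: "nat \<Rightarrow> nat set \<Rightarrow> nat set" where
  "collapse n p = (if n \<in> p then {2} else if p = {1..n - 1} then {1} else {})"

lemma punctured_eq: "punctured n = poset_cat (punctured_sets n)"
  by (simp add: punctured_def cube_le_def punctured_sets_def)

lemma finite_punctured_sets: "finite (punctured_sets n)"
  by (rule finite_subset[of _ "Pow {1..n}"]) (auto simp: punctured_sets_def)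

lemma punctured_sets_bottom:
  assumes "n \<ge> 1" "p \<in> punctured_sets n" "n \<notin> p"
  shows "p \<subseteq> {1..n - 1}"
proof
  fix i assume "i \<in> p"
  with assms have "1 \<le> i" "i \<le> n" "i \<noteq> n" by (auto simp: punctured_sets_def)
  then show "i \<in> {1..n - 1}" by auto
qed

text \<open>The bound on \<open>n\<close> matters: for \<open>n = 1\<close> truncated subtraction
  would let the empty set into the left side, while the empty set has no proper subset.\<close>

lemma punctured_sets_pred_iff:
  assumes "n \<ge> 2"
  shows "p \<in> punctured_sets (n - 1) \<longleftrightarrow> p \<subseteq> {1..n - 1} \<and> p \<noteq> {1..n - 1}"
proof
  assume "p \<in> punctured_sets (n - 1)"
  then have "p \<subseteq> {1..n - 1}" "card p \<le> n - 1 - 1" by (auto simp: punctured_sets_def)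
  with assms show "p \<subseteq> {1..n - 1} \<and> p \<noteq> {1..n - 1}" by auto
next
  assume p: "p \<subseteq> {1..n - 1} \<and> p \<noteq> {1..n - 1}"
  then have "card p < card {1..n - 1}" by (intro psubset_card_mono) auto
  with p show "p \<in> punctured_sets (n - 1)" by (auto simp: punctured_sets_def)
qed

text \<open>On the face with last coordinate \<open>0\<close> only \<open>(\<infinity>, 0)\<close>
  lies outside the smaller punctured cube. On the face with last coordinate \<open>1\<close>,
  removing \<open>n\<close> lowers the cardinality by one, so the bound for the large cube becomes
  the bound for the small one.\<close>

lemma punctured_sets_face:
  assumes "n \<ge> 2" "p \<in> punctured_sets n"
  shows "n \<notin> p \<Longrightarrow> p \<noteq> {1..n - 1} \<Longrightarrow> p \<in> punctured_sets (n - 1)"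
    and "n \<in> p \<Longrightarrow> p - {n} \<in> punctured_sets (n - 1)"
proof -
  show "n \<notin> p \<Longrightarrow> p \<noteq> {1..n - 1} \<Longrightarrow> p \<in> punctured_sets (n - 1)"
    using assms punctured_sets_bottom[of n p] by (simp add: punctured_sets_pred_iff del: One_nat_def)
  assume np: "n \<in> p"
  have fin: "finite p" using assms(2) finite_subset[of p "{1..n}"] by (auto simp: punctured_sets_def)
  have "p - {n} \<subseteq> {1..n - 1}"
  proof
    fix i assume "i \<in> p - {n}"
    with assms have "1 \<le> i" "i \<le> n" "i \<noteq> n" by (auto simp: punctured_sets_def)
    then show "i \<in> {1..n - 1}" by auto
  qed
  moreover have "card (p - {n}) \<le> n - 1 - 1"
    using assms(2) np fin by (auto simp: punctured_sets_def card_Diff_singleton)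
  ultimately show "p - {n} \<in> punctured_sets (n - 1)" by (simp add: punctured_sets_def)
qed

lemma punctured_sets_include:
  assumes "n \<ge> 2" "p \<in> punctured_sets (n - 1)"
  shows "p \<in> punctured_sets n" "insert n p \<in> punctured_sets n" "n \<notin> p" "p \<noteq> {1..n - 1}"
proof -
  have p: "p \<subseteq> {1..n - 1}" "card p \<le> n - 2" using assms by (auto simp: punctured_sets_def numeral_2_eq_2)
  have fin: "finite p" using p(1) finite_subset by blast
  show "n \<notin> p" using p(1) assms(1) by auto
  then have "card (insert n p) \<le> n - 1" using p(2) fin assms(1) by simp
  moreover have "{1..n - 1} \<subseteq> {1..n}" "n \<in> {1..n}" using assms(1) by auto
  moreover from this(1) have "p \<subseteq> {1..n}" using p(1) by (rule subset_trans[rotated])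
  ultimately show "p \<in> punctured_sets n" "insert n p \<in> punctured_sets n"
    using p(2) assms(1) by (simp_all add: punctured_sets_def)
  show "p \<noteq> {1..n - 1}" using assms by (simp add: punctured_sets_pred_iff del: One_nat_def)
qed

lemma punctured_sets_top:
  assumes "n \<ge> 2"
  shows "{1..n - 1} \<in> punctured_sets n" "collapse n {1..n - 1} = {1}"
proof -
  have "n \<notin> {1..n - 1}" "{1..n - 1} \<subseteq> {1..n}" using assms by auto
  then show "{1..n - 1} \<in> punctured_sets n" "collapse n {1..n - 1} = {1}"
    by (simp_all add: punctured_sets_def collapse_def)
qed

lemma collapse_in: "collapse n p \<in> {{}, {1}, {2}}"
  by (simp add: collapse_def)

lemma collapse_mono:
  assumes "n \<ge> 2" "p \<in> punctured_sets n" "q \<in> punctured_sets n" "p \<subseteq> q"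
  shows "collapse n p \<subseteq> collapse n q"
proof -
  consider "n \<in> p" | "n \<notin> p" "p = {1..n - 1}" | "n \<notin> p" "p \<noteq> {1..n - 1}" by blast
  then show ?thesis
  proof cases
    case 2
    \<comment> \<open>A set in the cube that contains \<open>(\<infinity>, 0)\<close> and
      \<open>n\<close> would be the removed top vertex. So \<open>(\<infinity>, 0)\<close> is
      maximal, and sending it to \<open>{1}\<close>, which is incomparable with \<open>{2}\<close>,
      keeps the map monotone.\<close>
    have "n \<notin> q"
    proof
      assume "n \<in> q"
      moreover have "{1..n} = insert n {1..n - 1}" using assms(1) by auto
      ultimately have "{1..n} \<subseteq> q" using 2(2) assms(4) by simp
      moreover have "finite q" "card q \<le> n - 1"
        using assms(3) finite_subset[of q "{1..n}"] by (auto simp: punctured_sets_def)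
      ultimately have "n \<le> n - 1" using card_mono[of q "{1..n}"] by simp
      then show False using assms(1) by simp
    qed
    then have "q = {1..n - 1}"
      using punctured_sets_bottom[of n q] assms(1,3,4) 2(2) by (intro subset_antisym) simp_all
    with 2 show ?thesis by simp
  next
    case 1
    then have "n \<in> q" using assms(4) by (rule subsetD[rotated])
    with 1 show ?thesis by (simp add: collapse_def)
  qed (simp add: collapse_def)
qed

text \<open>The fibre over the initial corner is the bottom face without
  \<open>(\<infinity>, 0)\<close>. This is the smaller punctured cube itself, so the reflection is
  the identity.\<close>

lemma reflective_fibre_bottom:
  assumes "n \<ge> 2"
  shows "reflective_fibre (punctured_sets n) (collapse n) {} (punctured_sets (n - 1)) (\<lambda>p. p) (\<lambda>p. p)"
  unfolding reflective_fibre_def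
  using punctured_sets_include[OF assms] punctured_sets_face(1)[OF assms]
  by (simp add: finite_punctured_sets collapse_def)

text \<open>The fibre over \<open>{2}\<close> is everything except \<open>(\<infinity>, 0)\<close>,
  and it is reflected onto the top face by adding \<open>n\<close>. At
  \<open>(\<infinity>, 0)\<close> this would produce the missing vertex. In the coordinates of the
  smaller cube the reflection reads \<open>p - {n}\<close>.\<close>

lemma reflective_fibre_top:
  assumes "n \<ge> 2"
  shows "reflective_fibre (punctured_sets n) (collapse n) {2} (punctured_sets (n - 1)) (insert n) (\<lambda>p. p - {n})"
proof -
  have "p - {n} \<in> punctured_sets (n - 1)" if "p \<in> punctured_sets n" "collapse n p \<subseteq> {2}" for p
  proof (cases "n \<in> p")
    case False
    moreover from this that(2) have "p \<noteq> {1..n - 1}" by (auto simp: collapse_def)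
    ultimately show ?thesis using punctured_sets_face(1)[OF assms that(1)] by simp
  qed (use punctured_sets_face(2)[OF assms that(1)] in simp)
  then show ?thesis
    unfolding reflective_fibre_def
    using punctured_sets_include[OF assms] by (auto simp: finite_punctured_sets collapse_def)
qed

text \<open>Every vertex lies over the terminal corner, so that corner is the colimit of the whole
  diagram.\<close>

lemma reflective_fibre_all:
  "reflective_fibre (punctured_sets n) (collapse n) {1, 2} (punctured_sets n) (\<lambda>p. p) (\<lambda>p. p)"
  unfolding reflective_fibre_def by (auto simp: finite_punctured_sets collapse_def)

lemma j_eq:
  "j n 0 = poset_ftor (punctured_sets (n - 1)) (\<lambda>p. p)"
  "j n (Suc 0) = poset_ftor (punctured_sets (n - 1)) (insert n)"
  by (auto simp: j_def poset_ftor_def punctured_eq mk_ftor_def in_ob_poset_iff in_ar_poset_iff append_coord_def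
      intro!: restrict_ext)

lemma j_par_eq:
  "j_par n B 0 = par_ftor (punctured_sets (n - 1)) B (\<lambda>p. p)"
  "j_par n B (Suc 0) = par_ftor (punctured_sets (n - 1)) B (insert n)"
  by (simp_all add: j_par_def j_eq punctured_eq)

section \<open>Corners and edges of the extended diagram\<close>

locale punctured_cube = derivator_on small D
  for small :: "'a uni set \<Rightarrow> bool" and D :: "('a, 'o, 'm) prederiv" +
  fixes n :: nat
  assumes n: "n \<ge> 2"
begin

sublocale monotone_extension small D "punctured_sets n" "Pow {1..2}" "collapse n"
proof unfold_locales
  show "collapse n p \<in> Pow {1..2}" for p unfolding Pow_12 using collapse_in by blast
qed (use finite_punctured_sets collapse_mono[OF n] in simp_all)

text \<open>\<open>collapse\<close> never takes the value \<open>{1, 2}\<close>, so the extension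
  can be made in two stages, the second of which is the one along the inclusion of the span.\<close>

lemma ext_cocartesian:
  assumes B: "small_cat small B" and X: "X \<in> ob (D0 D (dom_cat B))"
  shows "cocartesian D B (fo (ext B) X)"
proof -
  let ?V = "{S. S \<subseteq> {1..2::nat} \<and> card S \<le> 1}"
  have V: "finite ?V" by (rule finite_subset[of _ "Pow {1..2}"]) auto
  have cB: "category B" using B by (rule small_catD)
  have VB: "small_cat small (par_cat ?V B)"
    using smallness V B by (simp add: prod_small_cat poset_small_cat)
  have f: "collapse n p \<in> ?V" for p by (auto simp: collapse_def)
  have u: "is_functor (dom_cat B) (par_cat ?V B) (par B)"
    by (rule par_ftor_functor[OF cB f f_mono])
  have v: "is_functor (par_cat ?V B) (cod_cat B) (par_ftor ?V B (\<lambda>p. p))"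
    by (rule par_ftor_functor[OF cB]) auto
  have vu: "comp_ftor (dom_cat B) (par_ftor ?V B (\<lambda>p. p)) (par B) = par B"
    by (rule par_ftor_comp[OF cB f f_mono]) auto
  have span: "(span_incl :: 'a sftor) = poset_ftor ?V (\<lambda>p. p)"
    by (auto simp: span_incl_def poset_ftor_def cube_le_def mk_ftor_def in_ob_poset_iff in_ar_poset_iff
        intro!: restrict_ext)
  show ?thesis
    unfolding cocartesian_def
  proof (rule bexI)
    show "\<exists>e \<in> hom (D0 D (square \<times>\<^sub>c B))
               (fo (lan D (cube_le 2 1 \<times>\<^sub>c B) (square \<times>\<^sub>c B)
                      (prod_ftor (cube_le 2 1) B span_incl (id_ftor B)))
                 (fo (lan D (dom_cat B) (cube_le 2 1 \<times>\<^sub>c B) (par B)) X)) (fo (ext B) X).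
          is_iso (D0 D (square \<times>\<^sub>c B)) e"
      using lan_comp_iso[OF dom_small[OF B] VB cod_small[OF B] u v X]
      unfolding vu span cube_def cube_le_def .
    show "fo (lan D (dom_cat B) (cube_le 2 1 \<times>\<^sub>c B) (par B)) X \<in> ob (D0 D (cube_le 2 1 \<times>\<^sub>c B))"
      unfolding cube_le_def using lan_ob[OF dom_small[OF B] VB u X] .
  qed
qed

text \<open>Each prescribed corner gets an isomorphism to the corresponding value of the extension,
  and it remains to match the four edges. An edge that starts at a colimit is checked after
  transposition, where it becomes an identity between the cocones \<open>fibre_map\<close>.\<close>

lemma ext_underlying:
  assumes B: "small_cat small B" and X: "X \<in> ob (D0 D (dom_cat B))"
  shows "\<exists>\<theta>. is_nt_iso square (D0 D B) (underlying D square B (fo (ext B) X)) (colim_square D n B X) \<theta>"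
proof -
  let ?P = "punctured_sets n" and ?R = "punctured_sets (n - 1)" and ?p = "{1..n - 1}"
  let ?Z = "fo (ext B) X" and ?\<eta> = "unit B X"
  let ?RB = "par_cat ?R B" and ?prR = "par_proj ?R B" and ?prP = "par_proj ?P B"
  let ?j0 = "par_ftor ?R B (\<lambda>p. p)" and ?j1 = "par_ftor ?R B (insert n)" and ?jc = "par_ftor ?R B (\<lambda>_. ?p)"
  let ?lR = "lan D ?RB B ?prR" and ?uR = "lan_unit D ?RB B ?prR"
  let ?lP = "lan D (dom_cat B) B ?prP" and ?uP = "lan_unit D (dom_cat B) B ?prP"
  have cB: "category B" using B by (rule small_catD)
  have T: "{} \<in> Pow {1..2::nat}" "{1} \<in> Pow {1..2::nat}" "{2} \<in> Pow {1..2::nat}" "{1, 2} \<in> Pow {1..2::nat}"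
    unfolding Pow_12 by simp_all
  note p = punctured_sets_top[OF n] and inc = punctured_sets_include[OF n]
  have sub: "q \<subseteq> ?p" if "q \<in> ?R" for q using that punctured_sets_pred_iff[OF n] by blast
  have fR: "finite ?R" by (rule finite_punctured_sets)
  have RB: "small_cat small ?RB" using smallness fR B by (simp add: prod_small_cat poset_small_cat)
  have PB: "small_cat small (dom_cat B)" and SB: "small_cat small (cod_cat B)"
    using dom_small[OF B] cod_small[OF B] .
  have prR: "is_functor ?RB B ?prR" and prP: "is_functor (dom_cat B) B ?prP"
    using cB by (simp_all add: proj2_functor poset_category)
  have j0: "is_functor ?RB (dom_cat B) ?j0" and j1: "is_functor ?RB (dom_cat B) ?j1" and jc: "is_functor ?RB (dom_cat B) ?jc"
    using inc p by (auto intro!: par_ftor_functor[OF cB])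
  have sp: "is_functor B (dom_cat B) (dom_slice B ?p)" using dom_slice_functor[OF B p(1)] .
  have Z: "?Z \<in> ob (D0 D (cod_cat B))" using lan_ob[OF PB SB par_functor[OF B] X] .
  have \<eta>: "?\<eta> \<in> hom (D0 D (dom_cat B)) X (fo (par_pull B) ?Z)" using lan_unit_hom[OF PB SB par_functor[OF B] X] .
  note cat = D0_category[OF B] D0_category[OF RB] D0_category[OF PB]
  let ?X0 = "fo (D1 D ?RB (dom_cat B) ?j0) X" and ?X1 = "fo (D1 D ?RB (dom_cat B) ?j1) X"
  let ?Xp = "fo (D1 D B (dom_cat B) (dom_slice B ?p)) X"
  have X0: "?X0 \<in> ob (D0 D ?RB)" and X1: "?X1 \<in> ob (D0 D ?RB)" and Xp: "?Xp \<in> ob (D0 D B)"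
    using D1_ob[OF RB PB j0 X] D1_ob[OF RB PB j1 X] D1_ob[OF B PB sp X] .
  have lP: "fo ?lP X \<in> ob (D0 D B)" using lan_ob[OF PB B prP X] .
  have uP: "?uP X \<in> hom (D0 D (dom_cat B)) X (fo (D1 D (dom_cat B) B ?prP) (fo ?lP X))" using lan_unit_hom[OF PB B prP X] .
  have le: "collapse n q \<subseteq> {1, 2}" for q by (auto simp: collapse_def)
  have le0: "collapse n q \<subseteq> {}" and le1: "collapse n (insert n q) \<subseteq> {2}" if "q \<in> ?R" for q
    using inc[OF that] by (simp_all add: collapse_def)
  have idP: "par_ftor ?P B (\<lambda>p. p) = id_ftor (dom_cat B)"
    by (rule functor_eqI[OF par_ftor_functor[OF cB, of ?P _ ?P] id_ftor_functor[OF small_catD[OF PB]]])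
      (auto simp: in_ob_prod_iff in_ar_prod_iff in_ob_poset_iff in_ar_poset_iff)
  have const: "comp_ftor ?RB (dom_slice B ?p) ?prR = ?jc"
    using cB p(1) by (rule slice_proj2)
  have pr_sp: "comp_ftor B ?prP (dom_slice B ?p) = id_ftor B"
    using cB p(1) by (simp add: proj2_slice poset_category)
  have pr_j1: "comp_ftor ?RB ?prP ?j1 = ?prR"
    by (rule proj2_par_ftor[OF cB inc(2)]) auto

  obtain s00 where s00: "s00 \<in> hom (D0 D B) (fo ?lR ?X0) (fo (D1 D B (cod_cat B) (cod_slice B {})) ?Z)"
    "is_iso (D0 D B) s00"
    "fa (D1 D ?RB B ?prR) s00 \<cdot>\<^bsub>D0 D ?RB\<^esub> ?uR ?X0 = fibre_map ?R B (\<lambda>p. p) {} ?Z ?\<eta>"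
    using fibre_iso[OF B X T(1) reflective_fibre_bottom[OF n]] .
  obtain s01 where s01: "s01 \<in> hom (D0 D B) (fo ?lR ?X1) (fo (D1 D B (cod_cat B) (cod_slice B {2})) ?Z)"
    "is_iso (D0 D B) s01"
    "fa (D1 D ?RB B ?prR) s01 \<cdot>\<^bsub>D0 D ?RB\<^esub> ?uR ?X1 = fibre_map ?R B (insert n) {2} ?Z ?\<eta>"
    using fibre_iso[OF B X T(3) reflective_fibre_top[OF n]] .
  \<comment> \<open>The embedding is the identity at this corner; its restriction functor is
    eliminated so that the source is the colimit of \<open>X\<close> itself.\<close>
  obtain s11 where s11: "s11 \<in> hom (D0 D B) (fo ?lP X) (fo (D1 D B (cod_cat B) (cod_slice B {1, 2})) ?Z)"
    "is_iso (D0 D B) s11"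
    "fa (D1 D (dom_cat B) B ?prP) s11 \<cdot>\<^bsub>D0 D (dom_cat B)\<^esub> ?uP X = fibre_map ?P B (\<lambda>p. p) {1, 2} ?Z ?\<eta>"
    using fibre_iso[OF B X T(4) reflective_fibre_all, unfolded idP D1_id[OF PB] id_ftor_simps(1)[OF X]] .
  \<comment> \<open>No colimit occurs at this corner: the comparison is the component of the unit at
    \<open>(\<infinity>, 0)\<close>.\<close>
  define s10 where "s10 = fa (D1 D B (dom_cat B) (dom_slice B ?p)) ?\<eta>"
  \<comment> \<open>The vertex \<open>(\<infinity>, 0)\<close> is the top of its fibre, since a
    vertex containing \<open>n\<close> goes to \<open>{2}\<close>, which is not below
    \<open>{1}\<close>.\<close>
  have "q \<subseteq> ?p" if q: "q \<in> ?P" "collapse n q \<subseteq> collapse n ?p" for q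
  proof -
    have "n \<notin> q"
    proof
      assume "n \<in> q"
      then have "collapse n q = {2}" by (simp add: collapse_def)
      with q(2) p(2) show False by simp
    qed
    then show ?thesis using punctured_sets_bottom[OF _ q(1)] n by simp
  qed
  note s10 = iso_fibre_point[OF finite_S finite_T B f_in f_mono p(1) this
      lan_universal[OF PB SB par_functor[OF B] X], folded s10_def, unfolded p(2)]

  let ?t0c = "D2 D ?RB (dom_cat B) ?j0 ?jc (mono_nt ?R B (\<lambda>p. p) (\<lambda>_. ?p)) X"
  let ?t01 = "D2 D ?RB (dom_cat B) ?j0 ?j1 (mono_nt ?R B (\<lambda>p. p) (insert n)) X"
  have n0c: "is_nt ?RB (dom_cat B) ?j0 ?jc (mono_nt ?R B (\<lambda>p. p) (\<lambda>_. ?p))"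
    by (rule mono_nt_nt[OF cB]) (simp_all add: inc p sub del: One_nat_def)
  have n01: "is_nt ?RB (dom_cat B) ?j0 ?j1 (mono_nt ?R B (\<lambda>p. p) (insert n))"
    by (rule mono_nt_nt[OF cB]) (use inc in auto)
  have t0c: "?t0c \<in> hom (D0 D ?RB) ?X0 (fo (D1 D ?RB B ?prR) ?Xp)"
    using D2_hom[OF RB PB n0c X] D1_comp_ob[OF RB B PB prR sp X] unfolding const by simp
  have t01: "?t01 \<in> hom (D0 D ?RB) ?X0 ?X1" using D2_hom[OF RB PB n01 X] .

  \<comment> \<open>The four prescribed maps are rewritten in terms of monotone maps and their
    relations, so that the statements about \<open>fibre_map\<close> apply.\<close>
  have top_eq: "top_map D n B X = lan_adj D ?RB B ?prR ?Xp ?t0c"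
  proof -
    have "(\<lambda>q \<in> ob ?RB. Pair (Pair (append_coord n 0 (pfst q)) (inf0 n)) (idt B (psnd q))) = mono_nt ?R B (\<lambda>p. p) (\<lambda>_. ?p)"
      by (auto simp: mono_nt_def append_coord_def inf0_def in_ob_prod_iff in_ob_poset_iff intro!: restrict_ext)
    then show ?thesis
      using const by (simp add: top_map_def Let_def colim_adj_def at_def punctured_eq j_par_eq inf0_def)
  qed
  have left_eq: "left_map D n B X = fa ?lR ?t01"
  proof -
    have "(\<lambda>q \<in> ob ?RB. Pair (Pair (append_coord n 0 (pfst q)) (append_coord n (Suc 0) (pfst q))) (idt B (psnd q)))
        = mono_nt ?R B (\<lambda>p. p) (insert n)"
      by (auto simp: mono_nt_def append_coord_def in_ob_prod_iff in_ob_poset_iff intro!: restrict_ext)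
    then show ?thesis
      by (simp add: left_map_def Let_def colim_def punctured_eq j_par_eq)
  qed
  have right_eq: "right_map D n B X = fa (D1 D B (dom_cat B) (dom_slice B ?p)) (?uP X)"
    by (simp add: right_map_def at_def colim_unit_def punctured_eq inf0_def)
  have bottom_eq: "bottom_map D n B X = lan_adj D ?RB B ?prR (fo ?lP X) (fa (D1 D ?RB (dom_cat B) ?j1) (?uP X))"
    by (simp add: bottom_map_def colim_adj_def colim_def colim_unit_def punctured_eq j_par_eq)

  have edge: "fa (underlying D square B ?Z) (Pair (Vertex c) (Vertex c')) = edge B c c' ?Z"
    if "c \<in> Pow {1..2}" "c' \<in> Pow {1..2}" "c \<subseteq> c'" for c c'
    using that by (simp add: underlying_def cube_def del: Pow_iff)
  have edge_hom: "edge B c c' ?Z \<in> hom (D0 D B) (fo (D1 D B (cod_cat B) (cod_slice B c)) ?Z) (fo (D1 D B (cod_cat B) (cod_slice B c')) ?Z)"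
    if "c \<in> Pow {1..2}" "c' \<in> Pow {1..2}" "c \<subseteq> c'" for c c'
    using D2_hom[OF B SB edge_nt[OF B that] Z] .
  have und_ob: "fo (underlying D square B ?Z) (Vertex c) = fo (D1 D B (cod_cat B) (cod_slice B c)) ?Z"
    if "c \<in> Pow {1..2}" for c
    using that by (simp add: underlying_def at_def cube_def del: Pow_iff)

  note top_adj = lan_adj[OF RB B prR X0 Xp t0c, folded top_eq]
  have j1uP: "fa (D1 D ?RB (dom_cat B) ?j1) (?uP X) \<in> hom (D0 D ?RB) ?X1 (fo (D1 D ?RB B ?prR) (fo ?lP X))"
    using D1_hom[OF RB PB j1 uP] D1_comp_ob[OF RB PB B j1 prP lP] unfolding pr_j1 by simp
  note bottom_adj = lan_adj[OF RB B prR X1 lP j1uP, folded bottom_eq]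
  have left_hom: "left_map D n B X \<in> hom (D0 D B) (fo ?lR ?X0) (fo ?lR ?X1)"
    unfolding left_eq using functor_hom[OF lan_functor[OF RB B prR] t01] .
  have right_hom: "right_map D n B X \<in> hom (D0 D B) ?Xp (fo ?lP X)"
    unfolding right_eq using D1_hom[OF B PB sp uP] D1_comp_ob[OF B PB B sp prP lP] lP
    unfolding pr_sp by (simp add: D1_id[OF B])

  \<comment> \<open>The side shared by the three edges that start at a colimit: a corner isomorphism
    followed by an edge of the extended diagram transposes to the fibre map over the larger
    corner.\<close>
  have transpose_edge: "fa (D1 D ?RB B ?prR) (edge B c c' ?Z \<cdot>\<^bsub>D0 D B\<^esub> s) \<cdot>\<^bsub>D0 D ?RB\<^esub> ?uR (fo (D1 D ?RB (dom_cat B) (par_ftor ?R B g)) X)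
      = fibre_map ?R B g c' ?Z ?\<eta>"
    if s: "s \<in> hom (D0 D B) (fo ?lR (fo (D1 D ?RB (dom_cat B) (par_ftor ?R B g)) X)) (fo (D1 D B (cod_cat B) (cod_slice B c)) ?Z)"
      "fa (D1 D ?RB B ?prR) s \<cdot>\<^bsub>D0 D ?RB\<^esub> ?uR (fo (D1 D ?RB (dom_cat B) (par_ftor ?R B g)) X) = fibre_map ?R B g c ?Z ?\<eta>"
      and c: "c \<in> Pow {1..2}" "c' \<in> Pow {1..2}" "c \<subseteq> c'"
      and g: "\<And>q. q \<in> ?R \<Longrightarrow> g q \<in> ?P" "\<And>q q'. q \<in> ?R \<Longrightarrow> q' \<in> ?R \<Longrightarrow> q \<subseteq> q' \<Longrightarrow> g q \<subseteq> g q'"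
        "\<And>q. q \<in> ?R \<Longrightarrow> collapse n (g q) \<subseteq> c" for s c c' g
    using lan_transpose_cmp[OF RB B prR D1_ob[OF RB PB par_ftor_functor[OF cB g(1,2)] X] s(1) edge_hom[OF c]]
      fibre_map_edge[OF B Z \<eta> fR g(1,2) c g(3)] s(2)
    by simp

  have top: "s10 \<cdot>\<^bsub>D0 D B\<^esub> top_map D n B X = edge B {} {1} ?Z \<cdot>\<^bsub>D0 D B\<^esub> s00"
  proof (rule lan_eqI[OF RB B prR X0 cmp_hom[OF cat(1) top_adj(1) s10(1)] cmp_hom[OF cat(1) s00(1) edge_hom]])
    have "fa (D1 D ?RB B ?prR) (s10 \<cdot>\<^bsub>D0 D B\<^esub> top_map D n B X) \<cdot>\<^bsub>D0 D ?RB\<^esub> ?uR ?X0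
        = fa (D1 D ?RB B ?prR) s10 \<cdot>\<^bsub>D0 D ?RB\<^esub> ?t0c"
      using lan_transpose_cmp[OF RB B prR X0 top_adj(1) s10(1)] top_adj(2) by simp
    \<comment> \<open>The pulled back unit component is the cocone constant at
      \<open>(\<infinity>, 0)\<close>. Precomposed with the relations
      \<open>(q, 0) \<le> (\<infinity>, 0)\<close>, it becomes the cocone of the bottom face over
      \<open>{1}\<close>.\<close>
    also have "\<dots> = fibre_map ?R B (\<lambda>_. ?p) {1} ?Z ?\<eta> \<cdot>\<^bsub>D0 D ?RB\<^esub> ?t0c"
      by (simp only: s10_def fibre_map_const[OF B Z \<eta> fR p(1)] p(2))
    also have "\<dots> = fibre_map ?R B (\<lambda>p. p) {1} ?Z ?\<eta>"
      by (rule fibre_map_mono[OF B Z \<eta> fR])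
        (simp_all add: p T inc sub del: One_nat_def Pow_iff)
    also have "\<dots> = fa (D1 D ?RB B ?prR) (edge B {} {1} ?Z \<cdot>\<^bsub>D0 D B\<^esub> s00) \<cdot>\<^bsub>D0 D ?RB\<^esub> ?uR ?X0"
      by (rule transpose_edge[OF s00(1,3) T(1,2) _ inc(1) _ le0, symmetric]) simp_all
    finally show "fa (D1 D ?RB B ?prR) (s10 \<cdot>\<^bsub>D0 D B\<^esub> top_map D n B X) \<cdot>\<^bsub>D0 D ?RB\<^esub> ?uR ?X0 = \<dots>" .
  qed (use T in auto)
  have left: "s01 \<cdot>\<^bsub>D0 D B\<^esub> left_map D n B X = edge B {} {2} ?Z \<cdot>\<^bsub>D0 D B\<^esub> s00"
  proof (rule lan_eqI[OF RB B prR X0 cmp_hom[OF cat(1) left_hom s01(1)] cmp_hom[OF cat(1) s00(1) edge_hom]])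
    have "fa (D1 D ?RB B ?prR) (s01 \<cdot>\<^bsub>D0 D B\<^esub> left_map D n B X) \<cdot>\<^bsub>D0 D ?RB\<^esub> ?uR ?X0
        = fa (D1 D ?RB B ?prR) s01 \<cdot>\<^bsub>D0 D ?RB\<^esub> (?uR ?X1 \<cdot>\<^bsub>D0 D ?RB\<^esub> ?t01)"
      using lan_transpose_cmp[OF RB B prR X0 left_hom s01(1)] lan_unit_natural[OF RB B prR t01] by (simp add: left_eq)
    also have "\<dots> = fibre_map ?R B (insert n) {2} ?Z ?\<eta> \<cdot>\<^bsub>D0 D ?RB\<^esub> ?t01"
      using cmp_assoc[OF cat(2) t01 lan_unit_hom[OF RB B prR X1] D1_hom[OF RB B prR s01(1)]] s01(3) by simp
    also have "\<dots> = fibre_map ?R B (\<lambda>p. p) {2} ?Z ?\<eta>"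
      by (rule fibre_map_mono[OF B Z \<eta> fR]) (use T inc le1 in auto)
    also have "\<dots> = fa (D1 D ?RB B ?prR) (edge B {} {2} ?Z \<cdot>\<^bsub>D0 D B\<^esub> s00) \<cdot>\<^bsub>D0 D ?RB\<^esub> ?uR ?X0"
      by (rule transpose_edge[OF s00(1,3) T(1,3) _ inc(1) _ le0, symmetric]) simp_all
    finally show "fa (D1 D ?RB B ?prR) (s01 \<cdot>\<^bsub>D0 D B\<^esub> left_map D n B X) \<cdot>\<^bsub>D0 D ?RB\<^esub> ?uR ?X0 = \<dots>" .
  qed (use T in auto)
  have right: "s11 \<cdot>\<^bsub>D0 D B\<^esub> right_map D n B X = edge B {1} {1, 2} ?Z \<cdot>\<^bsub>D0 D B\<^esub> s10"
  proof -
    have ps: "fa (D1 D (dom_cat B) B ?prP) s11 \<in> hom (D0 D (dom_cat B)) (fo (D1 D (dom_cat B) B ?prP) (fo ?lP X))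
        (fo (D1 D (dom_cat B) B ?prP) (fo (D1 D B (cod_cat B) (cod_slice B {1, 2})) ?Z))"
      using D1_hom[OF PB B prP s11(1)] .
    \<comment> \<open>The slice at \<open>(\<infinity>, 0)\<close> is a section of the projection,
      so \<open>s11\<close> is the restriction of its own pullback and can be merged with the
      colimit unit before restricting.\<close>
    have "s11 = fa (D1 D B (dom_cat B) (dom_slice B ?p)) (fa (D1 D (dom_cat B) B ?prP) s11)"
      using D1_comp_hom[OF B PB B sp prP s11(1)] homD(1)[OF s11(1)] unfolding pr_sp by (simp add: D1_id[OF B])
    then have "s11 \<cdot>\<^bsub>D0 D B\<^esub> right_map D n B X
        = fa (D1 D B (dom_cat B) (dom_slice B ?p)) (fibre_map ?P B (\<lambda>p. p) {1, 2} ?Z ?\<eta>)"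
      using functor_cmp[OF D1_functor[OF B PB sp] uP ps] s11(3) by (simp add: right_eq)
    then show ?thesis
      using fibre_map_slice[OF B Z \<eta> T(4) le p(1)] by (simp only: s10_def p(2))
  qed
  have bottom: "s11 \<cdot>\<^bsub>D0 D B\<^esub> bottom_map D n B X = edge B {2} {1, 2} ?Z \<cdot>\<^bsub>D0 D B\<^esub> s01"
  proof (rule lan_eqI[OF RB B prR X1 cmp_hom[OF cat(1) bottom_adj(1) s11(1)] cmp_hom[OF cat(1) s01(1) edge_hom]])
    have ps: "fa (D1 D (dom_cat B) B ?prP) s11 \<in> hom (D0 D (dom_cat B)) (fo (D1 D (dom_cat B) B ?prP) (fo ?lP X))
        (fo (D1 D (dom_cat B) B ?prP) (fo (D1 D B (cod_cat B) (cod_slice B {1, 2})) ?Z))"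
      using D1_hom[OF PB B prP s11(1)] .
    have "fa (D1 D ?RB B ?prR) (s11 \<cdot>\<^bsub>D0 D B\<^esub> bottom_map D n B X) \<cdot>\<^bsub>D0 D ?RB\<^esub> ?uR ?X1
        = fa (D1 D ?RB B ?prR) s11 \<cdot>\<^bsub>D0 D ?RB\<^esub> fa (D1 D ?RB (dom_cat B) ?j1) (?uP X)"
      using lan_transpose_cmp[OF RB B prR X1 bottom_adj(1) s11(1)] bottom_adj(2) by simp
    \<comment> \<open>The projection from the top face factors through the embedding of that face,
      so the pulled back \<open>s11\<close> and the unit combine to the restriction of the cocone
      over the whole punctured cube.\<close>
    also have "\<dots> = fa (D1 D ?RB (dom_cat B) ?j1) (fibre_map ?P B (\<lambda>p. p) {1, 2} ?Z ?\<eta>)"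
      using D1_comp_hom[OF RB PB B j1 prP s11(1)] functor_cmp[OF D1_functor[OF RB PB j1] uP ps] s11(3)
      unfolding pr_j1 by simp
    also have "\<dots> = fibre_map ?R B (insert n) {1, 2} ?Z ?\<eta>"
      unfolding fibre_map_def[of ?P]
      by (rule fibre_map_restrict[OF B Z \<eta> fR _ _ T(4) le]) (use inc in auto)
    also have "\<dots> = fa (D1 D ?RB B ?prR) (edge B {2} {1, 2} ?Z \<cdot>\<^bsub>D0 D B\<^esub> s01) \<cdot>\<^bsub>D0 D ?RB\<^esub> ?uR ?X1"
      by (rule transpose_edge[OF s01(1,3) T(3,4) _ inc(2) _ le1, symmetric]) auto
    finally show "fa (D1 D ?RB B ?prR) (s11 \<cdot>\<^bsub>D0 D B\<^esub> bottom_map D n B X) \<cdot>\<^bsub>D0 D ?RB\<^esub> ?uR ?X1 = \<dots>" .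
  qed (use T in auto)

  have und: "is_functor square (D0 D B) (underlying D square B ?Z)"
    unfolding cube_def using derivator_on_axioms _ B Z
    by (rule underlying_functor) (simp add: poset_small_cat smallness finite_T)
  have sq: "{} \<subseteq> {1::nat}" "{} \<subseteq> {2::nat}" "{1::nat} \<subseteq> {1, 2}" "{2::nat} \<subseteq> {1, 2}" by simp_all
  show ?thesis
    unfolding colim_square_def
    using square_iso[OF cat(1) und top_adj(1) left_hom right_hom bottom_adj(1)
        s00(1)[folded und_ob[OF T(1)]] s10(1)[folded und_ob[OF T(2)]]
        s01(1)[folded und_ob[OF T(3)]] s11(1)[folded und_ob[OF T(4)]] s00(2) s10(2) s01(2) s11(2)
        top[folded edge[OF T(1,2) sq(1)]] left[folded edge[OF T(1,3) sq(2)]]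
        right[folded edge[OF T(2,4) sq(3)]] bottom[folded edge[OF T(3,4) sq(4)]]] .
qed

end

theorem corollary6p5:
  fixes small :: "'a uni set \<Rightarrow> bool"
    and D :: "('a, 'o, 'm) prederiv"
    and n :: nat
  assumes "smallness small"
    and "derivator small D"
    and "n \<ge> 2"
  shows "\<exists>d. morphism small (shift D (punctured n)) (shift D square) d \<and>
           (\<forall>B X. small_cat small B \<longrightarrow> X \<in> ob (D0 (shift D (punctured n)) B) \<longrightarrow>
              cocartesian D B (fo (mo d B) X) \<and>
              (\<exists>\<theta>. is_nt_iso square (D0 D B)
                     (underlying D square B (fo (mo d B) X)) (colim_square D n B X) \<theta>))"
proof -
  interpret punctured_cube small D n
    using assms by unfold_locales
  show ?thesis
  proof (rule exI[of _ ext_mor], intro conjI allI impI)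
    show "morphism small (shift D (punctured n)) (shift D square) ext_mor"
      using ext_morphism by (simp add: punctured_eq cube_def)
    fix B X assume B: "small_cat small B" and "X \<in> ob (D0 (shift D (punctured n)) B)"
    then have X: "X \<in> ob (D0 D (dom_cat B))" by (simp add: shift_def punctured_eq)
    have "mo ext_mor B = ext B" unfolding ext_mor_def by simp
    then show "cocartesian D B (fo (mo ext_mor B) X)"
      "\<exists>\<theta>. is_nt_iso square (D0 D B) (underlying D square B (fo (mo ext_mor B) X)) (colim_square D n B X) \<theta>"
      using ext_cocartesian[OF B X] ext_underlying[OF B X] by argo+
  qed
qed

end
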